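(* Assume the Riemann hypothesis. Let $0<\beta<1$ be a fixed number and let $0<\lambda<1/2$ be a fixed parameter. For $T$ sufficiently large, for all $t$ with $T^\beta\leq t\leq T\log T$, and for each of the two choices of the sign $\pm$, $$\int_{-(\log T)^{3}}^{(\log T)^{3}}\log\zeta\left(\frac12+i(t+u)\right)\left(\frac{\sin(\lambda u\log\log T)}{u}\right)^2\big(\pm3-2\sin(u\log\log T)\big)\,du=\frac{i\pi}{2}\sum_{n=2}^{\infty}\frac{\Lambda(n)\,w_n}{(\log n)\,n^{\frac12+it}}+O\big((\log T)^{\lambda}\big),$$ where $w_n=\max\{0,\,2\lambda\log\log T-|\log\log T-\log n|\}$ for $n\geq2$. The implied constant (and how large $T$ must be) depends at most on $\beta$ and $\lambda$.
   Context: $\zeta$ is the Riemann zeta-function. $\Lambda$ is the von Mangoldt function: $\Lambda(n)=\log p$ if $n=p^m$ with $p$ prime and $m\geq1$ an integer, and $\Lambda(n)=0$ otherwise. For $\tau>0$ such that $\tau$ is not the ordinate of a zero of $\zeta$, $\log\zeta\left(\frac12+i\tau\right)$ is the value obtained by continuous variation along the polygonal path from $2$ (where $\log\zeta(2)$ is real) to $2+i\tau$ and then to $\frac12+i\tau$; the exceptional $\tau$ are isolated and do not affect the integral. The factor $\left(\frac{\sin(au)}{u}\right)^2$ is interpreted as $a^2$ at $u=0$. *)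

theory Defs
  imports
    "HOL-Complex_Analysis.Complex_Analysis"
    "HOL-Number_Theory.Prime_Powers"
begin

text \<open>
  The Riemann zeta function is the analytic continuation of its Dirichlet series to the plane
  punctured at 1. The value at the pole is irrelevant; fixing it to 0 makes the function unique.
\<close>

definition zeta :: "complex \<Rightarrow> complex" where
  "zeta = (THE f. f holomorphic_on (- {1}) \<and>
                  (\<forall>s. Re s > 1 \<longrightarrow> (\<lambda>n. 1 / of_nat (Suc n) powr s) sums f s) \<and>
                  f 1 = 0)"

text \<open>
  The continuation exists: expanding \<open>(n + 1) powr (1 - s)\<close> around \<open>n\<close> binomially and summing over
  \<open>n\<close> expresses \<open>(s - 1) * zeta s\<close> by values of the same function at \<open>s + 1\<close>, \<open>s + 2\<close>, ... and a
  remainder series that converges further to the left.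
\<close>

lemma holomorphic_series:
  fixes f :: "nat \<Rightarrow> complex \<Rightarrow> complex"
  assumes S: "open S" and f: "\<And>n. f n holomorphic_on S"
    and bd: "\<And>x. x \<in> S \<Longrightarrow> \<exists>d>0. \<exists>M. \<exists>p>1. \<forall>n. \<forall>y\<in>ball x d \<inter> S. cmod (f n y) \<le> M * real (Suc n) powr (-p)"
  shows "\<exists>g. g holomorphic_on S \<and> (\<forall>x\<in>S. (\<lambda>n. f n x) sums g x)"
proof -
  have 1: "f n field_differentiable (at x)" if "x \<in> S" for n x
    using that f S holomorphic_on_imp_differentiable_at by blast
  have 2: "\<exists>d h. 0 < d \<and> summable h \<and> range h \<subseteq> \<real>\<^sub>\<ge>\<^sub>0 \<and>
      (\<forall>\<^sub>F n in sequentially. \<forall>y\<in>ball x d \<inter> S. cmod (f n y) \<le> cmod (h n))" if x: "x \<in> S" for x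
  proof -
    obtain d M p where d: "d > 0" "p > 1"
      and b: "\<And>n y. y \<in> ball x d \<inter> S \<Longrightarrow> cmod (f n y) \<le> M * real (Suc n) powr (-p)"
      using bd[OF x] by blast
    define h where "h = (\<lambda>n. complex_of_real (\<bar>M\<bar> * real (Suc n) powr (-p)))"
    have "summable (\<lambda>n. real (Suc n) powr (-p))"
      using summable_real_powr_iff[of "-p"] d by (subst summable_Suc_iff) simp
    hence "summable h"
      unfolding h_def by (intro summable_of_real summable_mult)
    moreover have "cmod (f n y) \<le> cmod (h n)" if "y \<in> ball x d \<inter> S" for n y
    proof -
      have "cmod (f n y) \<le> M * real (Suc n) powr (-p)" using b that by blast
      also have "\<dots> \<le> \<bar>M\<bar> * real (Suc n) powr (-p)" by (intro mult_right_mono) auto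
      finally show ?thesis by (simp only: h_def norm_of_real) 
    qed
    moreover have "range h \<subseteq> \<real>\<^sub>\<ge>\<^sub>0"
      unfolding h_def by (intro image_subsetI) (auto simp del: of_real_mult)
    ultimately show ?thesis using d by (intro exI[of _ d] exI[of _ h]) auto
  qed
  obtain g where "\<forall>x\<in>S. (\<lambda>n. f n x) sums g x \<and> g field_differentiable (at x)"
    using series_differentiable_comparison_complex[OF S 1 2] by blast
  thus ?thesis
    using S by (auto simp: holomorphic_on_open field_differentiable_def)
qed

lemma binomial_remainder_bound:
  fixes s :: complex
  assumes x: "x > 0" and s: "Re s \<ge> - real K"
  shows "cmod (of_real (x + 1) powr (1 - s) - (\<Sum>k\<le>K. ((1 - s) gchoose k) * of_real x powr (1 - s - of_nat k)))
    \<le> real (Suc K) * cmod ((1 - s) gchoose (Suc K)) * x powr (- Re s - real K)"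
proof -
  define f where "f = (\<lambda>i z. fact i * ((1 - s) gchoose i) * z powr (1 - s - of_nat i))"
  let ?S = "closed_segment (complex_of_real x) (of_real (x + 1))"
  have S: "z \<in> \<real> \<and> Re z \<ge> x" if "z \<in> ?S" for z
  proof -
    have "z \<in> of_real ` closed_segment x (x + 1)"
      using that by (metis closed_segment_of_real)
    thus ?thesis by (auto simp: closed_segment_eq_real_ivl)
  qed
  have "cmod (f 0 (of_real (x + 1)) - (\<Sum>i\<le>K. f i (of_real x) * (of_real (x + 1) - of_real x) ^ i / fact i))
     \<le> (fact (Suc K) * cmod ((1 - s) gchoose (Suc K)) * x powr (- Re s - real K)) *
        cmod (of_real (x + 1) - of_real x) ^ (Suc K) / fact K"
  proof (rule field_Taylor[of ?S])
    fix i z assume z: "z \<in> ?S"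
    have z': "z \<notin> \<real>\<^sub>\<le>\<^sub>0"
      using S[OF z] x by (auto simp: complex_nonpos_Reals_iff)
    have "(f i has_field_derivative fact i * ((1 - s) gchoose i) * ((1 - s - of_nat i) * z powr (1 - s - of_nat i - 1))) (at z)"
      unfolding f_def by (intro DERIV_cmult has_field_derivative_powr z')
    also have "fact i * ((1 - s) gchoose i) * ((1 - s - of_nat i) * z powr (1 - s - of_nat i - 1)) = f (Suc i) z"
    proof -
      have e: "1 - s - of_nat i - 1 = 1 - s - of_nat (Suc i)" by simp
      have g: "((1 - s) gchoose i) * (1 - s - of_nat i) = of_nat (Suc i) * ((1 - s) gchoose (Suc i))"
        by (metis gbinomial_absorb_comp gbinomial_absorption mult.commute)
      have "fact i * ((1 - s) gchoose i) * ((1 - s - of_nat i) * z powr (1 - s - of_nat i - 1))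
          = fact i * (((1 - s) gchoose i) * (1 - s - of_nat i)) * z powr (1 - s - of_nat (Suc i))"
        unfolding e by (simp only: mult_ac)
      also have "\<dots> = f (Suc i) z" unfolding g f_def by (simp add: algebra_simps)
      finally show ?thesis .
    qed
    finally show "(f i has_field_derivative f (Suc i) z) (at z within ?S)"
      by (rule has_field_derivative_at_within)
  next
    fix z assume z: "z \<in> ?S"
    have "cmod (z powr (1 - s - of_nat (Suc K))) = Re z powr (- Re s - real K)"
      using S[OF z] x by (subst norm_powr_real_powr) auto
    also have "\<dots> \<le> x powr (- Re s - real K)"
      using S[OF z] x s by (intro powr_mono2') auto
    finally show "cmod (f (Suc K) z) \<le> fact (Suc K) * cmod ((1 - s) gchoose (Suc K)) * x powr (- Re s - real K)"
      unfolding f_def norm_mult norm_fact by (intro mult_left_mono) auto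
  qed auto
  also have "of_real (x + 1) - complex_of_real x = 1" by simp
  also have "fact (Suc K) * cmod ((1 - s) gchoose (Suc K)) * x powr (- Re s - real K) * cmod 1 ^ (Suc K) / fact K
      = real (Suc K) * cmod ((1 - s) gchoose (Suc K)) * x powr (- Re s - real K)"
    by (simp add: field_simps)
  finally show ?thesis by (simp add: f_def)
qed

lemma holomorphic_gbinomial [holomorphic_intros]:
  "f holomorphic_on A \<Longrightarrow> (\<lambda>z. (f z :: complex) gchoose k) holomorphic_on A"
  unfolding gbinomial_prod_rev by (auto intro!: holomorphic_intros)

lemma powr_tendsto_0:
  assumes "Re s > 1"
  shows "(\<lambda>n. of_nat (Suc n) powr (1 - s)) \<longlonglongrightarrow> 0"
proof -
  have "(\<lambda>n. real (Suc n) powr (1 - Re s)) \<longlonglongrightarrow> 0"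
    using assms by (intro tendsto_neg_powr filterlim_compose[OF filterlim_real_sequentially filterlim_Suc]) auto
  moreover have "cmod (of_nat (Suc n) powr (1 - s)) = real (Suc n) powr (1 - Re s)" for n
    by (subst norm_powr_real_powr) auto
  ultimately show ?thesis by (subst tendsto_norm_zero_iff[symmetric]) simp
qed

lemma dirichlet_series_holomorphic:
  "\<exists>Z. Z holomorphic_on {s. Re s > 1} \<and> (\<forall>s. Re s > 1 \<longrightarrow> (\<lambda>n. 1 / of_nat (Suc n) powr s) sums Z s)"
proof -
  have "\<exists>Z. Z holomorphic_on {s. Re s > 1} \<and> (\<forall>s\<in>{s. Re s > 1}. (\<lambda>n. 1 / of_nat (Suc n) powr s) sums Z s)"
  proof (rule holomorphic_series)
    show "open {s. Re s > 1}" by (rule open_halfspace_Re_gt)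
  next
    fix n show "(\<lambda>s. 1 / of_nat (Suc n) powr s) holomorphic_on {s. Re s > 1}"
      by (auto intro!: holomorphic_intros simp del: of_nat_Suc)
  next
    fix s assume "s \<in> {s. Re s > 1}"
    hence s: "Re s > 1" by simp
    define d where "d = (Re s - 1) / 2"
    have "cmod (1 / of_nat (Suc n) powr y) \<le> 1 * real (Suc n) powr (- (1 + d))" if y: "y \<in> ball s d" for n y
    proof -
      have "Re s - Re y \<le> cmod (s - y)" by (metis complex_Re_le_cmod minus_complex.sel(1))
      hence "Re y \<ge> 1 + d" using y by (auto simp: d_def dist_norm field_simps)
      have "cmod (1 / of_nat (Suc n) powr y) = real (Suc n) powr (- Re y)"
        by (simp add: norm_divide norm_powr_real_powr powr_minus field_simps del: of_nat_Suc)
      also have "\<dots> \<le> real (Suc n) powr (- (1 + d))"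
        using \<open>Re y \<ge> 1 + d\<close> by (intro powr_mono) auto
      finally show ?thesis by simp
    qed
    moreover have "d > 0" using s by (simp add: d_def)
    ultimately show "\<exists>d>0. \<exists>M. \<exists>p>1. \<forall>n. \<forall>y\<in>ball s d \<inter> {s. 1 < Re s}.
        cmod (1 / of_nat (Suc n) powr y) \<le> M * real (Suc n) powr - p"
      by (intro exI[of _ d] conjI exI[of _ 1] exI[of _ "1 + d"]) auto
  qed
  thus ?thesis by simp
qed

lemma remainder_series_holomorphic:
  "\<exists>R. R holomorphic_on {s. Re s > 1 - real K} \<and> (\<forall>s. Re s > 1 - real K \<longrightarrow>
     (\<lambda>n. of_nat (Suc (Suc n)) powr (1 - s) -
        (\<Sum>k\<le>K. ((1 - s) gchoose k) * of_nat (Suc n) powr (1 - s - of_nat k))) sums R s)"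
  (is "\<exists>R. _ \<and> (\<forall>s. _ \<longrightarrow> (\<lambda>n. ?f n s) sums _)")
proof -
  have "\<exists>R. R holomorphic_on {s. Re s > 1 - real K} \<and> (\<forall>s\<in>{s. Re s > 1 - real K}. (\<lambda>n. ?f n s) sums R s)"
  proof (rule holomorphic_series)
    show "open {s. Re s > 1 - real K}" by (rule open_halfspace_Re_gt)
  next
    fix n show "?f n holomorphic_on {s. Re s > 1 - real K}"
      by (auto intro!: holomorphic_intros simp del: of_nat_Suc)
  next
    fix s assume "s \<in> {s. Re s > 1 - real K}"
    hence s: "Re s > 1 - real K" by simp
    define d where "d = (Re s - (1 - real K)) / 2"
    have d: "d > 0" using s by (simp add: d_def)
    have "compact ((\<lambda>z. (1 - z) gchoose (Suc K)) ` cball s d)"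
      by (intro compact_continuous_image holomorphic_on_imp_continuous_on holomorphic_intros) auto
    then obtain M where M: "\<And>z. z \<in> cball s d \<Longrightarrow> cmod ((1 - z) gchoose (Suc K)) \<le> M"
      by (meson bounded_iff compact_imp_bounded imageI)
    have "cmod (?f n y) \<le> (real (Suc K) * M) * real (Suc n) powr (- (1 + d))" if y: "y \<in> ball s d" for n y
    proof -
      have "Re s - Re y \<le> cmod (s - y)" by (metis complex_Re_le_cmod minus_complex.sel(1))
      hence Re: "Re y \<ge> 1 - real K + d" using y by (auto simp: d_def dist_norm field_simps)
      have "cmod (?f n y) \<le> real (Suc K) * cmod ((1 - y) gchoose (Suc K)) * real (Suc n) powr (- Re y - real K)"
        using binomial_remainder_bound[of "real (Suc n)" K y] Re d by (simp add: add.commute)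
      also have "\<dots> \<le> real (Suc K) * M * real (Suc n) powr (- (1 + d))"
        using Re M[of y] y d by (intro mult_mono powr_mono mult_nonneg_nonneg order.trans[OF norm_ge_zero M[of y]]) auto
      finally show ?thesis .
    qed
    thus "\<exists>d>0. \<exists>M. \<exists>p>1. \<forall>n. \<forall>y\<in>ball s d \<inter> {s. 1 - real K < Re s}.
        cmod (?f n y) \<le> M * real (Suc n) powr - p"
      using d by (intro exI[of _ d] conjI exI[of _ "real (Suc K) * M"] exI[of _ "1 + d"]) auto
  qed
  thus ?thesis by simp
qed

lemma continuation_to_halfplane:
  assumes Z: "\<And>s. Re s > 1 \<Longrightarrow> (\<lambda>n. 1 / of_nat (Suc n) powr s) sums Z s"
    and Z_hol: "Z holomorphic_on {s. Re s > 1}"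
  shows "\<exists>E. E holomorphic_on {s. Re s > 1 - real m} \<and> (\<forall>s. Re s > 1 \<longrightarrow> E s = (s - 1) * Z s)"
proof (induction m)
  case 0
  show ?case
    by (intro exI[of _ "\<lambda>s. (s - 1) * Z s"]) (auto intro!: holomorphic_intros Z_hol)
next
  case (Suc m)
  then obtain E where E: "E holomorphic_on {s. Re s > 1 - real m}"
      "\<And>s. Re s > 1 \<Longrightarrow> E s = (s - 1) * Z s" by auto
  obtain R where R: "R holomorphic_on {s. Re s > 1 - real (m + 2)}"
    "\<And>s. Re s > 1 - real (m + 2) \<Longrightarrow> (\<lambda>n. of_nat (Suc (Suc n)) powr (1 - s) -
        (\<Sum>k\<le>m + 2. ((1 - s) gchoose k) * of_nat (Suc n) powr (1 - s - of_nat k))) sums R s"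
    using remainder_series_holomorphic[of "m + 2"] by blast
  define F where "F = (\<lambda>s. R s + 1 - (\<Sum>k\<le>m. ((1 - s) gchoose (Suc k)) / of_nat (k + 2) * E (s + of_nat (Suc k))))"
  have "F holomorphic_on {s. Re s > 1 - real (Suc m)}"
  proof -
    have "(\<lambda>s. E (s + of_nat (Suc k))) holomorphic_on {s. Re s > 1 - real (Suc m)}" for k
      by (rule holomorphic_on_compose_gen[OF _ E(1), of "\<lambda>s. s + of_nat (Suc k)", unfolded o_def])
         (auto intro!: holomorphic_intros)
    moreover have "R holomorphic_on {s. Re s > 1 - real (Suc m)}"
      by (rule holomorphic_on_subset[OF R(1)]) auto
    moreover have "of_nat (k + 2) \<noteq> (0 :: complex)" for k
      by (simp only: of_nat_eq_0_iff)
    ultimately show ?thesis unfolding F_def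
      by (intro holomorphic_intros) auto
  qed
  moreover have "F s = (s - 1) * Z s" if s: "Re s > 1" for s
  proof -
    define a where "a = (\<lambda>n. of_nat (Suc n) powr (1 - s))"
    have "(\<lambda>n. a (Suc n) - a n) sums (0 - a 0)"
      by (intro telescope_sums) (use powr_tendsto_0[OF s] in \<open>simp add: a_def\<close>)
    hence 1: "(\<lambda>n. a (Suc n) - a n) sums (- 1)" by (simp add: a_def)
    have t: "of_nat (Suc n) powr (1 - s - of_nat (Suc k)) = 1 / of_nat (Suc n) powr (s + of_nat k)" for n k
    proof -
      have "1 - s - of_nat (Suc k) = - (s + of_nat k)" by simp
      thus ?thesis by (simp only: powr_minus_divide)
    qed
    have 2: "(\<lambda>n. \<Sum>k\<le>m + 1. ((1 - s) gchoose (Suc k)) * of_nat (Suc n) powr (1 - s - of_nat (Suc k)))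
          sums (\<Sum>k\<le>m + 1. ((1 - s) gchoose (Suc k)) * Z (s + of_nat k))"
      unfolding t using s by (intro sums_sum sums_mult Z) auto
    have "of_nat (Suc (Suc n)) powr (1 - s) -
        (\<Sum>k\<le>m + 2. ((1 - s) gchoose k) * of_nat (Suc n) powr (1 - s - of_nat k))
        = a (Suc n) - a n - (\<Sum>k\<le>m + 1. ((1 - s) gchoose (Suc k)) * of_nat (Suc n) powr (1 - s - of_nat (Suc k)))" for n
    proof -
      have "m + 2 = Suc (m + 1)" by simp
      show ?thesis unfolding \<open>m + 2 = Suc (m + 1)\<close> sum.atMost_Suc_shift
        by (simp add: a_def del: of_nat_Suc)
    qed
    hence "(\<lambda>n. a (Suc n) - a n - (\<Sum>k\<le>m + 1. ((1 - s) gchoose (Suc k)) * of_nat (Suc n) powr (1 - s - of_nat (Suc k)))) sums R s"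
      using R(2)[of s] s by simp
    with sums_diff[OF 1 2] have "R s = - 1 - (\<Sum>k\<le>m + 1. ((1 - s) gchoose (Suc k)) * Z (s + of_nat k))"
      using sums_unique2 by blast
    also have "(\<Sum>k\<le>m + 1. ((1 - s) gchoose (Suc k)) * Z (s + of_nat k))
       = (1 - s) * Z s + (\<Sum>k\<le>m. ((1 - s) gchoose (k + 2)) * Z (s + of_nat (Suc k)))"
    proof -
      have "m + 1 = Suc m" by simp
      show ?thesis unfolding \<open>m + 1 = Suc m\<close> sum.atMost_Suc_shift by simp
    qed
    also have "(\<Sum>k\<le>m. ((1 - s) gchoose (k + 2)) * Z (s + of_nat (Suc k)))
      = - (\<Sum>k\<le>m. ((1 - s) gchoose (Suc k)) / of_nat (k + 2) * E (s + of_nat (Suc k)))"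
      unfolding sum_negf[symmetric]
    proof (rule sum.cong[OF refl])
      fix k
      have nz: "of_nat (Suc (Suc k)) \<noteq> (0 :: complex)"
        by (simp only: of_nat_eq_0_iff)
      have "of_nat (Suc (Suc k)) * ((1 - s) gchoose (Suc (Suc k))) = ((1 - s) gchoose (Suc k)) * (1 - s - of_nat (Suc k))"
        by (metis gbinomial_absorb_comp gbinomial_absorption mult.commute)
      hence g: "((1 - s) gchoose (k + 2)) = ((1 - s) gchoose (Suc k)) * (1 - s - of_nat (Suc k)) / of_nat (k + 2)"
        using nz by (simp add: nonzero_eq_divide_eq mult.commute del: of_nat_Suc)
      have e: "E (s + of_nat (Suc k)) = (s + of_nat (Suc k) - 1) * Z (s + of_nat (Suc k))"
        using s by (intro E(2)) simp
      have m: "1 - s - of_nat (Suc k) = - (s + of_nat (Suc k) - 1)" by simp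
      have *: "c * (- b) / q * z = - (c / q * (b * z))" for c b q z :: complex
        by simp
      show "((1 - s) gchoose (k + 2)) * Z (s + of_nat (Suc k))
          = - (((1 - s) gchoose (Suc k)) / of_nat (k + 2) * E (s + of_nat (Suc k)))"
        unfolding g e m by (rule *)
    qed
    finally show ?thesis unfolding F_def by (simp add: algebra_simps)
  qed
  ultimately show ?case by blast
qed

lemma zeta_continuation_exists:
  "\<exists>f. f holomorphic_on (- {1}) \<and>
       (\<forall>s. Re s > 1 \<longrightarrow> (\<lambda>n. 1 / of_nat (Suc n) powr s) sums f s) \<and> f 1 = 0"
proof -
  obtain Z where Z: "Z holomorphic_on {s. Re s > 1}"
      "\<And>s. Re s > 1 \<Longrightarrow> (\<lambda>n. 1 / of_nat (Suc n) powr s) sums Z s"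
    using dirichlet_series_holomorphic by blast
  obtain E where E: "\<And>m. E m holomorphic_on {s. Re s > 1 - real m}"
      "\<And>m s. Re s > 1 \<Longrightarrow> E m s = (s - 1) * Z s"
    using continuation_to_halfplane[OF Z(2,1)] by metis
  have agree: "E m s = E k s" if "m \<le> k" "Re s > 1 - real m" for m k s
  proof (rule analytic_continuation_open[where f = "E m" and g = "E k"
          and s = "{s. Re s > 1}" and s' = "{s. Re s > 1 - real m}"])
    show "{s::complex. 1 < Re s} \<noteq> {}" by (auto intro: exI[of _ 2])
    show "connected {s. 1 - real m < Re s}" by (intro convex_connected convex_halfspace_Re_gt)
    show "E k holomorphic_on {s. 1 - real m < Re s}"
      by (rule holomorphic_on_subset[OF E(1)]) (use that in auto)
  qed (use E that open_halfspace_Re_gt in auto)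
  define idx where "idx = (\<lambda>s. nat \<lceil>2 - Re s\<rceil>)"
  have idx: "Re s > 1 - real (idx s)" for s
    unfolding idx_def by linarith
  define G where "G = (\<lambda>s. E (idx s) s)"
  have G_eq: "G s = E m s" if "Re s > 1 - real m" for s m
  proof (cases "idx s \<le> m")
    case True
    thus ?thesis unfolding G_def using idx by (rule agree)
  next
    case False
    thus ?thesis unfolding G_def using that by (intro agree[symmetric]) auto
  qed
  have "G holomorphic_on UNIV"
    unfolding holomorphic_on_open[OF open_UNIV]
  proof
    fix s
    have "(E (idx s) has_field_derivative deriv (E (idx s)) s) (at s)"
      using E(1) idx open_halfspace_Re_gt by (intro holomorphic_derivI[of _ "{z. Re z > 1 - real (idx s)}"]) auto
    hence "(G has_field_derivative deriv (E (idx s)) s) (at s)"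
      by (rule has_field_derivative_transform_within_open
          [where S = "{z. Re z > 1 - real (idx s)}"]) (use idx open_halfspace_Re_gt G_eq in auto)
    thus "\<exists>f'. (G has_field_derivative f') (at s)" by blast
  qed
  define f where "f = (\<lambda>s. if s = 1 then 0 else G s / (s - 1))"
  have "(\<lambda>s. G s / (s - 1)) holomorphic_on (- {1})"
    using \<open>G holomorphic_on UNIV\<close> by (auto intro!: holomorphic_intros intro: holomorphic_on_subset)
  hence "f holomorphic_on (- {1})"
    by (rule holomorphic_transform) (auto simp: f_def)
  moreover have "(\<lambda>n. 1 / of_nat (Suc n) powr s) sums f s" if "Re s > 1" for s
  proof -
    have "s \<noteq> 1" using that by auto
    moreover have "G s = (s - 1) * Z s" using G_eq[of 0 s] E(2)[of s 0] that by simp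
    ultimately have "f s = Z s" by (simp add: f_def)
    thus ?thesis using Z(2)[OF that] by simp
  qed
  moreover have "f 1 = 0" by (simp add: f_def)
  ultimately show ?thesis by blast
qed

lemma zeta_unique:
  assumes "f holomorphic_on (- {1})" "\<forall>s. Re s > 1 \<longrightarrow> (\<lambda>n. 1 / of_nat (Suc n) powr s) sums f s" "f 1 = 0"
  assumes "g holomorphic_on (- {1})" "\<forall>s. Re s > 1 \<longrightarrow> (\<lambda>n. 1 / of_nat (Suc n) powr s) sums g s" "g 1 = 0"
  shows "f = g"
proof
  fix s
  show "f s = g s"
  proof (cases "s = 1")
    case False
    show ?thesis
    proof (rule analytic_continuation_open[where f = f and g = g and s = "{s. Re s > 1}" and s' = "- {1}"])
      show "{s::complex. 1 < Re s} \<noteq> {}" by (auto intro: exI[of _ 2])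
      show "connected (- {1 :: complex})" by (intro connected_punctured_universe) simp
      show "\<And>z. z \<in> {s. 1 < Re s} \<Longrightarrow> f z = g z"
        using assms(2,5) sums_unique2 by blast
    qed (use assms False open_halfspace_Re_gt in auto)
  qed (use assms in simp)
qed

lemma
  shows zeta_holomorphic: "zeta holomorphic_on (- {1})"
    and zeta_sums: "Re s > 1 \<Longrightarrow> (\<lambda>n. 1 / of_nat (Suc n) powr s) sums zeta s"
    and zeta_1: "zeta 1 = 0"
proof -
  have "\<exists>!f. f holomorphic_on (- {1}) \<and>
       (\<forall>s. Re s > 1 \<longrightarrow> (\<lambda>n. 1 / of_nat (Suc n) powr s) sums f s) \<and> f 1 = 0"
    using zeta_continuation_exists zeta_unique by (intro ex_ex1I) blast+
  from theI'[OF this]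
  show "zeta holomorphic_on (- {1})" "zeta 1 = 0"
    and "Re s > 1 \<Longrightarrow> (\<lambda>n. 1 / of_nat (Suc n) powr s) sums zeta s"
    unfolding zeta_def by blast+
qed

definition riemann_hypothesis :: bool where
  "riemann_hypothesis \<longleftrightarrow> (\<forall>s. zeta s = 0 \<and> 0 < Re s \<and> Re s < 1 \<longrightarrow> Re s = 1 / 2)"

text \<open>
  \<open>log_along f \<gamma>\<close> is the value at the endpoint of \<open>\<gamma>\<close> of the logarithm of \<open>f\<close> obtained by
  continuous variation along \<open>\<gamma>\<close>, starting from a real value. It is meaningful only if \<open>f\<close> is
  continuous and nonzero along \<open>\<gamma>\<close> and positive at its starting point; the continuous lift \<open>g\<close>
  is then unique.
\<close>

definition log_along :: "(complex \<Rightarrow> complex) \<Rightarrow> (real \<Rightarrow> complex) \<Rightarrow> complex" where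
  "log_along f \<gamma> = (THE w. \<exists>g. continuous_on {0..1} g \<and>
                             (\<forall>x\<in>{0..1}. exp (g x) = f (\<gamma> x)) \<and>
                             g 0 \<in> \<real> \<and> g 1 = w)"

definition log_zeta :: "complex \<Rightarrow> complex" where
  "log_zeta s = log_along zeta (linepath 2 (Complex 2 (Im s)) +++ linepath (Complex 2 (Im s)) s)"

definition fejer_factor :: "real \<Rightarrow> real \<Rightarrow> real" where
  "fejer_factor a u = (if u = 0 then a\<^sup>2 else (sin (a * u) / u)\<^sup>2)"

end

theory Submission
  imports Defs "HOL-Probability.Sinc_Integral"
begin

text \<open>
  Write \<open>L = ln (ln T)\<close>, \<open>a = lam * L\<close>, \<open>H = ln T ^ 3\<close>. The weight in the integral is the restriction to the
  real line of the entire function \<open>K w = (sin (a * w) / w)^2 * (3 * \<sigma> - 2 * sin (L * w))\<close>, and \<open>log_zeta\<close> is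
  holomorphic to the right of the critical line under the Riemann hypothesis. So the segment of integration,
  which lies on the line \<open>Re s = 1/2\<close> in the variable \<open>s = 1/2 + \<i> * (t + u)\<close>, can be pushed to the line
  \<open>Re s = 2\<close>, where \<open>log_zeta\<close> is the absolutely convergent series \<open>\<Sum>n. \<Lambda>(n) / ln n * n powr (-s)\<close>.

  The growth of \<open>K\<close> in the imaginary direction is harmless because \<open>2 * lam < 1\<close>: at height \<open>3/2\<close> below the real
  axis it contributes a factor \<open>exp ((2 * a + L) * 3/2) \<le> exp (3 * L) = H\<close>, against a decay of \<open>1/u^2\<close>. On the two vertical
  ends \<open>u = \<plusminus>H\<close> this leaves \<open>O(1/H)\<close> times the integral of \<open>|log_zeta|\<close> over a horizontal segment reaching the
  critical line, which is bounded by a multiple of \<open>ln T\<close>. On the line \<open>Re s = 2\<close> the tails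
  \<open>|u| > H\<close> contribute only \<open>O(H * 1/H) = O(1)\<close>, so every term of the series may be integrated over the whole line.

  The integral of the \<open>n\<close>-th term over the whole line is moved back to the real axis, where it is a Fourier
  transform of the Fejer kernel, i.e. a tent of half-width \<open>2 * a\<close>. Because
  \<open>-2 * sin (L * u) = \<i> * (cis (L * u) - cis (-L * u))\<close>, the tents are centred at \<open>ln n = 0\<close>, \<open>ln n = L\<close> and
  \<open>ln n = -L\<close>. The second one is the main term. The third one does not meet the numbers \<open>ln n \<ge> 0\<close>, again because
  \<open>2 * lam < 1\<close>. The first one gives \<open>\<Sum>n\<le>x. n powr (-1/2) * ln (x/n) = O(sqrt x)\<close> with \<open>x = exp (2 * a)\<close>, which is
  the error term, as \<open>sqrt x = ln T powr lam\<close>.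

  The analytic input is the control of \<open>log_zeta\<close> up to the critical line, \<open>local_log_zeta\<close>: in a disc around
  \<open>2 + \<i> * \<tau>\<close> that crosses the line, \<open>log_zeta s\<close> is a function of size \<open>O(ln \<tau>)\<close> plus \<open>O(ln \<tau>)\<close> many
  logarithms \<open>Ln (s - \<rho>)\<close>, with all \<open>\<rho>\<close> on the line. A logarithm is integrable, and it is dominated by the
  logarithm of the distance of the imaginary parts (for points approaching the line) or of the real parts (for points
  on a horizontal segment). The first bound justifies the passage to the critical line itself
  (\<open>critical_line_limit\<close>), the second one bounds the horizontal segments (\<open>log_zeta_bound\<close>). The remaining
  ingredients are \<open>shift_log_zeta_integral\<close> for the first move of the contour, \<open>kernel_transform_tail\<close> and
  \<open>dirichlet_integral\<close> for the terms of the series, and \<open>transform_sum_estimate\<close> for the evaluation of the sum.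
\<close>

section \<open>Growth of zeta in the right half-plane\<close>

text \<open>
  Summing the binomial expansion \<open>(n+1) powr (1-s) = n powr (1-s) + (1-s) * n powr (-s) + ...\<close> over \<open>n\<close> telescopes
  on the left, so \<open>(s - 1) * zeta s - 1\<close> is the sum of the second order remainders. That sum converges for
  \<open>Re s > 0\<close>, and each remainder carries the factor \<open>s * (s - 1)\<close>.
\<close>

lemma zeta_growth:
  "\<exists>C>0. \<forall>s. Re s \<ge> 1 / 10 \<longrightarrow> cmod ((s - 1) * zeta s) \<le> 1 + C * cmod s * cmod (s - 1)"
proof -
  obtain R where R: "R holomorphic_on {s. Re s > 0}"
    "\<And>s. Re s > 0 \<Longrightarrow> (\<lambda>n. of_nat (Suc (Suc n)) powr (1 - s) -
        (\<Sum>k\<le>1. ((1 - s) gchoose k) * of_nat (Suc n) powr (1 - s - of_nat k))) sums R s"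
    using remainder_series_holomorphic[of 1] by auto
  have eq: "(s - 1) * zeta s = 1 + R s" if s: "Re s > 1" for s
  proof -
    define a where "a = (\<lambda>n. of_nat (Suc n) powr (1 - s))"
    have "(\<lambda>n. a (Suc n) - a n) sums (0 - a 0)"
      by (intro telescope_sums) (use powr_tendsto_0[OF s] in \<open>simp add: a_def\<close>)
    hence "(\<lambda>n. (a (Suc n) - a n) - (1 - s) * (1 / of_nat (Suc n) powr s)) sums (-1 - (1 - s) * zeta s)"
      by (intro sums_diff sums_mult zeta_sums s) (simp add: a_def)
    moreover have "(a (Suc n) - a n) - (1 - s) * (1 / of_nat (Suc n) powr s) =
        of_nat (Suc (Suc n)) powr (1 - s) -
        (\<Sum>k\<le>1. ((1 - s) gchoose k) * of_nat (Suc n) powr (1 - s - of_nat k))" for n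
    proof -
      have e: "(\<Sum>k\<le>1. (z gchoose k) * x powr (z - of_nat k)) = x powr z + z * x powr (z - 1)" for x z :: complex
        by simp
      have "1 - s - 1 = - s" by simp
      thus ?thesis unfolding e a_def by (simp only: powr_minus_divide) (simp del: of_nat_Suc)
    qed
    ultimately have "R s = -1 - (1 - s) * zeta s"
      using R(2)[of s] s sums_unique2 by auto
    thus ?thesis by (simp add: algebra_simps)
  qed
  have eq': "(s - 1) * zeta s = 1 + R s" if s: "Re s > 0" "s \<noteq> 1" for s
  proof (rule analytic_continuation_open[where s = "{s. Re s > 1}" and s' = "{s. Re s > 0} - {1}"
        and f = "\<lambda>s. (s - 1) * zeta s" and g = "\<lambda>s. 1 + R s"])
    show "open ({s. Re s > 0} - {1 :: complex})" "open {s. Re s > 1}"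
      by (auto intro!: open_halfspace_Re_gt)
    show "{s::complex. 1 < Re s} \<noteq> {}" by (auto intro: exI[of _ 2])
    show "connected ({s. Re s > 0} - {1 :: complex})"
      by (intro connected_open_delete convex_connected convex_halfspace_Re_gt open_halfspace_Re_gt) auto
    show "(\<lambda>s. (s - 1) * zeta s) holomorphic_on {s. 0 < Re s} - {1}"
      by (intro holomorphic_intros holomorphic_on_subset[OF zeta_holomorphic]) auto
    show "(\<lambda>s. 1 + R s) holomorphic_on {s. 0 < Re s} - {1}"
      by (intro holomorphic_intros holomorphic_on_subset[OF R(1)]) auto
  qed (use eq s in auto)
  define Z where "Z = (\<Sum>n. real (Suc n) powr (- (11 / 10)))"
  have sm: "summable (\<lambda>n. real (Suc n) powr (- (11 / 10)))"
    using summable_real_powr_iff[of "- (11/10)"] by (subst summable_Suc_iff) simp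
  have "Z > 0" unfolding Z_def by (rule suminf_pos[OF sm]) auto
  have bd: "cmod ((s - 1) * zeta s) \<le> 1 + Z * cmod s * cmod (s - 1)" if s: "Re s \<ge> 1 / 10" for s
  proof (cases "s = 1")
    case False
    let ?t = "\<lambda>n. of_nat (Suc (Suc n)) powr (1 - s) -
        (\<Sum>k\<le>1. ((1 - s) gchoose k) * of_nat (Suc n) powr (1 - s - of_nat k))"
    have ch: "cmod ((1 - s) gchoose Suc 1) * 2 = cmod s * cmod (s - 1)"
    proof -
      have e: "((1 - s) gchoose Suc 1) = (1 - s) * (1 - s - 1) / 2"
        by (simp add: gbinomial_prod_rev numeral_2_eq_2 prod.atLeast0_lessThan_Suc)
      show ?thesis unfolding e by (simp add: norm_mult norm_divide norm_minus_commute)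
    qed
    have b: "cmod (?t n) \<le> (cmod s * cmod (s - 1)) * real (Suc n) powr (- (11 / 10))" for n
    proof -
      have "cmod (?t n) \<le> real (Suc 1) * cmod ((1 - s) gchoose Suc 1) * real (Suc n) powr (- Re s - real 1)"
        using binomial_remainder_bound[of "real (Suc n)" 1 s] s by (simp add: add.commute)
      also have "\<dots> = (cmod s * cmod (s - 1)) * real (Suc n) powr (- Re s - real 1)"
        using ch by (simp add: mult.commute)
      also have "\<dots> \<le> (cmod s * cmod (s - 1)) * real (Suc n) powr (- (11 / 10))"
        using s by (intro mult_left_mono powr_mono) auto
      finally show ?thesis .
    qed
    have "cmod (R s) \<le> (\<Sum>n. (cmod s * cmod (s - 1)) * real (Suc n) powr (- (11 / 10)))"
      using R(2)[of s] s sums_unique[of ?t "R s"] norm_suminf_le[of ?t, OF b summable_mult[OF sm]] by auto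
    also have "\<dots> = Z * cmod s * cmod (s - 1)"
      unfolding Z_def by (subst suminf_mult[OF sm]) (simp add: mult_ac)
    finally show ?thesis
      using eq'[of s] s False norm_triangle_ineq[of 1 "R s"] by (auto simp: norm_one)
  qed (auto simp: zeta_1)
  thus ?thesis using \<open>Z > 0\<close> by blast
qed

section \<open>The Dirichlet series of the logarithm\<close>

text \<open>
  For \<open>n < 2\<close> the numerator vanishes, so the value is 0 and sums over \<open>log_coeff\<close> may start anywhere.
\<close>

definition log_coeff :: "nat \<Rightarrow> real" where
  "log_coeff n = mangoldt n / ln (real n)"

lemma log_coeff_0 [simp]: "log_coeff 0 = 0" and log_coeff_1 [simp]: "log_coeff (Suc 0) = 0"
  by (auto simp: log_coeff_def)

lemma log_coeff_nonneg: "log_coeff n \<ge> 0"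
  by (cases "n = 0") (auto simp: log_coeff_def intro!: divide_nonneg_nonneg mangoldt_nonneg)

lemma log_coeff_le_1: "log_coeff n \<le> 1"
proof (cases "n \<ge> 2")
  case True
  thus ?thesis using mangoldt_le[of n] by (simp add: log_coeff_def divide_le_eq)
next
  case False
  hence "n = 0 \<or> n = Suc 0" by auto
  thus ?thesis by auto
qed

lemma norm_dirichlet_term:
  "n > 0 \<Longrightarrow> cmod (1 / of_nat n powr s) = real n powr (- Re s)"
  by (simp add: norm_divide norm_powr_real_powr powr_minus field_simps)

text \<open>
  The two cases needed are \<open>c = log_coeff\<close> and \<open>c = 1\<close>; they supply both sides of the identity
  \<open>zeta' = zeta * dirichlet_log'\<close>. The term \<open>n = 0\<close> vanishes since \<open>0 powr x = 0\<close> and division by 0 gives 0.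
\<close>

lemma dirichlet_series_deriv:
  fixes c :: "nat \<Rightarrow> real"
  assumes c: "\<And>n. \<bar>c n\<bar> \<le> 1"
  shows "\<exists>g g'. \<forall>x\<in>{s. Re s > 1}. (\<lambda>n. of_real (c n) * (1 / of_nat n powr x)) sums g x \<and>
     (\<lambda>n. - of_real (ln (real n) * c n) * (1 / of_nat n powr x)) sums g' x \<and>
     (g has_field_derivative g' x) (at x)"
proof (rule series_and_derivative_comparison_local)
  show "open {s. Re s > 1}" by (rule open_halfspace_Re_gt)
next
  fix n :: nat and x :: complex assume x: "x \<in> {s. Re s > 1}"
  show "((\<lambda>x. of_real (c n) * (1 / of_nat n powr x)) has_field_derivative
     - of_real (ln (real n) * c n) * (1 / of_nat n powr x)) (at x)"
  proof (cases "n = 0")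
    case False
    thus ?thesis
      by (auto intro!: derivative_eq_intros simp: field_simps Ln_of_nat power2_eq_square)
  qed auto
next
  fix s :: complex assume "s \<in> {s. Re s > 1}"
  hence s: "Re s > 1" by simp
  define d where "d = (Re s - 1) / 2"
  have d: "d > 0" using s by (simp add: d_def)
  show "\<exists>d h. 0 < d \<and> summable h \<and> (\<forall>\<^sub>F n in sequentially. \<forall>y\<in>ball s d \<inter> {s. Re s > 1}.
      cmod (of_real (c n) * (1 / of_nat n powr y)) \<le> h n)"
  proof (intro exI[of _ d] exI[of _ "\<lambda>n. real n powr (- (1 + d))"] conjI d)
    show "summable (\<lambda>n. real n powr - (1 + d))"
      using d by (subst summable_real_powr_iff) auto
    show "\<forall>\<^sub>F n in sequentially. \<forall>y\<in>ball s d \<inter> {s. Re s > 1}.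
      cmod (of_real (c n) * (1 / of_nat n powr y)) \<le> real n powr (- (1 + d))"
      using eventually_gt_at_top[of 0]
    proof eventually_elim
      case (elim n)
      show ?case
      proof
        fix y assume y: "y \<in> ball s d \<inter> {s. Re s > 1}"
        have "Re s - Re y \<le> cmod (s - y)" by (metis complex_Re_le_cmod minus_complex.sel(1))
        hence "Re y \<ge> 1 + d" using y by (auto simp: d_def dist_norm field_simps)
        have "cmod (of_real (c n) * (1 / of_nat n powr y)) = \<bar>c n\<bar> * real n powr (- Re y)"
          unfolding norm_mult norm_dirichlet_term[OF elim] by simp
        also have "\<dots> \<le> 1 * real n powr (- (1 + d))"
          using \<open>Re y \<ge> 1 + d\<close> elim c by (intro mult_mono powr_mono) auto
        finally show "cmod (of_real (c n) * (1 / of_nat n powr y)) \<le> real n powr (- (1 + d))" by simp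
      qed
    qed
  qed
qed

lemma zeta_sums': "Re s > 1 \<Longrightarrow> (\<lambda>n. 1 / of_nat n powr s) sums zeta s"
  using zeta_sums[of s] sums_Suc_iff[of "\<lambda>n. 1 / of_nat n powr s" "zeta s"] by simp

definition dirichlet_log :: "complex \<Rightarrow> complex" where
  "dirichlet_log s = (\<Sum>n. of_real (log_coeff n) * (1 / of_nat n powr s))"

lemma
  shows dirichlet_log_sums:
      "Re s > 1 \<Longrightarrow> (\<lambda>n. of_real (log_coeff n) * (1 / of_nat n powr s)) sums dirichlet_log s"
    and dirichlet_log_deriv:
      "\<exists>d. \<forall>s. Re s > 1 \<longrightarrow> (\<lambda>n. - mangoldt n * (1 / of_nat n powr s)) sums d s \<and>
           (dirichlet_log has_field_derivative d s) (at s)"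
proof -
  have "\<bar>log_coeff n\<bar> \<le> 1" for n using log_coeff_le_1[of n] log_coeff_nonneg[of n] by auto
  from dirichlet_series_deriv[of log_coeff, OF this] obtain g g' where
    g: "\<And>x. Re x > 1 \<Longrightarrow> (\<lambda>n. of_real (log_coeff n) * (1 / of_nat n powr x)) sums g x"
       "\<And>x. Re x > 1 \<Longrightarrow> (\<lambda>n. - of_real (ln (real n) * log_coeff n) * (1 / of_nat n powr x)) sums g' x"
       "\<And>x. Re x > 1 \<Longrightarrow> (g has_field_derivative g' x) (at x)" by auto
  have ge: "g x = dirichlet_log x" if "Re x > 1" for x
    using g(1)[OF that] by (simp add: dirichlet_log_def sums_iff)
  have "(complex_of_real (ln (real n) * log_coeff n)) = mangoldt n" for n
  proof (cases "n \<ge> 2")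
    case True
    hence "ln (real n) * log_coeff n = mangoldt n" by (simp add: log_coeff_def)
    thus ?thesis by (simp only: of_real_mangoldt)
  next
    case False
    hence "n = 0 \<or> n = Suc 0" by auto
    thus ?thesis by auto
  qed
  moreover have "(dirichlet_log has_field_derivative g' x) (at x)" if x: "Re x > 1" for x
    by (rule has_field_derivative_transform_within_open[OF g(3)[OF x], of "{s. Re s > 1}"])
       (use x ge open_halfspace_Re_gt in auto)
  ultimately show "\<exists>d. \<forall>s. Re s > 1 \<longrightarrow> (\<lambda>n. - mangoldt n * (1 / of_nat n powr s)) sums d s \<and>
           (dirichlet_log has_field_derivative d s) (at s)"
    using g(2) by (intro exI[of _ g']) (auto simp del: of_real_mult)
  show "Re s > 1 \<Longrightarrow> (\<lambda>n. of_real (log_coeff n) * (1 / of_nat n powr s)) sums dirichlet_log s"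
    using g(1) ge by simp
qed

lemma zeta_deriv_sums:
  assumes s: "Re s > 1"
  shows "(\<lambda>n. - of_real (ln (real n)) * (1 / of_nat n powr s)) sums deriv zeta s"
proof -
  obtain g g' where
    g: "\<And>x. Re x > 1 \<Longrightarrow> (\<lambda>n. 1 / of_nat n powr x) sums g x"
       "\<And>x. Re x > 1 \<Longrightarrow> (\<lambda>n. - of_real (ln (real n)) * (1 / of_nat n powr x)) sums g' x"
       "\<And>x. Re x > 1 \<Longrightarrow> (g has_field_derivative g' x) (at x)" 
    using dirichlet_series_deriv[of "\<lambda>_. 1"] by auto
  have "g x = zeta x" if "Re x > 1" for x
    using sums_unique2[OF g(1) zeta_sums'] that by blast
  hence "(zeta has_field_derivative g' s) (at s)"
    by (intro has_field_derivative_transform_within_open[OF g(3)[OF s], of "{s. Re s > 1}"])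
       (use s open_halfspace_Re_gt in auto)
  thus ?thesis using g(2)[OF s] DERIV_imp_deriv by metis
qed

lemma summable_ln_powr:
  assumes "p > (1::real)"
  shows "summable (\<lambda>n. ln (real n) * real n powr (-p))"
proof (rule summable_comparison_test_ev)
  define e where "e = (p - 1) / 2"
  have e: "e > 0" using assms by (simp add: e_def)
  show "summable (\<lambda>n. real n powr (- (1 + e)) * (1 / e))"
    using e by (intro summable_mult2) (simp add: summable_real_powr_iff)
  show "\<forall>\<^sub>F n in sequentially. norm (ln (real n) * real n powr (-p)) \<le> real n powr (- (1 + e)) * (1 / e)"
    using eventually_gt_at_top[of 0]
  proof eventually_elim
    case (elim n)
    have "ln (real n) \<le> real n powr e / e" using elim e by (intro ln_powr_bound) auto
    hence "ln (real n) * real n powr (-p) \<le> real n powr e / e * real n powr (-p)"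
      by (intro mult_right_mono) auto
    also have "\<dots> = real n powr (- (1 + e)) * (1 / e)"
    proof -
      have "e + (-p) = - (1 + e)" by (simp add: e_def field_simps)
      hence "real n powr e * real n powr (-p) = real n powr (- (1 + e))"
        by (simp only: powr_add[symmetric])
      thus ?thesis by simp
    qed
    finally show ?case using elim by simp
  qed
qed

text \<open>
  Multiplying the two absolutely convergent series and collecting the pairs \<open>(n, m)\<close> according to \<open>k = n * m\<close> turns
  the product into the series with coefficients \<open>\<Sum>n | n dvd k. \<Lambda>(n) = ln k\<close>, which is the series of the derivative.
\<close>

lemma mangoldt_convolution:
  assumes s: "Re s > 1" 
    and d: "(\<lambda>n. - mangoldt n * (1 / of_nat n powr s)) sums d"
  shows "deriv zeta s = d * zeta s"
proof -
  let ?P = "{1..} :: nat set"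
  define f where "f = (\<lambda>n. - mangoldt n * (1 / of_nat n powr s) :: complex)"
  define g where "g = (\<lambda>n. 1 / of_nat n powr s :: complex)"
  have f0: "f 0 = 0" and g0: "g 0 = 0" by (auto simp: f_def g_def)
  have sf: "summable (\<lambda>n. norm (f n))"
  proof (rule summable_comparison_test_ev[OF _ summable_ln_powr[OF s]])
    show "\<forall>\<^sub>F n in sequentially. norm (norm (f n)) \<le> ln (real n) * real n powr - Re s"
      using eventually_gt_at_top[of 0]
      by eventually_elim
         (auto simp: f_def norm_mult norm_divide norm_powr_real_powr powr_minus field_simps intro!: divide_right_mono mangoldt_le)
  qed
  have sg: "summable (\<lambda>n. norm (g n))"
  proof (rule summable_comparison_test_ev)
    show "summable (\<lambda>n. real n powr (- Re s))" using s by (simp add: summable_real_powr_iff)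
    show "\<forall>\<^sub>F n in sequentially. norm (norm (g n)) \<le> real n powr - Re s"
      using eventually_gt_at_top[of 0]
      by eventually_elim (simp add: g_def norm_divide norm_powr_real_powr powr_minus field_simps)
  qed
  have hs: "(h has_sum S) ?P" if "h sums S" "summable (\<lambda>n. norm (h n))" "h 0 = 0" for h :: "nat \<Rightarrow> complex" and S
    using norm_summable_imp_has_sum[OF that(2,1)] that(3)
    by (subst has_sum_cong_neutral[where T = UNIV and g = h]) (auto simp: not_le)
  have hf: "(f has_sum d) ?P" using d sf f0 unfolding f_def by (intro hs) auto
  have hg: "(g has_sum zeta s) ?P" using zeta_sums'[OF s] sg g0 unfolding g_def by (intro hs) auto
  have nf: "(\<lambda>n. norm (f n)) summable_on ?P" and ng: "(\<lambda>n. norm (g n)) summable_on ?P"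
    using sf sg by (auto intro: summable_on_subset_banach[OF norm_summable_imp_summable_on[of "\<lambda>n. norm (_ n)"]])
  have ab: "(\<lambda>(n,m). f n * g m) summable_on ?P \<times> ?P"
  proof (rule abs_summable_summable)
    show "(\<lambda>x. norm (case x of (n, m) \<Rightarrow> f n * g m)) summable_on ?P \<times> ?P"
    proof (rule summable_on_SigmaI[where g = "\<lambda>n. norm (f n) * infsum (\<lambda>m. norm (g m)) ?P"])
      show "((\<lambda>y. norm (case (x, y) of (n, m) \<Rightarrow> f n * g m)) has_sum norm (f x) * (\<Sum>\<^sub>\<infinity>m\<in>?P. norm (g m))) ?P" for x
        unfolding prod.case norm_mult by (intro has_sum_cmult_right has_sum_infsum ng)
      show "(\<lambda>n. norm (f n) * infsum (\<lambda>m. norm (g m)) ?P) summable_on ?P"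
        by (intro summable_on_cmult_left nf)
    qed auto
  qed
  have "((\<lambda>(n,m). f n * g m) has_sum d * zeta s) (?P \<times> ?P)"
  proof (rule has_sum_SigmaI[where g = "\<lambda>n. f n * zeta s"])
    show "((\<lambda>y. case (x, y) of (n, m) \<Rightarrow> f n * g m) has_sum f x * zeta s) ?P" for x
      unfolding prod.case by (intro has_sum_cmult_right hg)
  qed (intro has_sum_cmult_left hf ab)+
  also have "?this \<longleftrightarrow> ((\<lambda>(k,n). f n * g (k div n)) has_sum d * zeta s) (Sigma ?P (\<lambda>k. {n. n dvd k}))"
  proof (rule has_sum_reindex_bij_witness[where j = "\<lambda>(n,m). (n * m, n)" and i = "\<lambda>(k,n). (n, k div n)"])
  qed (auto elim!: dvdE)
  finally have "((\<lambda>k. \<Sum>n | n dvd k. f n * g (k div n)) has_sum d * zeta s) ?P"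
    by (rule has_sum_Sigma') (auto intro!: has_sum_finiteI)
  also have "?this \<longleftrightarrow> ((\<lambda>k. - of_real (ln (real k)) * (1 / of_nat k powr s)) has_sum d * zeta s) ?P"
  proof (rule has_sum_cong)
    fix k assume k: "k \<in> ?P"
    have "(\<Sum>n | n dvd k. f n * g (k div n)) = (\<Sum>n | n dvd k. - mangoldt n * (1 / of_nat k powr s))"
    proof (rule sum.cong[OF refl])
      fix n assume "n \<in> {n. n dvd k}"
      then obtain m where m: "k = n * m" by auto
      hence n: "n > 0" "m > 0" using k by auto
      have "complex_of_real (real n * real m) powr s = of_nat n powr s * of_nat m powr s"
        by (subst of_real_mult, subst powr_times_real) auto
      hence "(of_nat k :: complex) powr s = of_nat n powr s * of_nat m powr s"
        by (simp add: m)
      thus "f n * g (k div n) = - mangoldt n * (1 / of_nat k powr s)"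
        using n by (simp add: f_def g_def m)
    qed
    also have "\<dots> = - (\<Sum>n | n dvd k. mangoldt n) * (1 / of_nat k powr s)"
      by (simp add: sum_negf sum_distrib_right[symmetric] sum_divide_distrib[symmetric])
    also have "(\<Sum>n | n dvd k. mangoldt n :: complex) = of_real (ln (real k))"
      using k by (intro mangoldt_sum) auto
    finally show "(\<Sum>n | n dvd k. f n * g (k div n)) = - of_real (ln (real k)) * (1 / of_nat k powr s)" .
  qed
  finally have "((\<lambda>k. - of_real (ln (real k)) * (1 / of_nat k powr s)) has_sum d * zeta s) ?P" .
  also have "?this \<longleftrightarrow> ((\<lambda>k. - of_real (ln (real k)) * (1 / of_nat k powr s)) has_sum d * zeta s) UNIV"
    by (rule has_sum_cong_neutral) auto
  finally have "(\<lambda>k. - of_real (ln (real k)) * (1 / of_nat k powr s)) sums (d * zeta s)"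
    by (rule has_sum_imp_sums)
  thus ?thesis using zeta_deriv_sums[OF s] sums_unique2 by blast
qed

text \<open>
  The factor \<open>2 powr (2 - Re s)\<close> shows that such a series tends to 0 for \<open>Re s \<longlongrightarrow> \<infinity>\<close>, which
  fixes the constant in \<open>exp_dirichlet_log\<close>; at \<open>Re s = 2\<close> it is a uniform bound.
\<close>

lemma dirichlet_tail_bound:
  fixes c :: "nat \<Rightarrow> real"
  assumes c: "\<And>n. \<bar>c n\<bar> \<le> 1" "c 0 = 0" "c (Suc 0) = 0"
    and S: "(\<lambda>n. of_real (c n) * (1 / of_nat n powr s)) sums S" and s: "Re s \<ge> 2"
  shows "cmod S \<le> 2 powr (2 - Re s) * (\<Sum>n. real n powr (-2))"
proof -
  have sm: "summable (\<lambda>n. real n powr (-2))" by (simp add: summable_real_powr_iff)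
  have b: "cmod (of_real (c n) * (1 / of_nat n powr s)) \<le> 2 powr (2 - Re s) * real n powr (-2)" for n
  proof (cases "n \<ge> 2")
    case True
    have "cmod (of_real (c n) * (1 / of_nat n powr s)) = \<bar>c n\<bar> * real n powr (- Re s)"
      using True by (subst norm_mult, subst norm_dirichlet_term) auto
    also have "\<dots> \<le> 1 * real n powr (- Re s)" by (intro mult_right_mono c) auto
    also have "real n powr (- Re s) = real n powr (2 - Re s) * real n powr (-2)"
      by (simp add: powr_add[symmetric])
    also have "\<dots> \<le> 2 powr (2 - Re s) * real n powr (-2)"
      using True s by (intro mult_right_mono powr_mono2') auto
    finally show ?thesis by simp
  next
    case False
    hence "n = 0 \<or> n = Suc 0" by auto
    thus ?thesis using c by auto
  qed
  have "cmod S \<le> (\<Sum>n. 2 powr (2 - Re s) * real n powr (-2))"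
    using norm_suminf_le[OF b summable_mult[OF sm]] S by (simp add: sums_iff)
  thus ?thesis by (simp add: suminf_mult[OF sm])
qed

text \<open>
  The function \<open>zeta * exp (- dirichlet_log)\<close> has derivative 0, hence is constant, and its limit at infinity is 1.
  This replaces the Euler product.
\<close>

lemma exp_dirichlet_log:
  assumes "Re s > 1"
  shows "exp (dirichlet_log s) = zeta s"
proof -
  obtain d where d: "\<And>s. Re s > 1 \<Longrightarrow> (\<lambda>n. - mangoldt n * (1 / of_nat n powr s)) sums d s"
    "\<And>s. Re s > 1 \<Longrightarrow> (dirichlet_log has_field_derivative d s) (at s)"
    using dirichlet_log_deriv by auto
  define h where "h = (\<lambda>s. zeta s * exp (- dirichlet_log s))"
  have "\<exists>c. \<forall>s\<in>{s. Re s > 1}. h s = c"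
  proof (rule has_field_derivative_zero_constant)
    fix s :: complex assume "s \<in> {s. Re s > 1}"
    hence s: "Re s > 1" by simp
    have z: "(zeta has_field_derivative d s * zeta s) (at s)"
      unfolding mangoldt_convolution[OF s d(1)[OF s], symmetric]
      by (rule holomorphic_derivI[OF zeta_holomorphic]) (use s in auto)
    have "(h has_field_derivative 0) (at s)"
      unfolding h_def by (auto intro!: derivative_eq_intros z d(2) s simp: algebra_simps)
    thus "(h has_field_derivative 0) (at s within {s. Re s > 1})"
      by (rule has_field_derivative_at_within)
  qed (rule convex_halfspace_Re_gt)
  then obtain c where c: "\<And>s. Re s > 1 \<Longrightarrow> h s = c" by auto
  define x where "x = (\<lambda>k. of_nat (k + 2) :: complex)"
  have x: "Re (x k) = real k + 2" for k by (simp add: x_def)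
  define B where "B = (\<Sum>n. real n powr (-2))"
  have lim: "(\<lambda>k. 2 powr (2 - Re (x k)) * B) \<longlonglongrightarrow> 0"
    unfolding x by real_asymp
  have "(\<lambda>k. dirichlet_log (x k)) \<longlonglongrightarrow> 0"
  proof (rule tendsto_norm_zero_cancel, rule tendsto_sandwich[OF _ _ tendsto_const lim])
    show "\<forall>\<^sub>F k in sequentially. norm (dirichlet_log (x k)) \<le> 2 powr (2 - Re (x k)) * B"
      unfolding B_def
      by (intro always_eventually allI dirichlet_tail_bound[OF _ _ _ dirichlet_log_sums])
         (auto simp: x log_coeff_le_1 log_coeff_nonneg abs_of_nonneg)
  qed auto
  moreover have "(\<lambda>k. zeta (x k) - 1) \<longlonglongrightarrow> 0"
  proof (rule tendsto_norm_zero_cancel, rule tendsto_sandwich[OF _ _ tendsto_const lim])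
    show "\<forall>\<^sub>F k in sequentially. norm (zeta (x k) - 1) \<le> 2 powr (2 - Re (x k)) * B"
    proof (intro always_eventually allI)
      fix k
      define e where "e = (\<lambda>n::nat. if n \<ge> 2 then 1 else 0 :: real)"
      have "(\<lambda>n::nat. (if n = 1 then 1 else 0 :: complex)) sums 1"
        using sums_single[of 1 "\<lambda>_. 1::complex"] by simp
      from sums_diff[OF zeta_sums'[of "x k"] this]
      have "(\<lambda>n::nat. 1 / of_nat n powr x k - (if n = 1 then 1 else 0)) sums (zeta (x k) - 1)"
        by (simp add: x)
      also have "(\<lambda>n::nat. 1 / of_nat n powr x k - (if n = 1 then 1 else 0)) =
          (\<lambda>n. of_real (e n) * (1 / of_nat n powr x k))"
      proof
        fix n :: nat
        have "n = 0 \<or> n = 1 \<or> n \<ge> 2" by auto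
        thus "1 / of_nat n powr x k - (if n = 1 then 1 else 0) = of_real (e n) * (1 / of_nat n powr x k)"
          by (auto simp: e_def)
      qed
      finally show "norm (zeta (x k) - 1) \<le> 2 powr (2 - Re (x k)) * B"
        unfolding B_def by (rule dirichlet_tail_bound[rotated 3]) (auto simp: e_def x)
    qed
  qed auto
  hence "(\<lambda>k. zeta (x k)) \<longlonglongrightarrow> 1" by (simp add: LIM_zero_iff)
  ultimately have "(\<lambda>k. h (x k)) \<longlonglongrightarrow> 1 * exp (- 0)"
    unfolding h_def by (intro tendsto_intros)
  moreover have "h (x k) = c" for k by (rule c) (simp add: x)
  ultimately have "c = 1" by (simp add: LIMSEQ_const_iff)
  hence "zeta s * exp (- dirichlet_log s) = 1" using c[OF assms] by (simp add: h_def)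
  thus ?thesis by (simp add: exp_minus field_simps)
qed

lemma zeta_nonzero_gt_1: "Re s > 1 \<Longrightarrow> zeta s \<noteq> 0"
  using exp_dirichlet_log[of s] exp_not_eq_zero by metis

section \<open>Nonvanishing on the line of real part one\<close>

lemma Re_dirichlet_term:
  assumes "n > 0"
  shows "Re (1 / of_nat n powr s) = real n powr (- Re s) * cos (Im s * ln (real n))"
proof -
  have "1 / of_nat n powr s = exp (- s * of_real (ln (real n)))"
    using assms by (simp add: powr_def Ln_of_nat exp_minus field_simps)
  thus ?thesis using assms by (simp add: Re_exp powr_def)
qed

lemma trig_3_4_1: "3 + 4 * cos x + cos (2 * x) \<ge> (0 :: real)"
proof -
  have "3 + 4 * cos x + cos (2 * x) = 2 * (1 + cos x)^2"
    unfolding cos_double_cos by (simp add: power2_eq_square algebra_simps)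
  thus ?thesis by simp
qed

text \<open>
  The real part of \<open>3 * log zeta(1+\<delta>) + 4 * log zeta(1+\<delta>+\<i>t) + log zeta(1+\<delta>+2\<i>t)\<close> is a series with
  nonnegative terms by \<open>trig_3_4_1\<close>.
\<close>

lemma zeta_3_4_1:
  assumes "\<delta> > 0"
  shows "cmod (zeta (Complex (1 + \<delta>) 0)) ^ 3 * cmod (zeta (Complex (1 + \<delta>) t)) ^ 4 *
    cmod (zeta (Complex (1 + \<delta>) (2 * t))) \<ge> 1"
proof -
  have s: "(\<lambda>n. Re (of_real (log_coeff n) * (1 / of_nat n powr Complex (1 + \<delta>) \<tau>)))
      sums Re (dirichlet_log (Complex (1 + \<delta>) \<tau>))" for \<tau>
    using dirichlet_log_sums assms by (intro sums_Re) auto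
  have "0 \<le> 3 * Re (dirichlet_log (Complex (1 + \<delta>) 0)) + 4 * Re (dirichlet_log (Complex (1 + \<delta>) t))
     + Re (dirichlet_log (Complex (1 + \<delta>) (2 * t)))"
  proof (rule sums_le[OF _ sums_zero])
    show "(\<lambda>n. 3 * Re (of_real (log_coeff n) * (1 / of_nat n powr Complex (1 + \<delta>) 0))
          + 4 * Re (of_real (log_coeff n) * (1 / of_nat n powr Complex (1 + \<delta>) t))
          + Re (of_real (log_coeff n) * (1 / of_nat n powr Complex (1 + \<delta>) (2 * t))))
       sums (3 * Re (dirichlet_log (Complex (1 + \<delta>) 0)) + 4 * Re (dirichlet_log (Complex (1 + \<delta>) t))
     + Re (dirichlet_log (Complex (1 + \<delta>) (2 * t))))"
      by (intro sums_add sums_mult s)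
  next
    fix n :: nat
    show "0 \<le> 3 * Re (of_real (log_coeff n) * (1 / of_nat n powr Complex (1 + \<delta>) 0))
          + 4 * Re (of_real (log_coeff n) * (1 / of_nat n powr Complex (1 + \<delta>) t))
          + Re (of_real (log_coeff n) * (1 / of_nat n powr Complex (1 + \<delta>) (2 * t)))"
    proof (cases "n = 0")
      case False
      have e: "Re (of_real (log_coeff n) * (1 / of_nat n powr Complex (1 + \<delta>) \<tau>))
           = log_coeff n * (real n powr (- (1 + \<delta>)) * cos (\<tau> * ln (real n)))" for \<tau>
      proof -
        have "Re (of_real a * z) = a * Re z" for a z by simp
        thus ?thesis using Re_dirichlet_term[of n "Complex (1 + \<delta>) \<tau>"] \<open>n \<noteq> 0\<close> by (simp only: complex.sel)
      qed
      have "0 \<le> (log_coeff n * real n powr (- (1 + \<delta>))) * 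
         (3 + 4 * cos (t * ln (real n)) + cos (2 * (t * ln (real n))))"
        by (intro mult_nonneg_nonneg trig_3_4_1 log_coeff_nonneg) auto
      thus ?thesis unfolding e by (simp add: algebra_simps)
    qed auto
  qed
  hence "1 \<le> exp (3 * Re (dirichlet_log (Complex (1 + \<delta>) 0)) + 4 * Re (dirichlet_log (Complex (1 + \<delta>) t))
     + Re (dirichlet_log (Complex (1 + \<delta>) (2 * t))))" by simp
  also have "\<dots> = exp (Re (dirichlet_log (Complex (1 + \<delta>) 0))) ^ 3 * exp (Re (dirichlet_log (Complex (1 + \<delta>) t))) ^ 4
     * exp (Re (dirichlet_log (Complex (1 + \<delta>) (2 * t))))"
    by (simp add: exp_add exp_of_nat_mult[symmetric])
  finally have "1 \<le> \<dots>" .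
  moreover have "exp (Re (dirichlet_log (Complex (1 + \<delta>) \<tau>))) = cmod (zeta (Complex (1 + \<delta>) \<tau>))" for \<tau>
    using exp_dirichlet_log[of "Complex (1 + \<delta>) \<tau>"] assms norm_exp_eq_Re by (metis add_less_cancel_left add.right_neutral complex.sel(1))
  ultimately show ?thesis by simp
qed

text \<open>
  The Riemann hypothesis only speaks about the open critical strip, so the line \<open>Re s = 1\<close> needs the classical
  argument: a zero at \<open>1 + \<i>t\<close> would make the product in \<open>zeta_3_4_1\<close> of size
  \<open>\<delta> powr (-3) * \<delta> powr 4 \<longlongrightarrow> 0\<close>.
\<close>

lemma zeta_nonzero_1:
  assumes t: "t \<noteq> 0"
  shows "zeta (Complex 1 t) \<noteq> 0"
proof
  assume z0: "zeta (Complex 1 t) = 0"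
  obtain C where C: "C > 0" "\<And>s. Re s \<ge> 1 / 10 \<Longrightarrow> cmod ((s - 1) * zeta s) \<le> 1 + C * cmod s * cmod (s - 1)"
    using zeta_growth by auto
  define A where "A = 1 + 2 * C"
  have A: "A > 0" using C by (simp add: A_def)
  have bd: "cmod (zeta (Complex (1 + \<delta>) 0)) \<le> A / \<delta>" if \<delta>: "\<delta> > 0" "\<delta> < 1" for \<delta>
  proof -
    have e: "Complex (1 + \<delta>) 0 - 1 = of_real \<delta>" "Complex (1 + \<delta>) 0 = of_real (1 + \<delta>)"
      by (auto simp: complex_eq_iff)
    have "cmod ((Complex (1 + \<delta>) 0 - 1) * zeta (Complex (1 + \<delta>) 0)) \<le> 1 + C * \<bar>1 + \<delta>\<bar> * \<bar>\<delta>\<bar>"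
      using C(2)[of "Complex (1 + \<delta>) 0"] \<delta> unfolding e(1) unfolding e(2) norm_of_real by simp
    also have "\<dots> \<le> 1 + C * 2 * 1" using \<delta> C by (intro add_left_mono mult_mono) auto
    finally have "\<delta> * cmod (zeta (Complex (1 + \<delta>) 0)) \<le> A"
      using \<delta> by (simp add: e(1) norm_mult A_def)
    thus ?thesis using \<delta> by (simp add: field_simps)
  qed
  have der: "(zeta has_field_derivative deriv zeta (Complex 1 t)) (at (Complex 1 t))"
    by (rule holomorphic_derivI[OF zeta_holomorphic]) (use t in \<open>auto simp: complex_eq_iff\<close>)
  have lim1: "filterlim (\<lambda>\<delta>. of_real \<delta> :: complex) (at 0) (at_right (0::real))"
    by (rule filterlim_atI) (auto intro!: tendsto_eq_intros simp: eventually_at_filter)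
  have "(\<lambda>h. (zeta (Complex 1 t + h) - zeta (Complex 1 t)) / h) \<midarrow>0\<rightarrow> deriv zeta (Complex 1 t)"
    using der by (simp add: DERIV_def)
  from filterlim_compose[OF this lim1]
  have l1: "((\<lambda>\<delta>. zeta (Complex (1 + \<delta>) t) / of_real \<delta>) \<longlongrightarrow> deriv zeta (Complex 1 t)) (at_right 0)"
  proof -
    have "Complex 1 t + of_real \<delta> = Complex (1 + \<delta>) t" for \<delta> by (auto simp: complex_eq_iff)
    thus ?thesis using filterlim_compose[OF \<open>(\<lambda>h. (zeta (Complex 1 t + h) - zeta (Complex 1 t)) / h) \<midarrow>0\<rightarrow> _\<close> lim1] z0 by simp
  qed
  have "isCont zeta (Complex 1 (2 * t))"
    by (intro DERIV_isCont[OF holomorphic_derivI[OF zeta_holomorphic]]) (use t in \<open>auto simp: complex_eq_iff\<close>)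
  moreover have "((\<lambda>\<delta>. Complex (1 + \<delta>) (2 * t)) \<longlongrightarrow> Complex (1 + 0) (2 * t)) (at_right 0)"
    by (intro tendsto_intros)
  ultimately have l2: "((\<lambda>\<delta>. zeta (Complex (1 + \<delta>) (2 * t))) \<longlongrightarrow> zeta (Complex 1 (2 * t))) (at_right 0)"
    using isCont_tendsto_compose by force
  have "((\<lambda>\<delta>. A ^ 3 * cmod (zeta (Complex (1 + \<delta>) t) / of_real \<delta>) ^ 4 * cmod (zeta (Complex (1 + \<delta>) (2 * t))) * \<delta>)
     \<longlongrightarrow> A ^ 3 * cmod (deriv zeta (Complex 1 t)) ^ 4 * cmod (zeta (Complex 1 (2 * t))) * 0) (at_right 0)"
    by (intro tendsto_intros l1 l2)
  hence "\<forall>\<^sub>F \<delta> in at_right 0. A ^ 3 * cmod (zeta (Complex (1 + \<delta>) t) / of_real \<delta>) ^ 4 * cmod (zeta (Complex (1 + \<delta>) (2 * t))) * \<delta> < 1"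
    by (rule order_tendstoD) simp
  moreover have "\<forall>\<^sub>F \<delta> in at_right 0. \<delta> \<in> {0<..<1::real}"
    by (rule eventually_at_right_real) simp
  ultimately have "\<forall>\<^sub>F \<delta> in at_right (0::real). False"
  proof eventually_elim
    case (elim \<delta>)
    hence \<delta>: "\<delta> > 0" "\<delta> < 1" by auto
    have "1 \<le> cmod (zeta (Complex (1 + \<delta>) 0)) ^ 3 * cmod (zeta (Complex (1 + \<delta>) t)) ^ 4 *
       cmod (zeta (Complex (1 + \<delta>) (2 * t)))" by (rule zeta_3_4_1) (use \<delta> in auto)
    also have "\<dots> \<le> (A / \<delta>) ^ 3 * cmod (zeta (Complex (1 + \<delta>) t)) ^ 4 *
       cmod (zeta (Complex (1 + \<delta>) (2 * t)))"
      by (intro mult_right_mono power_mono bd \<delta>) auto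
    also have "\<dots> = A ^ 3 * cmod (zeta (Complex (1 + \<delta>) t) / of_real \<delta>) ^ 4 * cmod (zeta (Complex (1 + \<delta>) (2 * t))) * \<delta>"
      using \<delta> by (simp add: norm_divide field_simps power_divide eval_nat_numeral)
    finally show ?case using elim(1) by simp
  qed
  thus False by simp
qed

section \<open>The logarithm as a holomorphic function\<close>

text \<open>
  Two logarithms of the same function differ by an integer multiple of \<open>2 * pi * \<i>\<close>; a continuous function with such
  discrete values is constant.
\<close>

lemma exp_lift_unique:
  fixes g h :: "'a :: topological_space \<Rightarrow> complex"
  assumes "connected S" "continuous_on S g" "continuous_on S h"
    and e: "\<And>x. x \<in> S \<Longrightarrow> exp (g x) = exp (h x)"
    and "x0 \<in> S" "g x0 = h x0" "x \<in> S"
  shows "g x = h x"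
proof -
  have "(\<lambda>x. g x - h x) constant_on S"
  proof (rule continuous_discrete_range_constant[OF assms(1)])
    show "continuous_on S (\<lambda>x. g x - h x)" by (intro continuous_intros assms)
    fix x assume x: "x \<in> S"
    show "\<exists>e>0. \<forall>y. y \<in> S \<and> g y - h y \<noteq> g x - h x \<longrightarrow> e \<le> cmod (g y - h y - (g x - h x))"
    proof (intro exI[of _ 1] conjI allI impI)
      fix y assume y: "y \<in> S \<and> g y - h y \<noteq> g x - h x"
      have "exp (g y - h y) = exp (g x - h x)" using x y e by (simp add: exp_diff)
      then obtain n where n: "g y - h y = g x - h x + (of_int (2 * n) * pi) * \<i>"
        unfolding exp_eq by blast
      hence "cmod (g y - h y - (g x - h x)) = \<bar>2 * real_of_int n\<bar> * pi"
        by (simp add: norm_mult)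
      moreover have "n \<noteq> 0" using n y by auto
      hence "\<bar>2 * real_of_int n\<bar> \<ge> 1" by (simp add: abs_mult)
      hence "\<bar>2 * real_of_int n\<bar> * pi \<ge> 1 * 1" using pi_gt3 by (intro mult_mono) auto
      ultimately show "1 \<le> cmod (g y - h y - (g x - h x))" by simp
    qed auto
  qed
  then obtain c where c: "\<And>x. x \<in> S \<Longrightarrow> g x - h x = c" by (auto simp: constant_on_def)
  from c[of x0] c[of x] assms show ?thesis by simp
qed

lemma log_along_eq:
  assumes g: "continuous_on {0..1} g" "\<And>x. x \<in> {0..1} \<Longrightarrow> exp (g x) = f (\<gamma> x)" "g 0 \<in> \<real>"
  shows "log_along f \<gamma> = g 1"
  unfolding log_along_def
proof (rule the_equality)
  show "\<exists>h. continuous_on {0..1} h \<and> (\<forall>x\<in>{0..1}. exp (h x) = f (\<gamma> x)) \<and> h 0 \<in> \<real> \<and> h 1 = g 1"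
    using g by blast
next
  fix w assume "\<exists>h. continuous_on {0..1} h \<and> (\<forall>x\<in>{0..1}. exp (h x) = f (\<gamma> x)) \<and> h 0 \<in> \<real> \<and> h 1 = w"
  then obtain h where h: "continuous_on {0..1} h" "\<And>x. x \<in> {0..1} \<Longrightarrow> exp (h x) = f (\<gamma> x)"
     "h 0 \<in> \<real>" "h 1 = w" by auto
  have "exp (h 0) = exp (g 0)" using h(2)[of 0] g(2)[of 0] by simp
  hence "h 0 = g 0" using h(3) g(3) by (auto elim!: Reals_cases simp: exp_of_real)
  from exp_lift_unique[OF connected_Icc h(1) g(1), of 0 1] this h g
  show "w = g 1" by auto
qed

text \<open>
  A pole-free region that contains the polygonal path from 2 to each of its points. It is starlike with respect to 2, so
  that zeta has a holomorphic logarithm there.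
\<close>

definition log_zeta_domain :: "complex set" where
  "log_zeta_domain = {s. Re s > 1} \<union> {s. Re s > 1 / 2 \<and> Im s > 0}"

lemma open_log_zeta_domain: "open log_zeta_domain"
  unfolding log_zeta_domain_def Collect_conj_eq
  by (intro open_Un open_Int open_halfspace_Re_gt open_halfspace_Im_gt)

lemma contractible_log_zeta_domain: "contractible log_zeta_domain"
proof (rule starlike_imp_contractible)
  show "starlike log_zeta_domain"
    unfolding starlike_def
  proof (intro bexI[of _ 2] ballI subsetI)
    fix x y assume x: "x \<in> log_zeta_domain" and y: "y \<in> closed_segment 2 x"
    then obtain u where u: "0 \<le> u" "u \<le> 1" "y = (1 - u) *\<^sub>R 2 + u *\<^sub>R x"
      by (auto simp: closed_segment_def)
    have Re: "Re y = 2 + u * (Re x - 2)" and Im: "Im y = u * Im x"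
      unfolding u(3) by (simp_all add: algebra_simps)
    show "y \<in> log_zeta_domain"
    proof (cases "Re x > 1")
      case True
      have "Re y > 1"
      proof (cases "Re x \<ge> 2")
        case True
        hence "u * (Re x - 2) \<ge> 0" using u by auto
        thus ?thesis using Re by simp
      next
        case False
        hence "u * (2 - Re x) \<le> 1 * (2 - Re x)" using u by (intro mult_right_mono) auto
        thus ?thesis using Re True by (simp add: algebra_simps)
      qed
      thus ?thesis by (simp add: log_zeta_domain_def)
    next
      case False
      hence x': "Re x > 1 / 2" "Im x > 0" using x by (auto simp: log_zeta_domain_def)
      have "u * (2 - Re x) \<le> 1 * (2 - Re x)" using u False by (intro mult_right_mono) auto
      hence "Re y > 1 / 2" using Re x' by (simp add: algebra_simps)
      moreover have "u = 0 \<or> Im y > 0"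
        unfolding Im using mult_pos_pos[of u "Im x"] x' u(1) by linarith
      ultimately show ?thesis using Re by (auto simp: log_zeta_domain_def)
    qed
  qed (simp add: log_zeta_domain_def)
qed

lemma zeta_nonzero_domain:
  assumes "riemann_hypothesis" "s \<in> log_zeta_domain"
  shows "zeta s \<noteq> 0"
proof -
  consider "Re s > 1" | "Re s = 1" "Im s > 0" | "Re s > 1 / 2" "Re s < 1" 
    using assms(2) unfolding log_zeta_domain_def by (cases "Re s" "1 :: real" rule: linorder_cases) auto
  thus ?thesis
  proof cases
    case 2
    hence "s = Complex 1 (Im s)" by (simp add: complex_eq_iff)
    thus ?thesis using zeta_nonzero_1[of "Im s"] 2 by simp
  qed (use assms(1) zeta_nonzero_gt_1 in \<open>auto simp: riemann_hypothesis_def\<close>)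
qed

lemma dirichlet_log_real: "dirichlet_log 2 \<in> \<real>"
proof -
  have e: "of_real (log_coeff n) * (1 / of_nat n powr 2) = (of_real (log_coeff n * (1 / real n ^ 2)) :: complex)" for n
    by (cases "n = 0") (auto simp: powr_numeral)
  have "(\<lambda>n. Im (of_real (log_coeff n) * (1 / of_nat n powr 2))) sums Im (dirichlet_log 2)"
    by (intro sums_Im dirichlet_log_sums) simp
  hence "Im (dirichlet_log 2) = 0"
    unfolding e Im_complex_of_real using sums_zero sums_unique2 by blast
  thus ?thesis by (simp add: complex_is_Real_iff)
qed

lemma holomorphic_log_zeta_exists:
  assumes "riemann_hypothesis"
  obtains l where "l holomorphic_on log_zeta_domain" "\<And>s. s \<in> log_zeta_domain \<Longrightarrow> exp (l s) = zeta s"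
    "l 2 = dirichlet_log 2"
proof -
  have "zeta holomorphic_on log_zeta_domain"
    by (rule holomorphic_on_subset[OF zeta_holomorphic]) (auto simp: log_zeta_domain_def)
  from contractible_imp_holomorphic_log[OF this contractible_log_zeta_domain zeta_nonzero_domain[OF assms]]
  obtain g where g: "g holomorphic_on log_zeta_domain" "\<And>s. s \<in> log_zeta_domain \<Longrightarrow> zeta s = exp (g s)"
    by auto
  show ?thesis
  proof (rule that[of "\<lambda>s. g s - g 2 + dirichlet_log 2"])
    show "(\<lambda>s. g s - g 2 + dirichlet_log 2) holomorphic_on log_zeta_domain"
      by (intro holomorphic_intros g)
    have "exp (g 2) = exp (dirichlet_log 2)"
      using g(2)[of 2] exp_dirichlet_log[of 2] by (simp add: log_zeta_domain_def)
    thus "exp (g s - g 2 + dirichlet_log 2) = zeta s" if "s \<in> log_zeta_domain" for s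
      using g(2)[OF that] by (simp add: exp_add exp_diff)
  qed simp
qed

text \<open>
  The path in the definition of \<open>log_zeta\<close> stays in the domain up to its endpoint, so composing it with \<open>h\<close> gives
  the continuous lift. Inserting the single point \<open>s\<close> allows the endpoint to be on the boundary.
\<close>

lemma log_zeta_eq_continuous_lift:
  assumes h: "continuous_on (insert s log_zeta_domain) h"
      "\<And>z. z \<in> insert s log_zeta_domain \<Longrightarrow> exp (h z) = zeta z" "h 2 \<in> \<real>"
    and s: "Re s \<ge> 1 / 2" "Im s > 0 \<or> Re s > 1"
  shows "log_zeta s = h s"
proof -
  define \<gamma> where "\<gamma> = linepath 2 (Complex 2 (Im s)) +++ linepath (Complex 2 (Im s)) s"
  have im: "path_image \<gamma> \<subseteq> insert s log_zeta_domain"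
  proof -
    have "z \<in> log_zeta_domain" if "z \<in> closed_segment 2 (Complex 2 (Im s))" for z
    proof -
      from that obtain u where "z = (1 - u) *\<^sub>R 2 + u *\<^sub>R Complex 2 (Im s)"
        by (auto simp: closed_segment_def)
      hence "Re z = (1 - u) * 2 + u * 2" by simp
      hence "Re z = 2" by simp
      thus ?thesis by (simp add: log_zeta_domain_def)
    qed
    moreover have "z \<in> insert s log_zeta_domain" if "z \<in> closed_segment (Complex 2 (Im s)) s" for z
    proof -
      from that obtain u where u: "0 \<le> u" "u \<le> 1" "z = (1 - u) *\<^sub>R Complex 2 (Im s) + u *\<^sub>R s"
        by (auto simp: closed_segment_def)
      have z: "Re z = (1 - u) * 2 + u * Re s" "Im z = Im s"
        unfolding u(3) by (simp_all add: algebra_simps)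
      show ?thesis
      proof (cases "u = 1")
        case False
        with u have u': "u < 1" by simp
        show ?thesis
        proof (cases "Re s > 1")
          case True
          have "u * Re s \<ge> u * 1" using u True by (intro mult_left_mono) auto
          hence "Re z > 1" using z u' by simp
          thus ?thesis by (simp add: log_zeta_domain_def)
        next
          case False
          have "u * Re s \<ge> u * (1 / 2)" using u s by (intro mult_left_mono) auto
          hence "Re z > 1 / 2" using z u' by simp
          thus ?thesis using z s False by (simp add: log_zeta_domain_def)
        qed
      qed (use u in auto)
    qed
    ultimately show ?thesis
      by (auto simp: \<gamma>_def path_image_join)
  qed
  have p: "path \<gamma>" by (auto simp: \<gamma>_def)
  have g0: "\<gamma> 0 = 2" and g1: "\<gamma> 1 = s"
    by (auto simp: \<gamma>_def joinpaths_def linepath_def)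
  have "log_along zeta \<gamma> = (h \<circ> \<gamma>) 1"
  proof (rule log_along_eq)
    show "continuous_on {0..1} (h \<circ> \<gamma>)"
      using p im unfolding path_def path_image_def
      by (intro continuous_on_compose continuous_on_subset[OF h(1)]) auto
    show "exp ((h \<circ> \<gamma>) x) = zeta (\<gamma> x)" if "x \<in> {0..1}" for x
      using that im h(2)[of "\<gamma> x"] unfolding path_image_def o_def by blast
    show "(h \<circ> \<gamma>) 0 \<in> \<real>" using h(3) g0 by simp
  qed
  thus ?thesis using g1 by (simp add: log_zeta_def \<gamma>_def)
qed

text \<open>
  The first three parts identify \<open>log_zeta\<close> with the holomorphic branch just found. The last one is the value on the
  critical line: away from the zeros it is the limit from the right.
\<close>

lemma
  assumes "riemann_hypothesis"
  shows log_zeta_holomorphic: "log_zeta holomorphic_on log_zeta_domain"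
    and exp_log_zeta: "s \<in> log_zeta_domain \<Longrightarrow> exp (log_zeta s) = zeta s"
    and log_zeta_eq_dirichlet: "Re s > 1 \<Longrightarrow> log_zeta s = dirichlet_log s"
    and log_zeta_boundary: "\<lbrakk>Re s = 1 / 2; Im s > 0; zeta s \<noteq> 0; (log_zeta \<longlongrightarrow> w) (at s within log_zeta_domain)\<rbrakk>
            \<Longrightarrow> log_zeta s = w"
proof -
  obtain l where l: "l holomorphic_on log_zeta_domain" "\<And>s. s \<in> log_zeta_domain \<Longrightarrow> exp (l s) = zeta s"
    "l 2 = dirichlet_log 2" using holomorphic_log_zeta_exists[OF assms] by metis
  have cl: "continuous_on log_zeta_domain l" by (rule holomorphic_on_imp_continuous_on[OF l(1)])
  have eq: "log_zeta s = l s" if "s \<in> log_zeta_domain" for s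
  proof -
    have i: "insert s log_zeta_domain = log_zeta_domain" using that by auto
    show ?thesis
    proof (rule log_zeta_eq_continuous_lift)
      show "Re s \<ge> 1 / 2" "Im s > 0 \<or> Re s > 1" using that by (auto simp: log_zeta_domain_def)
    qed (use i cl l dirichlet_log_real in auto)
  qed
  show "log_zeta holomorphic_on log_zeta_domain"
    by (rule holomorphic_transform[OF l(1)]) (simp add: eq)
  show "exp (log_zeta s) = zeta s" if "s \<in> log_zeta_domain" for s
    using eq l(2) that by simp
  show "log_zeta s = dirichlet_log s" if s: "Re s > 1" for s
  proof -
    have sub: "{s. Re s > 1} \<subseteq> log_zeta_domain" by (auto simp: log_zeta_domain_def)
    have "l s = dirichlet_log s"
    proof (rule exp_lift_unique[where g = l and h = dirichlet_log and x = s and S = "{s. Re s > 1}" and ?x0.0 = 2])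
      show "connected {s. 1 < Re s}" by (intro convex_connected convex_halfspace_Re_gt)
      show "continuous_on {s. 1 < Re s} l" by (rule continuous_on_subset[OF cl sub])
      have "isCont dirichlet_log x" if "Re x > 1" for x
        using dirichlet_log_deriv that DERIV_isCont by blast
      thus "continuous_on {s. 1 < Re s} dirichlet_log"
        by (intro continuous_at_imp_continuous_on) auto
    qed (use s sub l exp_dirichlet_log in auto)
    thus ?thesis using eq[of s] s sub by auto
  qed
  show "log_zeta s = w" if s: "Re s = 1 / 2" "Im s > 0" "zeta s \<noteq> 0"
    and w: "(log_zeta \<longlongrightarrow> w) (at s within log_zeta_domain)" 
  proof -
    have nin: "s \<notin> log_zeta_domain" using s by (auto simp: log_zeta_domain_def)
    have lw: "(l \<longlongrightarrow> w) (at s within log_zeta_domain)"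
      by (rule Lim_transform_within[OF w, of 1]) (auto simp: eq)
    have nt: "at s within log_zeta_domain \<noteq> bot"
    proof -
      have "s \<in> closure log_zeta_domain"
        unfolding closure_approachable
      proof (intro allI impI)
        fix e :: real assume "e > 0"
        thus "\<exists>y\<in>log_zeta_domain. dist y s < e"
          by (intro bexI[of _ "s + of_real (e / 2)"]) (use s in \<open>auto simp: log_zeta_domain_def dist_norm\<close>)
      qed
      thus ?thesis using nin by (simp add: at_within_eq_bot_iff)
    qed
    have zc: "(zeta \<longlongrightarrow> zeta s) (at s within log_zeta_domain)"
    proof -
      have "isCont zeta s"
        by (rule DERIV_isCont[OF holomorphic_derivI[OF zeta_holomorphic]]) (use s in auto)
      thus ?thesis unfolding isCont_def by (rule Lim_at_imp_Lim_at_within)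
    qed
    have "((\<lambda>z. exp (l z)) \<longlongrightarrow> exp w) (at s within log_zeta_domain)"
      by (intro tendsto_intros lw)
    hence "(zeta \<longlongrightarrow> exp w) (at s within log_zeta_domain)"
      by (rule Lim_transform_within[of _ _ _ _ 1]) (auto simp: l(2))
    hence ew: "exp w = zeta s" using tendsto_unique[OF nt _ zc] by blast
    define h where "h = (\<lambda>z. if z = s then w else l z)"
    have "log_zeta s = h s"
    proof (rule log_zeta_eq_continuous_lift)
      show "continuous_on (insert s log_zeta_domain) h"
        unfolding continuous_on_def
      proof
        fix x assume x: "x \<in> insert s log_zeta_domain"
        show "(h \<longlongrightarrow> h x) (at x within insert s log_zeta_domain)"
        proof (cases "x = s")
          case True
          have "(h \<longlongrightarrow> w) (at s within log_zeta_domain)"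
            by (rule Lim_transform_within[OF lw, of 1]) (auto simp: h_def)
          thus ?thesis using True unfolding at_within_def by (simp add: h_def)
        next
          case False
          with x have x: "x \<in> log_zeta_domain" by simp
          have "isCont l x" using cl x open_log_zeta_domain continuous_on_eq_continuous_at by blast
          hence "(l \<longlongrightarrow> l x) (at x within insert s log_zeta_domain)"
            unfolding isCont_def by (rule Lim_at_imp_Lim_at_within)
          hence "(h \<longlongrightarrow> l x) (at x within insert s log_zeta_domain)"
            by (rule Lim_transform_within[of _ _ _ _ "dist x s"]) (use False in \<open>auto simp: h_def dist_commute\<close>)
          thus ?thesis using False by (simp add: h_def)
        qed
      qed
      show "exp (h z) = zeta z" if "z \<in> insert s log_zeta_domain" for z
        using that ew l(2) by (auto simp: h_def)
      show "h 2 \<in> \<real>" using s l(3) dirichlet_log_real by (auto simp: h_def)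
    qed (use s in auto)
    thus ?thesis by (simp add: h_def)
  qed
qed

section \<open>Removing the zeros in a disc\<close>

text \<open>
  The map \<open>w \<mapsto> w / (2 * M - w)\<close> sends the half-plane \<open>Re w < M\<close> into the unit disc and fixes 0, so the
  Schwarz lemma applies to its composition with \<open>f\<close>; solving for \<open>f\<close> gives the bound.
\<close>

lemma Borel_Caratheodory_disc:
  assumes f: "f holomorphic_on ball 0 1" "f 0 = 0"
    and M: "\<And>z. norm z < 1 \<Longrightarrow> Re (f z) < M"
    and z: "norm z \<le> r" "r < 1"
  shows "norm (f z) \<le> 2 * M * r / (1 - r)"
proof -
  have M0: "M > 0" using M[of 0] f(2) by simp
  have lt: "norm (f z) < norm (2 * of_real M - f z)" if "norm z < 1" for z
  proof -
    have "0 < M * (M - Re (f z))" using M[OF that] M0 by simp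
    hence "(norm (f z))\<^sup>2 < (norm (2 * of_real M - f z))\<^sup>2"
      unfolding cmod_power2 by (simp add: power2_eq_square algebra_simps)
    thus ?thesis by (rule power2_less_imp_less) simp
  qed
  define g where "g = (\<lambda>z. f z / (2 * of_real M - f z))"
  have ne: "2 * of_real M - f z \<noteq> 0" if "norm z < 1" for z
    using lt[OF that] by auto
  have "norm (g z) \<le> norm z" if z: "norm z < 1" for z
  proof (rule Schwarz_Lemma(1))
    show "g holomorphic_on ball 0 1"
      unfolding g_def by (intro holomorphic_intros f) (use ne in auto)
    show "g 0 = 0" by (simp add: g_def f)
    show "norm (g z) < 1" if "norm z < 1" for z
      using lt[OF that] ne[OF that] by (simp add: g_def norm_divide divide_less_eq)
  qed (use z in auto)
  hence gz: "norm (g z) \<le> r" using z by (meson le_less_trans order_trans)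
  have "f z * (1 + g z) = 2 * of_real M * g z"
    using ne[of z] z by (simp add: g_def field_simps)
  hence "norm (f z) * norm (1 + g z) = 2 * M * norm (g z)"
    using M0 by (metis abs_of_pos norm_mult norm_of_real norm_numeral)
  also have "\<dots> \<le> 2 * M * r" using gz M0 by (intro mult_left_mono) auto
  finally have 1: "norm (f z) * norm (1 + g z) \<le> 2 * M * r" .
  have "1 - r \<le> norm (1 + g z)" using gz norm_diff_ineq[of 1 "g z"] by simp
  hence "norm (f z) * (1 - r) \<le> norm (f z) * norm (1 + g z)" by (intro mult_left_mono) auto
  with 1 show ?thesis using z by (simp add: field_simps)
qed

text \<open>
  Dividing by a Blaschke factor removes one zero \<open>w\<close>, keeps the bound \<open>B\<close> on the unit disc (the factor has modulus 1
  on the circle) and multiplies the modulus of the value at 0 by at least \<open>1 / q\<close>. As that value cannot exceed \<open>B\<close>, the process stops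
  after at most \<open>n\<close> steps. So the same induction bounds the number of zeros, as in Jensen's formula, and produces
  the zero-free factor \<open>g\<close>.
\<close>

lemma divide_out_zeros:
  assumes S: "open S" "cball 0 1 \<subseteq> S" and q: "0 < q" "q < 1"
  assumes "f holomorphic_on S" and "\<And>z. norm z \<le> 1 \<Longrightarrow> norm (f z) \<le> B"
    and "f 0 \<noteq> 0" "B * q ^ n < norm (f 0)"
  shows "\<exists>N\<le>n. \<exists>w g. (\<forall>i<N. norm (w i) \<le> q \<and> f (w i) = 0) \<and> g holomorphic_on S \<and>
    (\<forall>z. norm z \<le> 1 \<longrightarrow> norm (g z) \<le> B \<and> f z = g z * (\<Prod>i<N. (z - w i) / (1 - cnj (w i) * z))) \<and>
    (\<forall>z. norm z \<le> q \<longrightarrow> g z \<noteq> 0) \<and> norm (f 0) \<le> norm (g 0)"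
  using assms(5-)
proof (induction n arbitrary: f)
  case 0
  from 0(2)[of 0] 0(4) show ?case by auto
next
  case (Suc n f)
  show ?case
  proof (cases "\<forall>z. norm z \<le> q \<longrightarrow> f z \<noteq> 0")
    case True
    thus ?thesis using Suc.prems
      by (intro exI[of _ 0] conjI exI[of _ "\<lambda>_. 0"] exI[of _ f]) auto
  next
    case False
    then obtain a where a: "norm a \<le> q" "f a = 0" by auto
    have a0: "a \<noteq> 0" using a Suc.prems by auto
    have aS: "a \<in> S" using a q S(2) by auto
    define h where "h = (\<lambda>z. if z = a then deriv f a else f z / (z - a))"
    have hol: "h holomorphic_on S"
      by (rule pole_theorem_open_0[OF Suc.prems(1) S(1), of a]) (use a in \<open>auto simp: h_def\<close>)
    define g where "g = (\<lambda>z. h z * (1 - cnj a * z))"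
    have g: "g holomorphic_on S" unfolding g_def by (intro holomorphic_intros hol)
    have fh: "f z = h z * (z - a)" for z using a by (auto simp: h_def)
    have nz: "1 - cnj a * z \<noteq> 0" if "norm z \<le> 1" for z
    proof
      assume "1 - cnj a * z = 0"
      hence "norm (cnj a * z) = 1" by simp
      moreover have "norm (cnj a * z) \<le> q * 1" unfolding norm_mult
        using a that q by (intro mult_mono) auto
      ultimately show False using q by simp
    qed
    have fg: "f z = g z * ((z - a) / (1 - cnj a * z))" if "norm z \<le> 1" for z
      using nz[OF that] fh[of z] by (simp add: g_def)
    have bd: "norm (g z) \<le> B" if z: "norm z \<le> 1" for z
    proof (rule maximum_modulus_frontier[of g "cball 0 1"])
      show "g holomorphic_on interior (cball 0 1)"
        by (rule holomorphic_on_subset[OF g]) (use S in auto)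
      show "continuous_on (closure (cball 0 1)) g"
        by (rule holomorphic_on_imp_continuous_on, rule holomorphic_on_subset[OF g]) (use S in auto)
      fix z :: complex assume "z \<in> frontier (cball 0 1)"
      hence z: "norm z = 1" by simp
      have "norm (1 - cnj a * z) = norm (z - a)"
      proof -
        have "z * cnj z = 1" using z complex_norm_square[of z] by simp
        hence "1 - cnj a * z = z * cnj (z - a)" by (simp add: algebra_simps)
        hence "norm (1 - cnj a * z) = norm z * norm (z - a)" by (metis norm_mult complex_mod_cnj)
        thus ?thesis using z by simp
      qed
      hence "norm (g z) = norm (f z)" using fh[of z] by (simp add: g_def norm_mult)
      thus "norm (g z) \<le> B" using Suc.prems(2) z by simp
    qed (use z in auto)
    have f0: "norm (f 0) = norm (g 0) * norm a" using fg[of 0] by (simp add: norm_mult)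
    have "norm (f 0) \<le> norm (g 0) * q" unfolding f0 using a by (intro mult_left_mono) auto
    hence "B * q ^ n * q < norm (g 0) * q" using Suc.prems(4) by (simp add: mult_ac)
    hence Bq: "B * q ^ n < norm (g 0)" using q by (simp add: mult_less_cancel_right)
    have g0: "g 0 \<noteq> 0" using f0 Suc.prems(3) by auto
    from Suc.IH[OF g bd g0 Bq] obtain N w g' where IH: "N \<le> n" 
      "\<And>i. i < N \<Longrightarrow> norm (w i) \<le> q \<and> g (w i) = 0" "g' holomorphic_on S"
      "\<And>z. norm z \<le> 1 \<Longrightarrow> norm (g' z) \<le> B \<and> g z = g' z * (\<Prod>i<N. (z - w i) / (1 - cnj (w i) * z))"
      "\<And>z. norm z \<le> q \<Longrightarrow> g' z \<noteq> 0" "norm (g 0) \<le> norm (g' 0)" by blast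
    have le: "norm (f 0) \<le> norm (g 0)" unfolding f0 using a q by (intro mult_left_le) auto
    show ?thesis
    proof (intro exI[of _ "Suc N"] exI[of _ "\<lambda>i. if i = N then a else w i"] exI[of _ g'] conjI allI impI)
      fix i assume i: "i < Suc N"
      show "norm (if i = N then a else w i) \<le> q" using i IH(2)[of i] a by auto
      show "f (if i = N then a else w i) = 0"
      proof (cases "i = N")
        case False
        thus ?thesis using i IH(2)[of i] q by (subst fg) auto
      qed (use a in auto)
    next
      fix z :: complex assume z: "norm z \<le> 1"
      have "(\<Prod>i<N. (z - (if i = N then a else w i)) / (1 - cnj (if i = N then a else w i) * z))
          = (\<Prod>i<N. (z - w i) / (1 - cnj (w i) * z))" by (rule prod.cong) auto
      thus "f z = g' z * (\<Prod>i<Suc N. (z - (if i = N then a else w i)) / (1 - cnj (if i = N then a else w i) * z))"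
        using IH(4)[OF z] fg[OF z] by simp
    qed (use IH le in auto)
  qed
qed

section \<open>Local structure of the logarithm at the critical line\<close>

lemma norm_Ln_le: "z \<noteq> 0 \<Longrightarrow> norm (Ln z) \<le> \<bar>ln (norm z)\<bar> + pi"
  using cmod_le[of "Ln z"] Im_Ln_le_pi[of z] mpi_less_Im_Ln[of z] by auto

lemma abs_ln_le:
  assumes "x > 0" "x \<le> b" "1 / x \<le> b"
  shows "\<bar>ln x\<bar> \<le> (b :: real)"
proof -
  have "ln x \<le> x" "ln (1 / x) \<le> 1 / x" using assms by (auto intro!: ln_bound)
  thus ?thesis using assms by (auto simp: ln_div)
qed

text \<open>
  The bounds needed in a disc of radius \<open>19/10\<close> around \<open>2 + \<i> * \<tau>\<close>: it stays in \<open>Re s \<ge> 1/10\<close> and away from the pole,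
  and its centre is in the region of absolute convergence.
\<close>

lemma zeta_norm_bounds:
  assumes "riemann_hypothesis"
  shows
  "\<exists>A>1. \<forall>\<tau>\<ge>4. (\<forall>s. 1 / 10 \<le> Re s \<and> cmod (s - Complex 2 \<tau>) \<le> 19 / 10 \<longrightarrow> cmod (zeta s) \<le> A * \<tau>) \<and>
     cmod (log_zeta (Complex 2 \<tau>)) \<le> A \<and> 1 / A \<le> cmod (zeta (Complex 2 \<tau>))"
proof -
  obtain C where C: "C > 0" "\<And>s. Re s \<ge> 1 / 10 \<Longrightarrow> cmod ((s - 1) * zeta s) \<le> 1 + C * cmod s * cmod (s - 1)"
    using zeta_growth by auto
  define B where "B = (\<Sum>n. real n powr (-2))"
  define A where "A = 2 + 3 * C + B + exp B"
  have B: "B \<ge> 0" unfolding B_def by (intro suminf_nonneg) (auto simp: summable_real_powr_iff)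
  have A: "A > 1" "A \<ge> B" "A \<ge> exp B" unfolding A_def using B C(1) exp_gt_zero[of B] by linarith+
  have "cmod (zeta s) \<le> A * \<tau>" if \<tau>: "\<tau> \<ge> 4" and s: "1 / 10 \<le> Re s" "cmod (s - Complex 2 \<tau>) \<le> 19 / 10" for s \<tau>
  proof -
    have im: "\<bar>Im s - \<tau>\<bar> \<le> 19 / 10"
      using abs_Im_le_cmod[of "s - Complex 2 \<tau>"] s by simp
    have "cmod (s - 1) \<ge> \<bar>Im s\<bar>" using abs_Im_le_cmod[of "s - 1"] by simp
    hence s1: "cmod (s - 1) \<ge> 1" using im \<tau> by linarith
    have "cmod s \<le> cmod (s - Complex 2 \<tau>) + cmod (Complex 2 \<tau>)" 
      using norm_triangle_ineq[of "s - Complex 2 \<tau>" "Complex 2 \<tau>"] by simp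
    also have "cmod (Complex 2 \<tau>) \<le> 2 + \<tau>" using cmod_le[of "Complex 2 \<tau>"] \<tau> by simp
    finally have cs: "cmod s \<le> 3 * \<tau>" using s \<tau> by linarith
    have "cmod (s - 1) * cmod (zeta s) \<le> 1 + C * cmod s * cmod (s - 1)"
      using C(2)[OF s(1)] by (simp add: norm_mult)
    also have "\<dots> \<le> cmod (s - 1) + C * (3 * \<tau>) * cmod (s - 1)"
      using C s1 cs by (intro add_mono mult_right_mono mult_left_mono) auto
    also have "\<dots> = cmod (s - 1) * (1 + 3 * C * \<tau>)" by (simp add: algebra_simps)
    finally have "cmod (zeta s) \<le> 1 + 3 * C * \<tau>"
      using s1 by (simp only: mult_le_cancel_left_pos)
    also have "\<dots> \<le> 1 * \<tau> + 3 * C * \<tau>" using \<tau> by simp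
    also have "\<dots> \<le> A * \<tau>" unfolding distrib_right[symmetric]
      using B \<tau> by (intro mult_right_mono) (auto simp: A_def)
    finally show ?thesis .
  qed
  moreover have D: "cmod (dirichlet_log (Complex 2 \<tau>)) \<le> B" for \<tau>
    using dirichlet_tail_bound[OF _ _ _ dirichlet_log_sums[of "Complex 2 \<tau>"]]
    by (simp add: log_coeff_le_1 log_coeff_nonneg abs_of_nonneg B_def)
  moreover have "1 / A \<le> cmod (zeta (Complex 2 \<tau>))" for \<tau>
  proof -
    have "1 / A \<le> exp (- B)" using A by (simp add: exp_minus field_simps)
    also have "\<dots> \<le> exp (Re (dirichlet_log (Complex 2 \<tau>)))"
      using abs_Re_le_cmod[of "dirichlet_log (Complex 2 \<tau>)"] D[of \<tau>] by simp
    also have "\<dots> = cmod (zeta (Complex 2 \<tau>))"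
      using exp_dirichlet_log[of "Complex 2 \<tau>"] norm_exp_eq_Re[of "dirichlet_log (Complex 2 \<tau>)"] by simp
    finally show ?thesis .
  qed
  moreover have "cmod (log_zeta (Complex 2 \<tau>)) \<le> A" for \<tau>
    using D[of \<tau>] log_zeta_eq_dirichlet[OF assms, of "Complex 2 \<tau>"] A by simp
  ultimately show ?thesis using A by (intro exI[of _ A]) auto
qed

text \<open>
  A formula for \<open>log_zeta\<close> to the right of the critical line extends to the line if it is continuous there.
\<close>

lemma log_zeta_boundary_eq:
  assumes RH: "riemann_hypothesis"
    and s: "Re s = 1 / 2" "Im s > 0" "zeta s \<noteq> 0"
    and e: "e > 0" "\<And>z. z \<in> log_zeta_domain \<Longrightarrow> dist z s < e \<Longrightarrow> log_zeta z = h z" and h: "isCont h s"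
  shows "log_zeta s = h s"
proof (rule log_zeta_boundary[OF RH s])
  have "(h \<longlongrightarrow> h s) (at s within log_zeta_domain)"
    using h unfolding isCont_def by (rule Lim_at_imp_Lim_at_within)
  thus "(log_zeta \<longlongrightarrow> h s) (at s within log_zeta_domain)"
    by (rule Lim_transform_within[of _ _ _ _ e]) (use e in auto)
qed

text \<open>
  Scale the disc of radius \<open>19/10\<close> around \<open>c = 2 + \<i> * \<tau>\<close> to the unit disc and divide out the zeros with modulus at
  most \<open>17/19\<close>. Zeta is \<open>O(\<tau>)\<close> on the disc and bounded below at the centre, so there are \<open>O(ln \<tau>)\<close> zeros, and
  the zero-free factor has a logarithm whose real part is at most \<open>O(ln \<tau>)\<close>; the Borel-Caratheodory lemma turns
  this into a bound for its modulus on the disc with radius \<open>16/19\<close>, which is \<open>8/5\<close> in the original scale. All zeros lie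
  on the critical line by the Riemann hypothesis. The denominators of the Blaschke factors do not vanish and are absorbed
  into \<open>Q\<close>. Both sides are then logarithms of zeta on a convex set, so they agree once a multiple of \<open>2 * pi * \<i>\<close> is
  chosen correctly at the centre, and then also on the boundary, by continuity.

  The radius \<open>8/5 > 3/2\<close> makes the discs overlap along the critical line.
\<close>

lemma local_log_zeta:
  assumes RH: "riemann_hypothesis"
  shows "\<exists>C>0. \<forall>\<tau>\<ge>4. \<exists>N (\<gamma> :: nat \<Rightarrow> real) Q. real N \<le> C * ln \<tau> \<and> (\<forall>i<N. \<bar>\<gamma> i - \<tau>\<bar> \<le> 2) \<and>
    continuous_on (ball (Complex 2 \<tau>) (8 / 5)) Q \<and>
    (\<forall>s\<in>ball (Complex 2 \<tau>) (8 / 5). cmod (Q s) \<le> C * ln \<tau> \<and>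
       (Re s > 1 / 2 \<or> Re s = 1 / 2 \<and> Im s \<notin> \<gamma> ` {..<N} \<longrightarrow>
          log_zeta s = Q s + (\<Sum>i<N. Ln (s - Complex (1 / 2) (\<gamma> i)))))"
proof -
  obtain A where A: "A > 1" 
    "\<And>\<tau> s. \<tau> \<ge> 4 \<Longrightarrow> 1 / 10 \<le> Re s \<Longrightarrow> cmod (s - Complex 2 \<tau>) \<le> 19 / 10 \<Longrightarrow> cmod (zeta s) \<le> A * \<tau>"
    "\<And>\<tau>. \<tau> \<ge> 4 \<Longrightarrow> cmod (log_zeta (Complex 2 \<tau>)) \<le> A"
    "\<And>\<tau>. \<tau> \<ge> 4 \<Longrightarrow> 1 / A \<le> cmod (zeta (Complex 2 \<tau>))"
    using zeta_norm_bounds[OF RH] by blast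
  define C1 where "C1 = 2 * ln A + 1"
  define C2 where "C2 = C1 / ln (19 / 17) + 2"
  define C where "C = 2 * (32 * (C1 + 1) + C2 * 20) + A + C2 * 20"
  have C1: "C1 > 0" using A by (simp add: C1_def add_pos_pos)
  have C2: "C2 > 0" using C1 by (simp add: C2_def add_pos_pos)
  have C: "C > 0" "C2 \<le> C" using C1 C2 A by (auto simp: C_def intro!: add_pos_pos)
  show ?thesis
  proof (intro exI[of _ C] conjI allI impI C)
    fix \<tau> :: real assume \<tau>: "\<tau> \<ge> 4"
    define c where "c = Complex 2 \<tau>"
    define f where "f = (\<lambda>z. zeta (c + 19 / 10 * z))"
    have "ln 4 \<ge> (1 :: real)"
    proof -
      have "exp 1 \<le> (3::real)" by (rule exp_le)
      hence "1 \<le> ln (4 :: real)" by (subst ln_ge_iff) auto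
      thus ?thesis .
    qed
    moreover have "ln 4 \<le> ln \<tau>" using \<tau> by simp
    ultimately have ln1: "ln \<tau> \<ge> 1" by linarith
    have lnA: "ln (A * (A * \<tau>)) \<le> C1 * ln \<tau>"
    proof -
      have "ln (A * (A * \<tau>)) = 2 * ln A * 1 + ln \<tau>" using A \<tau> by (simp add: ln_mult)
      also have "\<dots> \<le> 2 * ln A * ln \<tau> + ln \<tau>" using ln1 A by (intro add_right_mono mult_left_mono) auto
      finally show ?thesis by (simp add: C1_def algebra_simps)
    qed
    have lnA0: "ln (A * (A * \<tau>)) > 0"
    proof -
      have "1 * 1 < A * (A * \<tau>)" using A \<tau> mult_strict_mono[of 1 A 1 \<tau>] 
        by (intro mult_strict_mono) auto
      thus ?thesis by simp
    qed
    (* In the original scale the radius is 399 / 200 < 2, so that real parts stay positive. *)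
    define S where "S = ball (0 :: complex) (21 / 20)"
    have S: "open S" "cball 0 1 \<subseteq> S" by (auto simp: S_def)
    have geo: "Re (c + 19 / 10 * z) > 2 - 19 / 10 * r" "Im (c + 19 / 10 * z) > \<tau> - 19 / 10 * r" if "norm z < r" for z r
    proof -
      have "\<bar>Re z\<bar> < r" "\<bar>Im z\<bar> < r" using abs_Re_le_cmod[of z] abs_Im_le_cmod[of z] that by auto
      thus "Re (c + 19 / 10 * z) > 2 - 19 / 10 * r" "Im (c + 19 / 10 * z) > \<tau> - 19 / 10 * r"
        by (auto simp: c_def abs_less_iff)
    qed
    have fS: "f holomorphic_on S"
    proof -
      have "(zeta \<circ> (\<lambda>z. c + 19 / 10 * z)) holomorphic_on S"
      proof (rule holomorphic_on_compose_gen[OF _ zeta_holomorphic])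
        show "(\<lambda>z. c + 19 / 10 * z) ` S \<subseteq> - {1}"
        proof (rule image_subsetI)
          fix z assume "z \<in> S"
          hence "Im (c + 19 / 10 * z) > 0" using geo(2)[of z "21 / 20"] \<tau> by (simp add: S_def)
          hence "c + 19 / 10 * z \<noteq> 1" by (metis less_irrefl one_complex.sel(2))
          thus "c + 19 / 10 * z \<in> - {1}" by simp
        qed
      qed (auto intro!: holomorphic_intros)
      thus ?thesis by (simp add: f_def o_def)
    qed
    have fB: "norm (f z) \<le> A * \<tau>" if z: "norm z \<le> 1" for z
      unfolding f_def
    proof (rule A(2)[OF \<tau>])
      show "1 / 10 \<le> Re (c + 19 / 10 * z)" using abs_Re_le_cmod[of z] z by (auto simp: c_def abs_le_iff)
      show "cmod (c + 19 / 10 * z - Complex 2 \<tau>) \<le> 19 / 10" using z by (simp add: c_def norm_mult)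
    qed
    have f0: "norm (f 0) \<ge> 1 / A" using A(4)[OF \<tau>] by (simp add: f_def c_def)
    hence f0': "f 0 \<noteq> 0" using A by auto
    (* Large enough for A * \<tau> * (17 / 19) ^ n < 1 / A, where A * \<tau> bounds f and 1 / A is a lower bound at 0. *)
    define n where "n = nat \<lceil>ln (A * (A * \<tau>)) / ln (19 / 17)\<rceil> + 1"
    have n1: "real n > ln (A * (A * \<tau>)) / ln (19 / 17)" unfolding n_def by linarith
    have n2: "real n \<le> C2 * ln \<tau>"
    proof -
      have "ln (A * (A * \<tau>)) / ln (19 / 17) > 0" using lnA0 by simp
      hence "real n \<le> ln (A * (A * \<tau>)) / ln (19 / 17) + 2 * 1" unfolding n_def by linarith
      also have "\<dots> \<le> C1 * ln \<tau> / ln (19 / 17) + 2 * ln \<tau>"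
        using lnA ln1 by (intro add_mono divide_right_mono) auto
      finally show ?thesis by (simp add: C2_def algebra_simps)
    qed
    have fn: "A * \<tau> * (17 / 19) ^ n < norm (f 0)"
    proof -
      have "ln (A * (A * \<tau>)) < real n * ln (19 / 17)" using n1 by (simp add: field_simps)
      also have "\<dots> = ln ((19 / 17) ^ n)" by (simp add: ln_realpow)
      finally have "A * (A * \<tau>) < (19 / 17) ^ n" using A \<tau> by (subst (asm) ln_less_cancel_iff) auto
      hence "A * \<tau> * (17 / 19) ^ n < 1 / A" using A \<tau> by (simp add: field_simps)
      thus ?thesis using f0 by linarith
    qed
    have q: "0 < (17 / 19 :: real)" "17 / 19 < (1 :: real)" by auto
    obtain N w g where N: "N \<le> n" and w: "\<And>i. i < N \<Longrightarrow> norm (w i) \<le> 17 / 19 \<and> f (w i) = 0" 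
      and g: "g holomorphic_on S"
        "\<And>z. norm z \<le> 1 \<Longrightarrow> norm (g z) \<le> A * \<tau>"
        "\<And>z. norm z \<le> 1 \<Longrightarrow> f z = g z * (\<Prod>i<N. (z - w i) / (1 - cnj (w i) * z))"
        "\<And>z. norm z \<le> 17 / 19 \<Longrightarrow> g z \<noteq> 0" "norm (f 0) \<le> norm (g 0)"
      using divide_out_zeros[OF S q fS fB f0' fn] by blast
    have gh: "g holomorphic_on ball 0 (17 / 19)" by (rule holomorphic_on_subset[OF g(1)]) (auto simp: S_def)
    obtain lg where lg: "lg holomorphic_on ball 0 (17 / 19)" "\<And>z. norm z < 17 / 19 \<Longrightarrow> g z = exp (lg z)"
      using contractible_imp_holomorphic_log[OF gh convex_imp_contractible[OF convex_ball]] g(4) by auto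
    have lg_bound: "norm (lg z - lg 0) \<le> 32 * (C1 + 1) * ln \<tau>" if z: "norm z \<le> 16 / 19" for z
    proof -
      let ?M = "C1 * ln \<tau> + 1"
      have "norm (lg (17 / 19 * (19 / 17 * z)) - lg 0) \<le> 2 * ?M * (16 / 17) / (1 - 16 / 17)"
      proof (rule Borel_Caratheodory_disc[of "\<lambda>z. lg (17 / 19 * z) - lg 0"])
        have "(lg \<circ> (\<lambda>z. 17 / 19 * z)) holomorphic_on ball 0 1"
          by (rule holomorphic_on_compose_gen[OF _ lg(1)]) (auto intro!: holomorphic_intros simp: norm_mult)
        thus "(\<lambda>z. lg (17 / 19 * z) - lg 0) holomorphic_on ball 0 1"
          by (intro holomorphic_intros) (simp add: o_def)
        show "norm (19 / 17 * z) \<le> 16 / 17" using z by (simp add: norm_mult)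
        fix y :: complex assume y: "norm y < 1"
        let ?y = "17 / 19 * y"
        have y': "norm ?y < 17 / 19" using y by (simp add: norm_mult)
        have "Re (lg ?y - lg 0) = ln (norm (g ?y)) - ln (norm (g 0))"
          using lg(2)[OF y'] lg(2)[of 0] by simp
        also have "\<dots> \<le> ln (A * \<tau>) - ln (1 / A)"
        proof (intro diff_mono)
          have "0 < norm (g ?y)" using g(4)[of ?y] y' by simp
          moreover have "norm (g ?y) \<le> A * \<tau>" using g(2)[of ?y] y' by simp
          ultimately show "ln (norm (g ?y)) \<le> ln (A * \<tau>)" by (intro ln_mono) linarith+
          show "ln (1 / A) \<le> ln (norm (g 0))" using f0 g(5) A by (subst ln_le_cancel_iff) (auto intro: less_le_trans)
        qed
        also have "\<dots> = ln (A * (A * \<tau>))" using A \<tau> by (simp add: ln_mult ln_div)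
        finally show "Re (lg ?y - lg 0) < ?M" using lnA by linarith
      qed auto
      also have "17 / 19 * (19 / 17 * z) = z" by simp
      also have "2 * ?M * (16 / 17) / (1 - 16 / 17) = 32 * ?M" by simp
      also have "\<dots> \<le> 32 * (C1 * ln \<tau> + ln \<tau>)" using ln1 by simp
      finally show ?thesis by (simp add: algebra_simps)
    qed
    define \<gamma> where "\<gamma> = (\<lambda>i. Im (c + 19 / 10 * w i))"
    have rho: "Complex (1 / 2) (\<gamma> i) = c + 19 / 10 * w i" if i: "i < N" for i
    proof -
      let ?r = "c + 19 / 10 * w i"
      have z0: "zeta ?r = 0" using w[OF i] by (simp add: f_def)
      have w1: "norm (w i) < 1" using w[OF i] by simp
      have im: "Im ?r > 0" using geo(2)[OF w1] \<tau> by simp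
      have "Re ?r > 0" using geo(1)[OF w1] by simp
      moreover have "Re ?r < 1"
      proof (rule ccontr)
        assume "\<not> Re ?r < 1"
        hence "?r \<in> log_zeta_domain" using im by (auto simp: log_zeta_domain_def)
        thus False using zeta_nonzero_domain[OF RH] z0 by blast
      qed
      ultimately have "Re ?r = 1 / 2" using RH z0 unfolding riemann_hypothesis_def by blast
      thus ?thesis by (simp add: \<gamma>_def complex_eq_iff)
    qed
    define Z where "Z = (\<lambda>s. (s - c) * (10 / 19))"
    have Zs: "c + 19 / 10 * Z s = s" for s by (simp add: Z_def field_simps)
    have Zb: "norm (Z s) < 16 / 19" if "s \<in> ball c (8 / 5)" for s
    proof -
      have "norm (Z s) = norm (s - c) * norm (10 / 19 :: complex)" unfolding Z_def by (rule norm_mult)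
      moreover have "norm (s - c) < 8 / 5" using that by (simp add: dist_norm norm_minus_commute)
      ultimately show ?thesis by simp
    qed
    have Zw: "Z s - w i = (s - Complex (1 / 2) (\<gamma> i)) * (10 / 19)" if "i < N" for s i
      unfolding rho[OF that] Z_def by (simp add: field_simps)
    have wz: "norm (cnj (w i) * Z s) < 4 / 5" if "i < N" "s \<in> ball c (8 / 5)" for s i
    proof -
      have "norm (cnj (w i) * Z s) \<le> 17 / 19 * (16 / 19)" unfolding norm_mult
        using w[OF that(1)] Zb[OF that(2)] by (intro mult_mono) auto
      thus ?thesis by simp
    qed
    (* The logarithm of a Blaschke denominator, together with the change of scale of z - w. *)
    define lb where "lb = (\<lambda>i s. - Ln (1 - cnj (w i) * Z s) + of_real (ln (10 / 19)))"
    have onw: "1 / 5 \<le> norm (1 - cnj (w i) * Z s)" "norm (1 - cnj (w i) * Z s) \<le> 5"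
       "1 - cnj (w i) * Z s \<notin> \<real>\<^sub>\<le>\<^sub>0" if "i < N" "s \<in> ball c (8 / 5)" for s i
    proof -
      show "1 / 5 \<le> norm (1 - cnj (w i) * Z s)" "norm (1 - cnj (w i) * Z s) \<le> 5"
        using wz[OF that] norm_triangle_ineq4[of 1 "cnj (w i) * Z s"] norm_triangle_ineq2[of 1 "cnj (w i) * Z s"]
        by (simp_all add: norm_one)
      have "Re (cnj (w i) * Z s) \<le> norm (cnj (w i) * Z s)" by (rule complex_Re_le_cmod)
      hence "Re (1 - cnj (w i) * Z s) > 0" using wz[OF that] by (simp add: minus_complex.sel)
      thus "1 - cnj (w i) * Z s \<notin> \<real>\<^sub>\<le>\<^sub>0" by (auto simp: complex_nonpos_Reals_iff)
    qed
    have lb_bound: "norm (lb i s) \<le> 20" if "i < N" "s \<in> ball c (8 / 5)" for s i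
    proof -
      have ne: "1 - cnj (w i) * Z s \<noteq> 0" using onw(3)[OF that] by auto
      have "norm (Ln (1 - cnj (w i) * Z s)) \<le> \<bar>ln (norm (1 - cnj (w i) * Z s))\<bar> + pi"
        by (rule norm_Ln_le[OF ne])
      also have "\<bar>ln (norm (1 - cnj (w i) * Z s))\<bar> \<le> 5"
        using onw(1,2)[OF that] ne by (intro abs_ln_le) (auto simp: field_simps)
      finally have "norm (Ln (1 - cnj (w i) * Z s)) \<le> 9" using pi_less_4 by simp
      moreover have "\<bar>ln (10 / 19 :: real)\<bar> \<le> 2" by (rule abs_ln_le) auto
      ultimately show ?thesis unfolding lb_def
        by (intro norm_triangle_le) (simp only: norm_minus_cancel norm_of_real)
    qed
    have lb_cont: "continuous_on (ball c (8 / 5)) (lb i)" if "i < N" for i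
      unfolding lb_def Z_def
      by (intro continuous_intros) (use onw(3)[OF that] in \<open>auto simp: Z_def\<close>)
    define Q0 where "Q0 = (\<lambda>s. (lg (Z s) - lg 0) + (\<Sum>i<N. lb i s))"
    have N': "real N \<le> C2 * ln \<tau>" using N n2 by linarith
    have Q0_bound: "norm (Q0 s) \<le> (32 * (C1 + 1) + C2 * 20) * ln \<tau>" if "s \<in> ball c (8 / 5)" for s
    proof -
      have "norm (Q0 s) \<le> 32 * (C1 + 1) * ln \<tau> + (\<Sum>i<N. 20)"
        unfolding Q0_def using Zb[OF that]
        by (intro norm_triangle_le add_mono lg_bound sum_norm_le lb_bound that) auto
      also have "(\<Sum>i<N. 20 :: real) \<le> (C2 * ln \<tau>) * 20" using N' by simp
      finally show ?thesis by (simp add: algebra_simps)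
    qed
    have Q0_cont: "continuous_on (ball c (8 / 5)) Q0"
    proof -
      have "continuous_on (ball c (8 / 5)) (\<lambda>s. lg (Z s))"
      proof (rule continuous_on_compose2[OF holomorphic_on_imp_continuous_on[OF lg(1)]])
        show "continuous_on (ball c (8 / 5)) Z" unfolding Z_def by (intro continuous_intros)
        show "Z ` ball c (8 / 5) \<subseteq> ball 0 (17 / 19)"
        proof
          fix y assume "y \<in> Z ` ball c (8 / 5)"
          then obtain x where "x \<in> ball c (8 / 5)" "y = Z x" by auto
          thus "y \<in> ball 0 (17 / 19)" using Zb[of x] by simp
        qed
      qed
      thus ?thesis unfolding Q0_def by (intro continuous_intros lb_cont) auto
    qed
    define L where "L = (\<lambda>s. \<Sum>i<N. Ln (s - Complex (1 / 2) (\<gamma> i)))"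
    have expQ0: "exp (lg 0) * exp (Q0 s + L s) = zeta s" 
      if s: "s \<in> ball c (8 / 5)" "\<And>i. i < N \<Longrightarrow> s \<noteq> Complex (1 / 2) (\<gamma> i)" for s
    proof -
      have "exp (lg 0) * exp (Q0 s + L s) = exp (lg (Z s)) * (\<Prod>i<N. exp (lb i s) * exp (Ln (s - Complex (1 / 2) (\<gamma> i))))"
        by (simp add: Q0_def L_def exp_add exp_diff exp_sum prod.distrib mult_ac)
      also have "exp (lg (Z s)) = g (Z s)" using lg(2)[of "Z s"] Zb[OF s(1)] by simp
      also have "(\<Prod>i<N. exp (lb i s) * exp (Ln (s - Complex (1 / 2) (\<gamma> i)))) =
          (\<Prod>i<N. (Z s - w i) / (1 - cnj (w i) * Z s))"
      proof (rule prod.cong[OF refl])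
        fix i assume "i \<in> {..<N}"
        hence i: "i < N" by simp
        have ne: "1 - cnj (w i) * Z s \<noteq> 0" using onw(3)[OF i s(1)] by auto
        have "exp (lb i s) = (10 / 19) / (1 - cnj (w i) * Z s)"
          unfolding lb_def exp_add exp_minus exp_Ln[OF ne] exp_of_real by (simp add: field_simps)
        moreover have "exp (Ln (s - Complex (1 / 2) (\<gamma> i))) = s - Complex (1 / 2) (\<gamma> i)"
          using s(2)[OF i] by (intro exp_Ln) auto
        ultimately show "exp (lb i s) * exp (Ln (s - Complex (1 / 2) (\<gamma> i))) = (Z s - w i) / (1 - cnj (w i) * Z s)"
          unfolding Zw[OF i] by (simp only: times_divide_eq_left times_divide_eq_right mult.commute)
      qed
      also have "g (Z s) * \<dots> = f (Z s)" using g(3)[of "Z s"] Zb[OF s(1)] by simp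
      also have "\<dots> = zeta s" by (simp only: f_def Zs)
      finally show ?thesis .
    qed
    (* The constant that makes both logarithms agree at the centre; it is a logarithm of exp (lg 0). *)
    define \<kappa> where "\<kappa> = log_zeta c - Q0 c - L c"
    define Q where "Q = (\<lambda>s. Q0 s + \<kappa>)"
    have cin: "c \<in> ball c (8 / 5)" by simp
    have c_rho: "c \<noteq> Complex (1 / 2) x" for x by (simp add: c_def)
    have exp\<kappa>: "exp \<kappa> = exp (lg 0)"
    proof -
      have "exp (log_zeta c) = zeta c"
        by (rule exp_log_zeta[OF RH]) (simp add: log_zeta_domain_def c_def)
      also have "\<dots> = exp (lg 0) * exp (Q0 c + L c)"
        by (rule expQ0[symmetric, OF cin c_rho])
      finally show ?thesis unfolding \<kappa>_def diff_diff_eq exp_diff by simp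
    qed
    have L_bound: "norm (L c) \<le> C2 * 20 * ln \<tau>"
    proof -
      have "norm (L c) \<le> (\<Sum>i<N. 20)"
        unfolding L_def
      proof (rule sum_norm_le)
        fix i assume "i \<in> {..<N}"
        hence i: "i < N" by simp
        have ne: "c - Complex (1 / 2) (\<gamma> i) \<noteq> 0" using c_rho by simp
        have "norm (c - Complex (1 / 2) (\<gamma> i)) = 19 / 10 * norm (w i)" unfolding rho[OF i]
          by (simp add: norm_mult)
        hence u: "norm (c - Complex (1 / 2) (\<gamma> i)) \<le> 16" using w[OF i] by simp
        have l: "norm (c - Complex (1 / 2) (\<gamma> i)) \<ge> 3 / 2"
          using abs_Re_le_cmod[of "c - Complex (1 / 2) (\<gamma> i)"] by (simp add: c_def)
        have "norm (Ln (c - Complex (1 / 2) (\<gamma> i))) \<le> \<bar>ln (norm (c - Complex (1 / 2) (\<gamma> i)))\<bar> + pi"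
          by (rule norm_Ln_le[OF ne])
        also have "\<bar>ln (norm (c - Complex (1 / 2) (\<gamma> i)))\<bar> \<le> 16"
          using u l by (intro abs_ln_le) (auto simp: divide_le_eq)
        finally show "norm (Ln (c - Complex (1 / 2) (\<gamma> i))) \<le> 20" using pi_less_4 by simp
      qed
      thus ?thesis using N' by simp
    qed
    have eq: "log_zeta s = Q s + L s" if s: "s \<in> ball c (8 / 5)" "Re s > 1 / 2" for s
    proof (rule exp_lift_unique[where g = log_zeta and h = "\<lambda>s. Q s + L s" and x = s and ?x0.0 = c 
        and S = "ball c (8 / 5) \<inter> {s. Re s > 1 / 2}"])
      have cv: "convex (ball c (8 / 5) \<inter> {s. Re s > 1 / 2})"
        by (intro convex_Int convex_ball convex_halfspace_Re_gt)
      show "connected (ball c (8 / 5) \<inter> {s. Re s > 1 / 2})" by (rule convex_connected[OF cv])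
      have imp: "Im z > 0" if "z \<in> ball c (8 / 5)" for z
        using geo(2)[of "Z z" "16 / 19"] Zb[OF that] \<tau> unfolding Zs by simp
      have dom: "z \<in> log_zeta_domain" if "z \<in> ball c (8 / 5)" "Re z > 1 / 2" for z
        using imp[OF that(1)] that(2) by (simp add: log_zeta_domain_def)
      show "continuous_on (ball c (8 / 5) \<inter> {s. Re s > 1 / 2}) log_zeta"
        by (rule continuous_on_subset[OF holomorphic_on_imp_continuous_on[OF log_zeta_holomorphic[OF RH]]])
           (use dom in auto)
      have L_cont: "continuous_on (ball c (8 / 5) \<inter> {s. Re s > 1 / 2}) L"
        unfolding L_def by (intro continuous_intros) (auto simp: complex_nonpos_Reals_iff)
      show "continuous_on (ball c (8 / 5) \<inter> {s. Re s > 1 / 2}) (\<lambda>s. Q s + L s)"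
        unfolding Q_def by (intro continuous_intros L_cont continuous_on_subset[OF Q0_cont]) auto
      show "exp (log_zeta z) = exp (Q z + L z)" if "z \<in> ball c (8 / 5) \<inter> {s. Re s > 1 / 2}" for z
      proof -
        have "exp (Q z + L z) = exp \<kappa> * exp (Q0 z + L z)" by (simp add: Q_def exp_add mult_ac)
        also have "\<dots> = zeta z" unfolding exp\<kappa> by (rule expQ0) (use that in auto)
        also have "\<dots> = exp (log_zeta z)" by (rule exp_log_zeta[OF RH, symmetric]) (use that dom in auto)
        finally show ?thesis ..
      qed
      show "c \<in> ball c (8 / 5) \<inter> {s. Re s > 1 / 2}" by (simp add: c_def)
      show "log_zeta c = Q c + L c" by (simp add: Q_def \<kappa>_def)
    qed (use s in auto)
    have eq_boundary: "log_zeta s = Q s + L s" 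
      if s: "s \<in> ball c (8 / 5)" "Re s = 1 / 2" "Im s \<notin> \<gamma> ` {..<N}" for s
    proof -
      have ne: "s \<noteq> Complex (1 / 2) (\<gamma> i)" if "i < N" for i using s(3) that by auto
      obtain e where e: "e > 0" "ball s e \<subseteq> ball c (8 / 5)"
        using s(1) open_contains_ball by (metis open_ball)
      show ?thesis
      proof (rule log_zeta_boundary_eq[OF RH, where h = "\<lambda>s. Q s + L s"])
        show "Im s > 0" using geo(2)[of "Z s" "16 / 19"] Zb[OF s(1)] \<tau> unfolding Zs by simp
        show "zeta s \<noteq> 0" using expQ0[OF s(1) ne] by auto
        show "e / 2 > 0" using e by simp
        show "log_zeta z = Q z + L z" if z: "z \<in> log_zeta_domain" "dist z s < e / 2" for z
        proof (rule eq)
          have "z \<in> ball s e" using e z by (simp add: dist_commute)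
          thus "z \<in> ball c (8 / 5)" using e by blast
          show "Re z > 1 / 2" using z by (auto simp: log_zeta_domain_def)
        qed
        have "isCont Q0 s" using Q0_cont s(1) continuous_on_eq_continuous_at[OF open_ball] by blast
        moreover have "isCont L s" unfolding L_def
        proof (intro continuous_intros)
          fix i assume "i \<in> {..<N}"
          thus "s - Complex (1 / 2) (\<gamma> i) \<notin> \<real>\<^sub>\<le>\<^sub>0"
            using s by (auto simp: complex_nonpos_Reals_iff)
        qed
        ultimately show "isCont (\<lambda>s. Q s + L s) s" unfolding Q_def by (intro continuous_intros)
      qed (use s in auto)
    qed
    have Q_bound: "norm (Q s) \<le> C * ln \<tau>" if "s \<in> ball c (8 / 5)" for s
    proof -
      have "norm (log_zeta c) \<le> A" using A(3)[OF \<tau>] by (simp add: c_def)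
      also have "\<dots> \<le> A * ln \<tau>" using A ln1 by simp
      finally have "norm \<kappa> \<le> A * ln \<tau> + (32 * (C1 + 1) + C2 * 20) * ln \<tau> + C2 * 20 * ln \<tau>"
        unfolding \<kappa>_def diff_conv_add_uminus using Q0_bound[OF cin] L_bound
        by (intro norm_triangle_le add_mono) (simp_all only: norm_minus_cancel)
      hence "norm (Q s) \<le> (32 * (C1 + 1) + C2 * 20) * ln \<tau> + 
         (A * ln \<tau> + (32 * (C1 + 1) + C2 * 20) * ln \<tau> + C2 * 20 * ln \<tau>)"
        unfolding Q_def by (intro norm_triangle_le add_mono Q0_bound that)
      also have "\<dots> = C * ln \<tau>" unfolding C_def by (simp add: algebra_simps)
      finally show ?thesis .
    qed
    have "C2 * ln \<tau> \<le> C * ln \<tau>" using C ln1 by (intro mult_right_mono) auto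
    show "\<exists>N \<gamma> Q. real N \<le> C * ln \<tau> \<and> (\<forall>i<N. \<bar>\<gamma> i - \<tau>\<bar> \<le> 2) \<and>
      continuous_on (ball (Complex 2 \<tau>) (8 / 5)) Q \<and>
      (\<forall>s\<in>ball (Complex 2 \<tau>) (8 / 5). cmod (Q s) \<le> C * ln \<tau> \<and>
       (Re s > 1 / 2 \<or> Re s = 1 / 2 \<and> Im s \<notin> \<gamma> ` {..<N} \<longrightarrow>
          log_zeta s = Q s + (\<Sum>i<N. Ln (s - Complex (1 / 2) (\<gamma> i)))))"
      unfolding c_def[symmetric] L_def[symmetric]
    proof (intro exI[of _ N] exI[of _ \<gamma>] exI[of _ Q] conjI ballI allI impI)
      fix i assume "i < N"
      hence "norm (w i) \<le> 17 / 19" using w by simp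
      thus "\<bar>\<gamma> i - \<tau>\<bar> \<le> 2" using abs_Im_le_cmod[of "w i"] by (simp add: \<gamma>_def c_def)
    next
      show "real N \<le> C * ln \<tau>" using N' \<open>C2 * ln \<tau> \<le> C * ln \<tau>\<close> by linarith
      show "continuous_on (ball c (8 / 5)) Q" unfolding Q_def by (intro continuous_intros Q0_cont)
    next
      fix s assume "s \<in> ball c (8 / 5)" "Re s > 1 / 2 \<or> Re s = 1 / 2 \<and> Im s \<notin> \<gamma> ` {..<N}"
      thus "log_zeta s = Q s + (\<Sum>i<N. Ln (s - Complex (1 / 2) (\<gamma> i)))"
        using eq eq_boundary unfolding L_def by blast
    qed (rule Q_bound)
  qed
qed

section \<open>The kernel and its Fourier transform\<close>

text \<open>
  The entire function that extends \<open>fejer_factor a\<close>.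
\<close>

definition fejer_complex :: "real \<Rightarrow> complex \<Rightarrow> complex" where
  "fejer_complex a w = (if w = 0 then of_real a else sin (of_real a * w) / w)\<^sup>2"

lemma fejer_complex_of_real: "fejer_complex a (of_real u) = of_real (fejer_factor a u)"
  by (simp add: fejer_complex_def fejer_factor_def sin_of_real flip: of_real_mult)

lemma holomorphic_fejer_complex: "fejer_complex a holomorphic_on S"
proof -
  define h where "h = (\<lambda>w. if w = 0 then of_real a else sin (of_real a * w) / w :: complex)"
  have "((\<lambda>w. sin (of_real a * w)) has_field_derivative of_real a) (at (0 :: complex))"
    by (auto intro!: derivative_eq_intros)
  hence "deriv (\<lambda>w :: complex. sin (of_real a * w)) 0 = of_real a" by (rule DERIV_imp_deriv)
  note d = this
  have "(\<lambda>w :: complex. sin (of_real a * w)) holomorphic_on UNIV"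
    by (intro holomorphic_intros)
  hence "h holomorphic_on UNIV"
  proof (rule pole_theorem_open_0[where a = 0])
    show "h 0 = deriv (\<lambda>w. sin (of_real a * w)) 0"
      unfolding d by (simp add: h_def)
  qed (simp_all add: h_def)
  hence "(\<lambda>w. h w ^ 2) holomorphic_on S"
    by (intro holomorphic_intros) (auto intro: holomorphic_on_subset)
  thus ?thesis by (simp add: h_def fejer_complex_def[abs_def])
qed

lemma norm_sin_le: "norm (sin w) \<le> exp \<bar>Im w\<bar>" for w :: complex
proof -
  have "norm (sin w) = norm (exp (\<i> * w) - exp (- (\<i> * w))) / 2"
    by (simp add: sin_exp_eq norm_divide norm_mult)
  also have "\<dots> \<le> (exp (- Im w) + exp (Im w)) / 2"
    using norm_triangle_ineq4[of "exp (\<i> * w)" "exp (- (\<i> * w))"] by simp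
  also have "\<dots> \<le> (exp \<bar>Im w\<bar> + exp \<bar>Im w\<bar>) / 2"
    by (intro divide_right_mono add_mono) auto
  finally show ?thesis by simp
qed

text \<open>
  The entire function that extends the weight of the integral.
\<close>

definition fejer_kernel :: "real \<Rightarrow> real \<Rightarrow> real \<Rightarrow> complex \<Rightarrow> complex" where
  "fejer_kernel a L \<sigma> w = fejer_complex a w * (3 * of_real \<sigma> - 2 * sin (of_real L * w))"

lemma kernel_of_real:
  "fejer_kernel a L \<sigma> (of_real u) = of_real (fejer_factor a u * (\<sigma> * 3 - 2 * sin (u * L)))"
  unfolding fejer_kernel_def fejer_complex_of_real of_real_mult[symmetric] sin_of_real
  by (simp add: mult.commute)

lemma holomorphic_kernel: "fejer_kernel a L \<sigma> holomorphic_on S"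
  unfolding fejer_kernel_def[abs_def] by (intro holomorphic_intros holomorphic_fejer_complex)

lemma norm_kernel_le:
  assumes "a \<ge> 0" "L \<ge> 0" "\<bar>\<sigma>\<bar> = 1" "w \<noteq> 0" "\<bar>Im w\<bar> \<le> y"
  shows "norm (fejer_kernel a L \<sigma> w) \<le> 5 * exp ((2 * a + L) * y) / (norm w)\<^sup>2"
proof -
  have s: "norm (sin (of_real c * w)) \<le> exp (c * y)" if "c \<ge> 0" for c
  proof -
    have "norm (sin (of_real c * w)) \<le> exp \<bar>Im (of_real c * w)\<bar>" by (rule norm_sin_le)
    also have "\<dots> \<le> exp (c * y)" using assms that by (simp add: abs_mult mult_left_mono)
    finally show ?thesis .
  qed
  have y: "y \<ge> 0" using assms by linarith
  have "norm (3 * of_real \<sigma> - 2 * sin (of_real L * w)) \<le> 3 * 1 + 2 * exp (L * y)"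
    using norm_triangle_ineq4[of "3 * of_real \<sigma>" "2 * sin (of_real L * w)"] s[of L] assms
    by (simp add: norm_mult)
  also have "\<dots> \<le> 5 * exp (L * y)" using y assms by simp
  finally have 1: "norm (3 * of_real \<sigma> - 2 * sin (of_real L * w)) \<le> 5 * exp (L * y)" .
  have "norm (fejer_complex a w) = (norm (sin (of_real a * w)) / norm w)\<^sup>2"
    using assms by (simp add: fejer_complex_def norm_power norm_divide)
  also have "\<dots> \<le> (exp (a * y) / norm w)\<^sup>2"
    using assms by (intro power_mono divide_right_mono s) auto
  also have "\<dots> = exp (2 * a * y) / (norm w)\<^sup>2"
    by (simp add: power_divide flip: exp_of_nat_mult)
  finally have "norm (fejer_kernel a L \<sigma> w) \<le> exp (2 * a * y) / (norm w)\<^sup>2 * (5 * exp (L * y))"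
    unfolding fejer_kernel_def norm_mult using 1 by (intro mult_mono) auto
  also have "\<dots> = 5 * exp ((2 * a + L) * y) / (norm w)\<^sup>2"
    by (simp add: exp_add algebra_simps)
  finally show ?thesis .
qed

text \<open>
  A primitive of \<open>(1 - cos (c * u)) / u^2\<close>, obtained by integration by parts (see \<open>cos_primitive_eq\<close>). Written
  with \<open>sinc\<close> it is visibly continuous at 0.
\<close>

definition cos_primitive :: "real \<Rightarrow> real \<Rightarrow> real" where
  "cos_primitive c u = c * Si (c * u) - c * sin (c * u / 2) * sinc (c * u / 2)"

lemma cos_primitive_eq: "u \<noteq> 0 \<Longrightarrow> cos_primitive c u = c * Si (c * u) - (1 - cos (c * u)) / u"
  using cos_double_sin[of "c * u / 2"]
  by (auto simp: cos_primitive_def power2_eq_square)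

lemma continuous_cos_primitive: "continuous_on A (cos_primitive c)"
proof -
  have "continuous_on UNIV Si" by (intro continuous_at_imp_continuous_on) (auto intro: isCont_Si)
  hence "continuous_on A (\<lambda>u. Si (c * u))"
    by (rule continuous_on_compose2) (auto intro!: continuous_intros)
  thus ?thesis unfolding cos_primitive_def[abs_def] by (intro continuous_intros) auto
qed

lemma DERIV_cos_primitive:
  assumes "u \<noteq> 0"
  shows "(cos_primitive c has_real_derivative (1 - cos (c * u)) / u\<^sup>2) (at u)"
proof -
  have 1: "((\<lambda>u. Si (c * u)) has_real_derivative sinc (c * u) * c) (at u)"
    by (rule DERIV_chain2[OF DERIV_Si DERIV_cmult_Id])
  have 2: "((\<lambda>u. (1 - cos (c * u)) / u) has_real_derivative
      (sin (c * u) * c * u - (1 - cos (c * u))) / (u * u)) (at u)"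
    using assms by (auto intro!: derivative_eq_intros)
  have "((\<lambda>u. c * Si (c * u) - (1 - cos (c * u)) / u) has_real_derivative
      c * (sinc (c * u) * c) - (sin (c * u) * c * u - (1 - cos (c * u))) / (u * u)) (at u)"
    by (rule DERIV_diff[OF DERIV_cmult[OF 1] 2])
  also have "c * (sinc (c * u) * c) = (sin (c * u) * c * u) / (u * u)"
    using assms by (cases "c = 0") (auto simp: field_simps)
  also have "(sin (c * u) * c * u) / (u * u) - (sin (c * u) * c * u - (1 - cos (c * u))) / (u * u)
     = (1 - cos (c * u)) / u\<^sup>2"
    unfolding diff_divide_distrib[symmetric] by (simp add: power2_eq_square)
  finally show ?thesis
    by (rule has_field_derivative_transform_within_open[of _ _ _ "- {0}"])
       (use assms cos_primitive_eq in auto)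
qed

lemma cos_primitive_minus: "u \<ge> 0 \<Longrightarrow> cos_primitive c (- u) = - cos_primitive c u"
proof -
  assume u: "u \<ge> 0"
  have "Si (- (c * u)) = - Si (c * u)"
  proof (cases "c \<ge> 0")
    case True
    thus ?thesis using u by (intro Si_neg) auto
  next
    case False
    hence "- (c * u) \<ge> 0" using u by (simp add: mult_le_0_iff)
    from Si_neg[OF this] show ?thesis by simp
  qed
  thus ?thesis by (simp add: cos_primitive_def)
qed

lemma tendsto_cos_primitive: "(cos_primitive c \<longlongrightarrow> \<bar>c\<bar> * (pi / 2)) at_top"
proof -
  have 1: "((\<lambda>u. c * Si (c * u)) \<longlongrightarrow> \<bar>c\<bar> * (pi / 2)) at_top"
  proof -
    have *: "((\<lambda>u. d * Si (d * u)) \<longlongrightarrow> d * (pi / 2)) at_top" if "d > 0" for d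
      by (intro tendsto_mult_left filterlim_compose[OF Si_at_top]
            filterlim_tendsto_pos_mult_at_top[OF tendsto_const that] filterlim_ident)
    consider "c > 0" | "c = 0" | "c < 0" by linarith
    thus ?thesis
    proof cases
      case 3
      have "((\<lambda>u. (-c) * Si ((-c) * u)) \<longlongrightarrow> (-c) * (pi / 2)) at_top" using 3 by (intro *) auto
      moreover have "\<forall>\<^sub>F u in at_top. (-c) * Si ((-c) * u) = c * Si (c * u)"
        using eventually_ge_at_top[of 0]
      proof eventually_elim
        case (elim u)
        hence "(-c) * u \<ge> 0" using 3 by (intro mult_nonneg_nonneg) auto
        from Si_neg[OF this] show ?case by simp
      qed
      ultimately have "((\<lambda>u. c * Si (c * u)) \<longlongrightarrow> (-c) * (pi / 2)) at_top"
        by (rule Lim_transform_eventually)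
      thus ?thesis using 3 by simp
    qed (use * in auto)
  qed
  have 2: "((\<lambda>u. (1 - cos (c * u)) / u) \<longlongrightarrow> 0) at_top"
  proof (rule tendsto_norm_zero_cancel, rule tendsto_sandwich[OF _ _ tendsto_const])
    show "((\<lambda>u::real. 2 / u) \<longlongrightarrow> 0) at_top" by real_asymp
    show "\<forall>\<^sub>F u in at_top. norm ((1 - cos (c * u)) / u) \<le> 2 / u"
      using eventually_gt_at_top[of 0]
    proof eventually_elim
      case (elim u)
      have "\<bar>1 - cos (c * u)\<bar> \<le> 2" using cos_ge_minus_one[of "c * u"] cos_le_one[of "c * u"] by linarith
      thus ?case using elim by (simp add: divide_right_mono)
    qed
  qed auto
  have "((\<lambda>u. c * Si (c * u) - (1 - cos (c * u)) / u) \<longlongrightarrow> \<bar>c\<bar> * (pi / 2) - 0) at_top"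
    by (intro tendsto_diff 1 2)
  hence "((\<lambda>u. c * Si (c * u) - (1 - cos (c * u)) / u) \<longlongrightarrow> \<bar>c\<bar> * (pi / 2)) at_top" by simp
  moreover have "\<forall>\<^sub>F u in at_top. c * Si (c * u) - (1 - cos (c * u)) / u = cos_primitive c u"
    using eventually_gt_at_top[of 0] by eventually_elim (simp add: cos_primitive_eq)
  ultimately show ?thesis by (rule Lim_transform_eventually)
qed

lemma fejer_factor_minus: "fejer_factor a (- u) = fejer_factor a u"
  by (simp add: fejer_factor_def)

lemma continuous_on_fejer_factor: "continuous_on A (fejer_factor a)"
proof -
  have "continuous_on A (\<lambda>u. Re (fejer_complex a (of_real u)))"
    by (intro continuous_intros continuous_on_compose2[OF holomorphic_on_imp_continuous_on[OF holomorphic_fejer_complex[of a UNIV]]]) auto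
  thus ?thesis by (simp add: fejer_complex_of_real)
qed

text \<open>
  The identity \<open>4 * sin(x)^2 * cos(y) = 2 * cos(y) - cos(2x + y) - cos(2x - y)\<close> writes the integrand as a combination of
  three functions \<open>(1 - cos (c * u)) / u^2\<close>.
\<close>

lemma fejer_cos_has_integral:
  assumes "X \<ge> 0"
  shows "((\<lambda>u. fejer_factor a u * cos (b * u)) has_integral
    (cos_primitive (2 * a + b) X + cos_primitive (2 * a - b) X - 2 * cos_primitive b X) / 2) {-X..X}"
proof -
  define P where "P = (\<lambda>u. (cos_primitive (2 * a + b) u + cos_primitive (2 * a - b) u - 2 * cos_primitive b u) / 4)"
  have "((\<lambda>u. fejer_factor a u * cos (b * u)) has_integral (P X - P (-X))) {-X..X}"
  proof (rule fundamental_theorem_of_calculus_interior_strong[of "{0}"])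
    show "continuous_on {-X..X} P"
      unfolding P_def by (intro continuous_on_divide continuous_on_add continuous_on_diff
          continuous_on_mult continuous_on_const continuous_cos_primitive) auto
    fix u assume "u \<in> {-X<..<X} - {0}"
    hence u: "u \<noteq> 0" by auto
    have "(P has_real_derivative ((1 - cos ((2 * a + b) * u)) / u\<^sup>2 + (1 - cos ((2 * a - b) * u)) / u\<^sup>2
        - 2 * ((1 - cos (b * u)) / u\<^sup>2)) / 4) (at u)"
      unfolding P_def by (intro DERIV_cdivide DERIV_diff DERIV_add DERIV_cmult DERIV_cos_primitive u)
    also have "((1 - cos ((2 * a + b) * u)) / u\<^sup>2 + (1 - cos ((2 * a - b) * u)) / u\<^sup>2
        - 2 * ((1 - cos (b * u)) / u\<^sup>2)) / 4 = fejer_factor a u * cos (b * u)"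
    proof -
      have e: "(2 * a + b) * u = 2 * (a * u) + b * u" "(2 * a - b) * u = 2 * (a * u) - b * u"
        by (auto simp: algebra_simps)
      have "cos ((2 * a + b) * u) + cos ((2 * a - b) * u) = 2 * cos (2 * (a * u)) * cos (b * u)"
        unfolding e by (simp add: cos_add cos_diff)
      also have "cos (2 * (a * u)) = 1 - 2 * (sin (a * u))\<^sup>2" by (rule cos_double_sin)
      finally have c: "cos ((2 * a + b) * u) + cos ((2 * a - b) * u) = 2 * (1 - 2 * (sin (a * u))\<^sup>2) * cos (b * u)" .
      have "((1 - cos ((2 * a + b) * u)) / u\<^sup>2 + (1 - cos ((2 * a - b) * u)) / u\<^sup>2 - 2 * ((1 - cos (b * u)) / u\<^sup>2)) / 4
        = (2 * cos (b * u) - (cos ((2 * a + b) * u) + cos ((2 * a - b) * u))) / (4 * u\<^sup>2)"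
        using u by (simp add: divide_simps)
      also have "\<dots> = (4 * ((sin (a * u))\<^sup>2 * cos (b * u))) / (4 * u\<^sup>2)"
        unfolding c by (simp add: algebra_simps)
      also have "\<dots> = fejer_factor a u * cos (b * u)"
        using u by (simp add: fejer_factor_def power_divide)
      finally show ?thesis .
    qed
    finally show "(P has_vector_derivative fejer_factor a u * cos (b * u)) (at u)"
      by (simp add: has_real_derivative_iff_has_vector_derivative)
  qed (use assms in auto)
  also have "P X - P (-X) = (cos_primitive (2 * a + b) X + cos_primitive (2 * a - b) X - 2 * cos_primitive b X) / 2"
    using assms by (simp add: P_def cos_primitive_minus field_simps)
  finally show ?thesis .
qed

text \<open>
  The limits \<open>|c| * pi / 2\<close> of the three primitives combine to
  \<open>pi / 4 * (|2a + b| + |2a - b| - 2 * |b|)\<close>, which is the tent; the sine part vanishes by symmetry.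
\<close>

lemma fejer_fourier_transform:
  assumes "a \<ge> 0"
  shows "((\<lambda>X. integral {-X..X} (\<lambda>u. of_real (fejer_factor a u) * cis (b * u))) \<longlongrightarrow>
     of_real (pi / 2 * max 0 (2 * a - \<bar>b\<bar>))) at_top"
proof -
  define I where "I = (\<lambda>X. (cos_primitive (2 * a + b) X + cos_primitive (2 * a - b) X - 2 * cos_primitive b X) / 2)"
  have "(I \<longlongrightarrow> (\<bar>2 * a + b\<bar> * (pi / 2) + \<bar>2 * a - b\<bar> * (pi / 2) - 2 * (\<bar>b\<bar> * (pi / 2))) / 2) at_top"
    unfolding I_def by (intro tendsto_intros tendsto_cos_primitive) auto
  also have "(\<bar>2 * a + b\<bar> * (pi / 2) + \<bar>2 * a - b\<bar> * (pi / 2) - 2 * (\<bar>b\<bar> * (pi / 2))) / 2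
     = pi / 2 * ((\<bar>2 * a + b\<bar> + \<bar>2 * a - b\<bar> - 2 * \<bar>b\<bar>) / 2)"
    by (simp add: algebra_simps)
  also have "(\<bar>2 * a + b\<bar> + \<bar>2 * a - b\<bar> - 2 * \<bar>b\<bar>) / 2 = max 0 (2 * a - \<bar>b\<bar>)"
    using assms by (auto simp: max_def abs_if)
  finally have "((\<lambda>X. of_real (I X) :: complex) \<longlongrightarrow> of_real (pi / 2 * max 0 (2 * a - \<bar>b\<bar>))) at_top"
    by (rule tendsto_of_real)
  moreover have "\<forall>\<^sub>F X in at_top. of_real (I X) = integral {-X..X} (\<lambda>u. of_real (fejer_factor a u) * cis (b * u))"
    using eventually_ge_at_top[of 0]
  proof eventually_elim
    case (elim X)
    define s where "s = integral {-X..X} (\<lambda>u. fejer_factor a u * sin (b * u))"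
    have int: "(\<lambda>u. fejer_factor a u * sin (b * u)) integrable_on {-X..X}"
      by (intro integrable_continuous_interval continuous_intros continuous_on_fejer_factor)
    have "s = integral {-X..X} (\<lambda>u. - (fejer_factor a u * sin (b * u)))"
      unfolding s_def using Henstock_Kurzweil_Integration.integral_reflect_real[of X "-X" "\<lambda>u. fejer_factor a u * sin (b * u)"]
      by (simp add: fejer_factor_minus)
    hence "s = 0" by (simp add: s_def)
    hence i2: "((\<lambda>u. fejer_factor a u * sin (b * u)) has_integral 0) {-X..X}"
      using integrable_integral[OF int] by (simp add: s_def)
    have i1: "((\<lambda>u. fejer_factor a u * cos (b * u)) has_integral I X) {-X..X}"
      using fejer_cos_has_integral[OF elim] by (simp add: I_def)
    have "((\<lambda>u. of_real (fejer_factor a u * cos (b * u)) + \<i> * of_real (fejer_factor a u * sin (b * u)))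
       has_integral (of_real (I X) + \<i> * of_real 0)) {-X..X}"
      by (intro has_integral_add has_integral_mult_right has_integral_of_real i1 i2)
    moreover have "of_real (fejer_factor a u * cos (b * u)) + \<i> * of_real (fejer_factor a u * sin (b * u)) = 
       of_real (fejer_factor a u) * cis (b * u)" for u
      by (simp add: complex_eq_iff)
    ultimately have "((\<lambda>u. of_real (fejer_factor a u) * cis (b * u)) has_integral of_real (I X)) {-X..X}"
      by simp
    thus ?case by (simp add: integral_unique)
  qed
  ultimately show ?thesis by (rule Lim_transform_eventually)
qed

section \<open>Bounds for the logarithm and the passage to the critical line\<close>

text \<open>
  The function \<open>1 / sqrt \<bar>x - c\<bar>\<close> serves as an integrable majorant of the logarithm: its primitive is
  \<open>2 * sqrt (x - c)\<close>, where \<open>sqrt\<close> is the odd extension of the square root to negative numbers.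
\<close>

lemma inverse_sqrt_integrable: "(\<lambda>x. 1 / sqrt \<bar>x - c\<bar>) integrable_on {p..q}"
proof (cases "p \<le> q")
  case True
  have "((\<lambda>x. 1 / sqrt \<bar>x - c\<bar>) has_integral (2 * sqrt (q - c) - 2 * sqrt (p - c))) {p..q}"
  proof (rule fundamental_theorem_of_calculus_interior_strong[of "{c}"])
    fix x assume "x \<in> {p<..<q} - {c}"
    hence x: "x \<noteq> c" by auto
    have "(sqrt has_real_derivative 1 / (2 * sqrt \<bar>x - c\<bar>)) (at (x - c))"
      by (rule DERIV_real_sqrt_generic) (use x in \<open>auto simp: field_simps simp flip: real_sqrt_minus\<close>)
    hence "((\<lambda>x. sqrt (x - c)) has_real_derivative 1 / (2 * sqrt \<bar>x - c\<bar>) * 1) (at x)"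
      by (rule DERIV_chain2) (auto intro!: derivative_eq_intros)
    hence "((\<lambda>x. 2 * sqrt (x - c)) has_real_derivative 2 * (1 / (2 * sqrt \<bar>x - c\<bar>) * 1)) (at x)"
      by (rule DERIV_cmult)
    thus "((\<lambda>x. 2 * sqrt (x - c)) has_vector_derivative 1 / sqrt \<bar>x - c\<bar>) (at x)"
      by (simp add: has_real_derivative_iff_has_vector_derivative)
  qed (use True in \<open>auto intro!: continuous_intros\<close>)
  thus ?thesis by blast
qed auto

lemma norm_Ln_le_inverse_sqrt:
  assumes "0 < d" "d \<le> norm z" "norm z \<le> 4"
  shows "norm (Ln z) \<le> 8 + 2 / sqrt d"
proof -
  have z: "norm z > 0" using assms by linarith
  have "ln (norm z) \<le> norm z" using z by (intro ln_bound)
  moreover have "- ln (norm z) \<le> 2 / sqrt d"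
  proof -
    have "- ln (norm z) \<le> - ln d" using assms z by simp
    also have "\<dots> = 2 * ln (1 / sqrt d)" using assms by (simp add: ln_div ln_sqrt)
    also have "\<dots> \<le> 2 * (1 / sqrt d)" using assms by (intro mult_left_mono ln_bound) auto
    finally show ?thesis by simp
  qed
  moreover have "2 / sqrt d \<ge> 0" using assms by simp
  ultimately have "\<bar>ln (norm z)\<bar> \<le> 4 + 2 / sqrt d" using assms by linarith
  thus ?thesis using norm_Ln_le[of z] z pi_less_4 by auto
qed

text \<open>
  At distance \<open>y\<close> from the critical line every logarithm in \<open>local_log_zeta\<close> is at most \<open>8 + 2 / sqrt y\<close>, because
  the zeros have real part \<open>1/2\<close>. The bound is integrable over \<open>y\<close>, which a bound by \<open>1 / y\<close>, as the
  Borel-Caratheodory lemma alone would give, is not.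
\<close>

lemma log_zeta_bound:
  assumes RH: "riemann_hypothesis"
  shows "\<exists>C>0. \<forall>\<tau>\<ge>4. \<forall>y\<in>{0<..3/2}. cmod (log_zeta (Complex (1 / 2 + y) \<tau>)) \<le> C * ln \<tau> * (1 + 1 / (2 * sqrt y))"
proof -
  obtain C where C: "C > 0" and *: "\<And>\<tau>. \<tau> \<ge> 4 \<Longrightarrow> \<exists>N (\<gamma> :: nat \<Rightarrow> real) Q. real N \<le> C * ln \<tau> \<and>
    (\<forall>i<N. \<bar>\<gamma> i - \<tau>\<bar> \<le> 2) \<and> continuous_on (ball (Complex 2 \<tau>) (8 / 5)) Q \<and>
    (\<forall>s\<in>ball (Complex 2 \<tau>) (8 / 5). cmod (Q s) \<le> C * ln \<tau> \<and>
       (Re s > 1 / 2 \<or> Re s = 1 / 2 \<and> Im s \<notin> \<gamma> ` {..<N} \<longrightarrow>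
          log_zeta s = Q s + (\<Sum>i<N. Ln (s - Complex (1 / 2) (\<gamma> i)))))"
    using local_log_zeta[OF RH] by blast
  show ?thesis
  proof (intro exI[of _ "9 * C"] conjI allI impI ballI)
    fix \<tau> y :: real assume \<tau>: "\<tau> \<ge> 4" and "y \<in> {0<..3/2}"
    hence y: "y > 0" "y \<le> 3 / 2" by auto
    obtain N \<gamma> Q where N: "real N \<le> C * ln \<tau>" and \<gamma>: "\<And>i. i < N \<Longrightarrow> \<bar>\<gamma> i - \<tau>\<bar> \<le> 2"
      and Q: "\<And>s. s \<in> ball (Complex 2 \<tau>) (8 / 5) \<Longrightarrow> cmod (Q s) \<le> C * ln \<tau>"
      "\<And>s. s \<in> ball (Complex 2 \<tau>) (8 / 5) \<Longrightarrow> Re s > 1 / 2 \<Longrightarrow>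
          log_zeta s = Q s + (\<Sum>i<N. Ln (s - Complex (1 / 2) (\<gamma> i)))" using *[OF \<tau>] by blast
    define s where "s = Complex (1 / 2 + y) \<tau>"
    have s: "s \<in> ball (Complex 2 \<tau>) (8 / 5)"
    proof -
      have "Complex 2 \<tau> - s = of_real (3 / 2 - y)" by (simp add: s_def complex_eq_iff)
      hence "dist (Complex 2 \<tau>) s = \<bar>3 / 2 - y\<bar>" by (simp only: dist_norm norm_of_real)
      thus ?thesis using y by simp
    qed
    have L: "cmod (Ln (s - Complex (1 / 2) (\<gamma> i))) \<le> 8 + 2 / sqrt y" if i: "i < N" for i
    proof (rule norm_Ln_le_inverse_sqrt)
      show "y \<le> cmod (s - Complex (1 / 2) (\<gamma> i))"
        using abs_Re_le_cmod[of "s - Complex (1 / 2) (\<gamma> i)"] y by (simp add: s_def)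
      show "cmod (s - Complex (1 / 2) (\<gamma> i)) \<le> 4"
        using cmod_le[of "s - Complex (1 / 2) (\<gamma> i)"] y \<gamma>[OF i] by (simp add: s_def abs_minus_commute)
    qed (use y in auto)
    have "cmod (log_zeta s) \<le> C * ln \<tau> + (\<Sum>i<N. 8 + 2 / sqrt y)"
    proof -
      have "log_zeta s = Q s + (\<Sum>i<N. Ln (s - Complex (1 / 2) (\<gamma> i)))"
        by (rule Q(2)[OF s]) (use y in \<open>simp add: s_def\<close>)
      thus ?thesis
        by (simp only:) (intro norm_triangle_le add_mono Q(1)[OF s] sum_norm_le L, auto)
    qed
    also have "(\<Sum>i<N. 8 + 2 / sqrt y) = real N * (8 + 2 / sqrt y)" by simp
    also have "\<dots> \<le> C * ln \<tau> * (8 + 2 / sqrt y)" using N y by (intro mult_right_mono) auto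
    also have "C * ln \<tau> + C * ln \<tau> * (8 + 2 / sqrt y) = C * ln \<tau> * (9 + 2 / sqrt y)" by (simp add: algebra_simps)
    also have "\<dots> \<le> C * ln \<tau> * (9 * (1 + 1 / (2 * sqrt y)))"
      using C \<tau> y by (intro mult_left_mono) (auto simp: field_simps)
    finally show "cmod (log_zeta (Complex (1 / 2 + y) \<tau>)) \<le> 9 * C * ln \<tau> * (1 + 1 / (2 * sqrt y))"
      by (simp add: s_def mult_ac)
  qed (use C in auto)
qed

text \<open>
  Here the distance to a zero is bounded below by the difference of the imaginary parts, which does not depend on
  \<open>\<epsilon>\<close>.
\<close>

lemma log_zeta_local_majorant:
  assumes RH: "riemann_hypothesis" and \<tau>0: "\<tau>\<^sub>0 \<ge> 4"
  shows "\<exists>Z h. finite Z \<and> (\<forall>p q. h integrable_on {p..q}) \<and> (\<forall>x. h x \<ge> 0) \<and>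
     (\<forall>\<tau>. \<bar>\<tau> - \<tau>\<^sub>0\<bar> \<le> 1 / 2 \<and> \<tau> \<notin> Z \<longrightarrow>
        (\<forall>\<epsilon>\<in>{0..1/10}. cmod (log_zeta (Complex (1 / 2 + \<epsilon>) \<tau>)) \<le> h \<tau>) \<and>
        ((\<lambda>\<epsilon>. log_zeta (Complex (1 / 2 + \<epsilon>) \<tau>)) \<longlongrightarrow> log_zeta (Complex (1 / 2) \<tau>)) (at_right 0))"
proof -
  obtain C N \<gamma> Q where C: "C > 0" and \<gamma>: "\<And>i::nat. i < N \<Longrightarrow> \<bar>\<gamma> i - \<tau>\<^sub>0\<bar> \<le> 2"
      and Qc: "continuous_on (ball (Complex 2 \<tau>\<^sub>0) (8 / 5)) Q"
      and Q: "\<And>s. s \<in> ball (Complex 2 \<tau>\<^sub>0) (8 / 5) \<Longrightarrow> cmod (Q s) \<le> C * ln \<tau>\<^sub>0"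
      "\<And>s. s \<in> ball (Complex 2 \<tau>\<^sub>0) (8 / 5) \<Longrightarrow> Re s > 1 / 2 \<or> Re s = 1 / 2 \<and> Im s \<notin> \<gamma> ` {..<N} \<Longrightarrow>
          log_zeta s = Q s + (\<Sum>i<N. Ln (s - Complex (1 / 2) (\<gamma> i)))"
    using local_log_zeta[OF RH] \<tau>0 by metis
  define h where "h = (\<lambda>\<tau>. C * ln \<tau>\<^sub>0 + (\<Sum>i<N. 8 + 2 * (1 / sqrt \<bar>\<tau> - \<gamma> i\<bar>)))"
  show ?thesis
  proof (intro exI[of _ "\<gamma> ` {..<N}"] exI[of _ h] conjI allI impI ballI)
    show "h integrable_on {p..q}" for p q
      unfolding h_def
      by (intro integrable_add integrable_sum integrable_on_mult_right inverse_sqrt_integrable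
            integrable_const_ivl) auto
    show "h x \<ge> 0" for x using C \<tau>0 by (auto simp: h_def intro!: add_nonneg_nonneg sum_nonneg)
  next
    fix \<tau> assume \<tau>: "\<bar>\<tau> - \<tau>\<^sub>0\<bar> \<le> 1 / 2 \<and> \<tau> \<notin> \<gamma> ` {..<N}"
    have ball: "Complex (1 / 2 + \<epsilon>) \<tau> \<in> ball (Complex 2 \<tau>\<^sub>0) (8 / 5)" if \<epsilon>: "\<epsilon> \<in> {0..1/10}" for \<epsilon>
    proof -
      have "(cmod (Complex 2 \<tau>\<^sub>0 - Complex (1 / 2 + \<epsilon>) \<tau>))\<^sup>2 = (3 / 2 - \<epsilon>)\<^sup>2 + (\<tau> - \<tau>\<^sub>0)\<^sup>2"
        by (simp add: cmod_power2 power2_commute)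
      also have "\<dots> \<le> (3 / 2)\<^sup>2 + (1 / 2)\<^sup>2"
        using \<epsilon> \<tau> by (intro add_mono power_mono abs_le_square_iff[THEN iffD1]) auto
      also have "\<dots> < (8 / 5)\<^sup>2" by (simp add: power2_eq_square)
      finally have "cmod (Complex 2 \<tau>\<^sub>0 - Complex (1 / 2 + \<epsilon>) \<tau>) < 8 / 5"
        by (rule power2_less_imp_less) simp
      thus ?thesis unfolding mem_ball dist_norm .
    qed
    have eq: "log_zeta (Complex (1 / 2 + \<epsilon>) \<tau>) = Q (Complex (1 / 2 + \<epsilon>) \<tau>) +
        (\<Sum>i<N. Ln (Complex (1 / 2 + \<epsilon>) \<tau> - Complex (1 / 2) (\<gamma> i)))" if \<epsilon>: "\<epsilon> \<in> {0..1/10}" for \<epsilon>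
      using \<epsilon> \<tau> by (intro Q(2) ball) (cases "\<epsilon> = 0", auto)
    show "cmod (log_zeta (Complex (1 / 2 + \<epsilon>) \<tau>)) \<le> h \<tau>" if \<epsilon>: "\<epsilon> \<in> {0..1/10}" for \<epsilon>
      unfolding eq[OF \<epsilon>] h_def
    proof (intro norm_triangle_le add_mono Q(1) ball \<epsilon> sum_norm_le)
      fix i assume "i \<in> {..<N}"
      hence i: "i < N" by simp
      have "cmod (Ln (Complex (1 / 2 + \<epsilon>) \<tau> - Complex (1 / 2) (\<gamma> i))) \<le> 8 + 2 / sqrt \<bar>\<tau> - \<gamma> i\<bar>"
      proof (rule norm_Ln_le_inverse_sqrt)
        show "\<bar>\<tau> - \<gamma> i\<bar> > 0" using \<tau> i by auto
        show "\<bar>\<tau> - \<gamma> i\<bar> \<le> cmod (Complex (1 / 2 + \<epsilon>) \<tau> - Complex (1 / 2) (\<gamma> i))"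
          using abs_Im_le_cmod[of "Complex (1 / 2 + \<epsilon>) \<tau> - Complex (1 / 2) (\<gamma> i)"] by simp
        show "cmod (Complex (1 / 2 + \<epsilon>) \<tau> - Complex (1 / 2) (\<gamma> i)) \<le> 4"
          using cmod_le[of "Complex (1 / 2 + \<epsilon>) \<tau> - Complex (1 / 2) (\<gamma> i)"] \<gamma>[OF i] \<tau> \<epsilon> by (simp add: abs_if split: if_splits)
      qed
      thus "cmod (Ln (Complex (1 / 2 + \<epsilon>) \<tau> - Complex (1 / 2) (\<gamma> i))) \<le> 8 + 2 * (1 / sqrt \<bar>\<tau> - \<gamma> i\<bar>)" by simp
    qed
    have cx: "((\<lambda>\<epsilon>. Complex (1 / 2 + \<epsilon>) \<tau>) \<longlongrightarrow> Complex (1 / 2 + 0) \<tau>) (at_right 0)"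
      by (intro tendsto_intros)
    have "isCont Q (Complex (1 / 2 + 0) \<tau>)"
      using Qc ball[of 0] continuous_on_eq_continuous_at[OF open_ball] by fastforce
    hence Ql: "((\<lambda>\<epsilon>. Q (Complex (1 / 2 + \<epsilon>) \<tau>)) \<longlongrightarrow> Q (Complex (1 / 2 + 0) \<tau>)) (at_right 0)"
      using cx by (rule isCont_tendsto_compose)
    have "((\<lambda>\<epsilon>. Q (Complex (1 / 2 + \<epsilon>) \<tau>) + (\<Sum>i<N. Ln (Complex (1 / 2 + \<epsilon>) \<tau> - Complex (1 / 2) (\<gamma> i))))
       \<longlongrightarrow> Q (Complex (1 / 2 + 0) \<tau>) + (\<Sum>i<N. Ln (Complex (1 / 2 + 0) \<tau> - Complex (1 / 2) (\<gamma> i)))) (at_right 0)"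
    proof (intro tendsto_add Ql tendsto_sum tendsto_Ln tendsto_diff cx tendsto_const)
      fix i assume "i \<in> {..<N}"
      thus "Complex (1 / 2 + 0) \<tau> - Complex (1 / 2) (\<gamma> i) \<notin> \<real>\<^sub>\<le>\<^sub>0"
        using \<tau> by (auto simp: complex_nonpos_Reals_iff)
    qed
    also have "Q (Complex (1 / 2 + 0) \<tau>) + (\<Sum>i<N. Ln (Complex (1 / 2 + 0) \<tau> - Complex (1 / 2) (\<gamma> i))) = 
        log_zeta (Complex (1 / 2) \<tau>)" using eq[of 0] by simp
    finally show "((\<lambda>\<epsilon>. log_zeta (Complex (1 / 2 + \<epsilon>) \<tau>)) \<longlongrightarrow> log_zeta (Complex (1 / 2) \<tau>)) (at_right 0)"
    proof (rule Lim_transform_eventually)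
      have "\<forall>\<^sub>F \<epsilon> in at_right 0. \<epsilon> \<in> {0<..<1/10::real}" by (rule eventually_at_right_real) simp
      thus "\<forall>\<^sub>F \<epsilon> in at_right 0. Q (Complex (1 / 2 + \<epsilon>) \<tau>) +
          (\<Sum>i<N. Ln (Complex (1 / 2 + \<epsilon>) \<tau> - Complex (1 / 2) (\<gamma> i))) = log_zeta (Complex (1 / 2 + \<epsilon>) \<tau>)"
        by eventually_elim (rule eq[symmetric], auto)
    qed
  qed auto
qed

text \<open>
  A finite number of the local majorants, centred at integers, covers the interval; since they are nonnegative, their sum
  dominates each of them.
\<close>

lemma log_zeta_majorant:
  assumes RH: "riemann_hypothesis" and p: "p \<ge> 5"
  shows "\<exists>Z h. finite Z \<and> h integrable_on {p..q} \<and>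
     (\<forall>\<tau>\<in>{p..q} - Z. (\<forall>\<epsilon>\<in>{0..1/10}. cmod (log_zeta (Complex (1 / 2 + \<epsilon>) \<tau>)) \<le> h \<tau>) \<and>
        ((\<lambda>\<epsilon>. log_zeta (Complex (1 / 2 + \<epsilon>) \<tau>)) \<longlongrightarrow> log_zeta (Complex (1 / 2) \<tau>)) (at_right 0))"
proof -
  define P where "P = (\<lambda>\<tau>\<^sub>0 Z h. finite Z \<and> (\<forall>p q. h integrable_on {p..q}) \<and> (\<forall>x. h x \<ge> 0) \<and>
     (\<forall>\<tau>. \<bar>\<tau> - \<tau>\<^sub>0\<bar> \<le> 1 / 2 \<and> \<tau> \<notin> Z \<longrightarrow>
        (\<forall>\<epsilon>\<in>{0..1/10}. cmod (log_zeta (Complex (1 / 2 + \<epsilon>) \<tau>)) \<le> h \<tau>) \<and>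
        ((\<lambda>\<epsilon>. log_zeta (Complex (1 / 2 + \<epsilon>) \<tau>)) \<longlongrightarrow> log_zeta (Complex (1 / 2) \<tau>)) (at_right 0)))"
  have "\<exists>Z h. P (real_of_int k) Z h" if "k \<ge> 4" for k
    using log_zeta_local_majorant[OF RH, of "of_int k"] that unfolding P_def by simp
  then obtain Z h where "\<And>k::int. k \<ge> 4 \<Longrightarrow> P (of_int k) (Z k) (h k)" by metis
  hence Zh: "\<And>k::int. k \<ge> 4 \<Longrightarrow> finite (Z k)" "\<And>k p q. k \<ge> 4 \<Longrightarrow> h k integrable_on {p..q}"
    "\<And>k x. k \<ge> 4 \<Longrightarrow> h k x \<ge> 0"
    "\<And>k \<tau> \<epsilon>. k \<ge> 4 \<Longrightarrow> \<bar>\<tau> - of_int k\<bar> \<le> 1 / 2 \<Longrightarrow> \<tau> \<notin> Z k \<Longrightarrow> \<epsilon> \<in> {0..1/10} \<Longrightarrow>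
        cmod (log_zeta (Complex (1 / 2 + \<epsilon>) \<tau>)) \<le> h k \<tau>"
    "\<And>k \<tau>. k \<ge> 4 \<Longrightarrow> \<bar>\<tau> - of_int k\<bar> \<le> 1 / 2 \<Longrightarrow> \<tau> \<notin> Z k \<Longrightarrow>
        ((\<lambda>\<epsilon>. log_zeta (Complex (1 / 2 + \<epsilon>) \<tau>)) \<longlongrightarrow> log_zeta (Complex (1 / 2) \<tau>)) (at_right 0)"
    unfolding P_def by blast+
  define A where "A = {4..\<lfloor>q + 1 / 2\<rfloor>}"
  have A: "finite A" "\<And>k. k \<in> A \<Longrightarrow> k \<ge> 4" by (auto simp: A_def)
  show ?thesis
  proof (intro exI[of _ "\<Union>k\<in>A. Z k"] exI[of _ "\<lambda>\<tau>. \<Sum>k\<in>A. h k \<tau>"] conjI ballI)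
    show "finite (\<Union>k\<in>A. Z k)" using A Zh(1) by auto
    show "(\<lambda>\<tau>. \<Sum>k\<in>A. h k \<tau>) integrable_on {p..q}" using A Zh(2) by (intro integrable_sum) auto
  next
    fix \<tau> assume \<tau>: "\<tau> \<in> {p..q} - (\<Union>k\<in>A. Z k)"
    (* The nearest integer to \<tau>. *)
    define k where "k = \<lfloor>\<tau> + 1 / 2\<rfloor>"
    have k: "\<bar>\<tau> - of_int k\<bar> \<le> 1 / 2" unfolding k_def by linarith
    have kA: "k \<in> A" 
    proof -
      have "k \<le> \<lfloor>q + 1 / 2\<rfloor>" unfolding k_def using \<tau> by (intro floor_mono) auto
      moreover have "k \<ge> 4" unfolding k_def using \<tau> p by (simp add: le_floor_iff)
      ultimately show ?thesis by (simp add: A_def)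
    qed
    have Zk: "\<tau> \<notin> Z k" using \<tau> kA by auto
    show "((\<lambda>\<epsilon>. log_zeta (Complex (1 / 2 + \<epsilon>) \<tau>)) \<longlongrightarrow> log_zeta (Complex (1 / 2) \<tau>)) (at_right 0)"
      by (rule Zh(5)[OF A(2)[OF kA] k Zk])
    fix \<epsilon> :: real assume \<epsilon>: "\<epsilon> \<in> {0..1/10}"
    have "cmod (log_zeta (Complex (1 / 2 + \<epsilon>) \<tau>)) \<le> h k \<tau>"
      by (rule Zh(4)[OF A(2)[OF kA] k Zk \<epsilon>])
    also have "\<dots> \<le> (\<Sum>k\<in>A. h k \<tau>)"
      by (intro member_le_sum kA Zh(3) A) auto
    finally show "cmod (log_zeta (Complex (1 / 2 + \<epsilon>) \<tau>)) \<le> (\<Sum>k\<in>A. h k \<tau>)" .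
  qed
qed

text \<open>
  Dominated convergence. The finitely many ordinates of zeros, where the value of \<open>log_zeta\<close> is arbitrary, are removed
  from the interval beforehand.
\<close>

lemma critical_line_limit:
  fixes K :: "complex \<Rightarrow> complex" and t H :: real
  defines "F \<equiv> \<lambda>u. log_zeta (Complex (1 / 2) (t + u)) * K (of_real u)"
    and "e \<equiv> \<lambda>k. 1 / (real k + 10)"
  assumes RH: "riemann_hypothesis" and t: "t - H \<ge> 5" and K: "continuous_on UNIV K"
  shows "F absolutely_integrable_on {-H..H}"
    and "(\<lambda>k. integral {-H..H} (\<lambda>u. log_zeta (Complex (1 / 2 + e k) (t + u)) * K (Complex u (- e k))))
       \<longlonglongrightarrow> integral {-H..H} F"
proof -
  obtain Z h where Zh: "finite Z" "h integrable_on {t - H..t + H}"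
    "\<And>\<tau> \<epsilon>. \<tau> \<in> {t - H..t + H} - Z \<Longrightarrow> \<epsilon> \<in> {0..1/10} \<Longrightarrow> cmod (log_zeta (Complex (1 / 2 + \<epsilon>) \<tau>)) \<le> h \<tau>"
    "\<And>\<tau>. \<tau> \<in> {t - H..t + H} - Z \<Longrightarrow> ((\<lambda>\<epsilon>. log_zeta (Complex (1 / 2 + \<epsilon>) \<tau>)) \<longlongrightarrow> log_zeta (Complex (1 / 2) \<tau>)) (at_right 0)"
    using log_zeta_majorant[OF RH t, of "t + H"] by blast
  define Z' where "Z' = (\<lambda>z. z - t) ` Z"
  define S where "S = {-H..H} - Z'"
  have neg: "negligible ({-H..H} - S)" "negligible (S - {-H..H})"
    using Zh(1) by (auto simp: S_def Z'_def intro: negligible_subset[OF negligible_finite[of Z']])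
  have n1: "negligible {x \<in> {-H..H} - S. \<phi> x}" for \<phi> by (rule negligible_subset[OF neg(1)]) auto
  have n2: "negligible {x \<in> S - {-H..H}. \<phi> x}" for \<phi> by (rule negligible_subset[OF neg(2)]) auto
  have SZ: "t + u \<in> {t - H..t + H} - Z" if "u \<in> S" for u
    using that by (force simp: S_def Z'_def image_iff)
  have e: "e k > 0" "e k \<le> 1 / 10" for k by (auto simp: e_def field_simps)
  define D where "D = cbox (Complex (-H) (-1)) (Complex H 0)"
  have D: "Complex u (- x) \<in> D" if "u \<in> {-H..H}" "0 \<le> x" "x \<le> 1" for u x
    using that by (auto simp: D_def in_cbox_complex_iff)
  have "bounded (K ` D)"
    unfolding D_def by (intro compact_imp_bounded compact_continuous_image continuous_on_subset[OF K]) auto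
  then obtain B where B: "\<And>w. w \<in> D \<Longrightarrow> norm (K w) \<le> B" by (auto simp: bounded_iff)
  define f where "f = (\<lambda>k u. log_zeta (Complex (1 / 2 + e k) (t + u)) * K (Complex u (- e k)))"
  define g where "g = (\<lambda>u. h (t + u) * B)"
  have h: "(\<lambda>u. h (t + u)) integrable_on {-H..H}"
  proof -
    have "(\<lambda>x. h (x + t)) integrable_on {t - H - t..t + H - t}"
      by (rule integrable_shift_real_ivl[OF Zh(2)])
    thus ?thesis by (simp add: add.commute)
  qed
  have g: "g integrable_on S"
    unfolding g_def by (rule integrable_spike_set[OF integrable_on_mult_left[OF h] n1 n2])
  have fint: "f k integrable_on {-H..H}" for k
    unfolding f_def
  proof (intro integrable_continuous_interval continuous_intros)
    show "continuous_on {-H..H} (\<lambda>u. log_zeta (Complex (1 / 2 + e k) (t + u)))"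
      by (rule continuous_on_compose2[OF holomorphic_on_imp_continuous_on[OF log_zeta_holomorphic[OF RH]]])
         (use e[of k] t in \<open>auto simp: log_zeta_domain_def intro!: continuous_intros\<close>)
    show "continuous_on {-H..H} (\<lambda>u. K (Complex u (- e k)))"
      by (rule continuous_on_compose2[OF K]) (auto intro!: continuous_intros)
  qed
  have fS: "f k integrable_on S" for k
    by (rule integrable_spike_set[OF fint n1 n2])
  have hB: "norm (a * K w) \<le> h (t + u) * B" if "norm a \<le> h (t + u)" "w \<in> D" for a w u
  proof -
    have "0 \<le> h (t + u)" using that(1) norm_ge_zero order_trans by blast
    thus ?thesis unfolding norm_mult using that B by (intro mult_mono) auto
  qed
  have fg: "norm (f k u) \<le> g u" if u: "u \<in> S" for k u
    unfolding f_def g_def using u e[of k] 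
    by (intro hB Zh(3) SZ D) (auto simp: S_def)
  have Fg: "norm (F u) \<le> g u" if u: "u \<in> S" for u
    unfolding F_def g_def using u Zh(3)[OF SZ[OF u], of 0] D[of u 0]
    by (intro hB) (auto simp: S_def Complex_eq)
  have e0: "filterlim e (at_right 0) sequentially"
    unfolding e_def by real_asymp
  have lim: "(\<lambda>k. f k u) \<longlonglongrightarrow> F u" if u: "u \<in> S" for u
  proof -
    have 1: "(\<lambda>k. log_zeta (Complex (1 / 2 + e k) (t + u))) \<longlonglongrightarrow> log_zeta (Complex (1 / 2) (t + u))"
      by (rule filterlim_compose[OF Zh(4)[OF SZ[OF u]] e0])
    have "e \<longlonglongrightarrow> 0" unfolding e_def by real_asymp
    hence cl: "(\<lambda>k. Complex u (- e k)) \<longlonglongrightarrow> Complex u (- 0)" by (intro tendsto_intros)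
    have "isCont K (Complex u (- 0))" using K continuous_on_eq_continuous_at[OF open_UNIV] by blast
    from isCont_tendsto_compose[OF this cl]
    have "(\<lambda>k. K (Complex u (- e k))) \<longlonglongrightarrow> K (Complex u (- 0))" .
    moreover have "Complex u (- 0) = of_real u" by (simp add: complex_eq_iff)
    ultimately have 2: "(\<lambda>k. K (Complex u (- e k))) \<longlonglongrightarrow> K (of_real u)" by simp
    show ?thesis unfolding f_def F_def by (intro tendsto_mult 1 2)
  qed
  have "F integrable_on S" and I: "(\<lambda>k. integral S (f k)) \<longlonglongrightarrow> integral S F"
    using Equivalence_Lebesgue_Henstock_Integration.dominated_convergence[OF fS g fg lim] by auto
  hence "F absolutely_integrable_on S" using g Fg by (intro absolutely_integrable_integrable_bound[of S F g]) auto
  thus "F absolutely_integrable_on {-H..H}"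
    by (rule absolutely_integrable_spike_set[OF _ n2 n1])
  have "integral S \<phi> = integral {-H..H} \<phi>" for \<phi> :: "real \<Rightarrow> complex"
    by (rule integral_spike_set[OF n2 n1])
  thus "(\<lambda>k. integral {-H..H} (\<lambda>u. log_zeta (Complex (1 / 2 + e k) (t + u)) * K (Complex u (- e k))))
       \<longlonglongrightarrow> integral {-H..H} F" using I by (simp add: f_def)
qed

section \<open>Moving the contour to the line of real part two\<close>

text \<open>
  Cauchy's theorem for a rectangle, with the contribution of its vertical sides estimated. A primitive on the convex set
  \<open>S\<close> evaluates all four sides.
\<close>

lemma shift_contour:
  assumes S: "open S" "convex S" and \<Phi>: "\<Phi> holomorphic_on S"
    and X: "X \<ge> 0" and y: "y1 \<le> y2"
    and rect: "\<And>u y. u \<in> {-X..X} \<Longrightarrow> y \<in> {y1..y2} \<Longrightarrow> Complex u (-y) \<in> S"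
    and h: "(h has_integral B) {y1..y2}"
      "\<And>y. y \<in> {y1..y2} \<Longrightarrow> cmod (\<Phi> (Complex X (-y))) \<le> h y"
      "\<And>y. y \<in> {y1..y2} \<Longrightarrow> cmod (\<Phi> (Complex (-X) (-y))) \<le> h y"
  shows "cmod (integral {-X..X} (\<lambda>u. \<Phi> (Complex u (-y1))) - integral {-X..X} (\<lambda>u. \<Phi> (Complex u (-y2)))) \<le> 2 * B"
proof -
  obtain \<Psi> where \<Psi>: "\<And>z. z \<in> S \<Longrightarrow> (\<Psi> has_field_derivative \<Phi> z) (at z)"
    using holomorphic_convex_primitive'[OF S(2,1) \<Phi>] at_within_open[OF _ S(1)] by metis
  have hor: "((\<lambda>u. \<Phi> (Complex u (-y))) has_integral (\<Psi> (Complex X (-y)) - \<Psi> (Complex (-X) (-y)))) {-X..X}"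
    if y: "y \<in> {y1..y2}" for y
  proof (rule fundamental_theorem_of_calculus)
    fix u assume u: "u \<in> {-X..X}"
    have "((\<lambda>u. Complex u (-y)) has_vector_derivative 1) (at u within {-X..X})"
      unfolding Complex_eq by (auto intro!: derivative_eq_intros)
    from field_vector_diff_chain_within[OF this has_field_derivative_at_within[OF \<Psi>[OF rect[OF u y]]]]
    show "((\<lambda>u. \<Psi> (Complex u (-y))) has_vector_derivative \<Phi> (Complex u (-y))) (at u within {-X..X})"
      by (simp add: o_def)
  qed (use X in auto)
  have ver: "cmod (\<Psi> (Complex u (-y2)) - \<Psi> (Complex u (-y1))) \<le> B"
    if u: "u \<in> {-X..X}" and le: "\<And>y. y \<in> {y1..y2} \<Longrightarrow> cmod (\<Phi> (Complex u (-y))) \<le> h y" for u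
  proof -
    have i: "((\<lambda>y. - \<i> * \<Phi> (Complex u (-y))) has_integral (\<Psi> (Complex u (-y2)) - \<Psi> (Complex u (-y1)))) {y1..y2}"
    proof (rule fundamental_theorem_of_calculus)
      fix y assume y: "y \<in> {y1..y2}"
      have "((\<lambda>y. Complex u (-y)) has_vector_derivative - \<i>) (at y within {y1..y2})"
        unfolding Complex_eq by (auto intro!: derivative_eq_intros)
      from field_vector_diff_chain_within[OF this has_field_derivative_at_within[OF \<Psi>[OF rect[OF u y]]]]
      show "((\<lambda>y. \<Psi> (Complex u (-y))) has_vector_derivative - \<i> * \<Phi> (Complex u (-y))) (at y within {y1..y2})"
        by (simp add: o_def)
    qed (use y in auto)
    have "cmod (integral {y1..y2} (\<lambda>y. - \<i> * \<Phi> (Complex u (-y)))) \<le> integral {y1..y2} h"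
      by (rule Henstock_Kurzweil_Integration.integral_norm_bound_integral)
         (use i h(1) le in \<open>auto simp: norm_mult has_integral_integrable_integral\<close>)
    thus ?thesis unfolding integral_unique[OF i] integral_unique[OF h(1)] .
  qed
  have "integral {-X..X} (\<lambda>u. \<Phi> (Complex u (-y1))) - integral {-X..X} (\<lambda>u. \<Phi> (Complex u (-y2)))
    = (\<Psi> (Complex (-X) (-y2)) - \<Psi> (Complex (-X) (-y1))) - (\<Psi> (Complex X (-y2)) - \<Psi> (Complex X (-y1)))"
    using hor[of y1] hor[of y2] y by (simp add: integral_unique)
  also have "cmod \<dots> \<le> B + B"
    using X by (intro norm_triangle_le_diff add_mono ver h) auto
  finally show ?thesis by simp
qed

text \<open>
  The bound is uniform over \<open>0 \<le> y \<le> 3/2\<close>, so it applies both to the sides of the rectangle and to its bottom.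
\<close>

lemma norm_kernel_shifted:
  assumes "a \<ge> 0" "L \<ge> 0" "\<bar>\<sigma>\<bar> = 1" "\<bar>u\<bar> \<ge> H" "H > 0" "y \<in> {0..3/2}"
  shows "norm (fejer_kernel a L \<sigma> (Complex u (-y))) \<le> 5 * exp ((2 * a + L) * (3 / 2)) / H\<^sup>2"
proof -
  have "norm (fejer_kernel a L \<sigma> (Complex u (-y))) \<le> 5 * exp ((2 * a + L) * (3 / 2)) / (norm (Complex u (-y)))\<^sup>2"
  proof (rule norm_kernel_le)
    have "u \<noteq> 0" using assms(4,5) by auto
    thus "Complex u (-y) \<noteq> 0" by (simp add: complex_eq_iff)
  qed (use assms in auto)
  also have "\<dots> \<le> 5 * exp ((2 * a + L) * (3 / 2)) / H\<^sup>2"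
  proof -
    have n: "H \<le> norm (Complex u (-y))" using abs_Re_le_cmod[of "Complex u (-y)"] assms by simp
    hence n0: "0 < norm (Complex u (-y))" using assms(5) by linarith
    show ?thesis
      by (intro divide_left_mono power_mono n mult_pos_pos zero_less_power n0) (use assms in auto)
  qed
  finally show ?thesis .
qed

lemma inverse_sqrt_primitive:
  fixes c p q :: real
  assumes "0 < p" "p \<le> q"
  shows "((\<lambda>y. c * (1 + 1 / (2 * sqrt y))) has_integral c * ((q + sqrt q) - (p + sqrt p))) {p..q}"
proof (rule has_integral_mult_right, rule fundamental_theorem_of_calculus)
  fix y assume "y \<in> {p..q}"
  hence "y > 0" using assms by auto
  hence "((\<lambda>y. y + sqrt y) has_real_derivative 1 + 1 / (2 * sqrt y)) (at y)"
    by (auto intro!: derivative_eq_intros simp: field_simps)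
  thus "((\<lambda>y. y + sqrt y) has_vector_derivative 1 + 1 / (2 * sqrt y)) (at y within {p..q})"
    using has_real_derivative_iff_has_vector_derivative has_vector_derivative_at_within by blast
qed (use assms in auto)

text \<open>
  The rectangle has its top at height \<open>\<epsilon>\<close> below the real axis and its bottom at height \<open>3/2\<close> below it; these correspond
  to the lines \<open>Re s = 1/2 + \<epsilon>\<close> and \<open>Re s = 2\<close>. The estimate of the sides does not depend on \<open>\<epsilon>\<close> because the bound in
  \<open>log_zeta_bound\<close> is integrable up to 0.
\<close>

lemma shift_log_zeta_integral:
  assumes RH: "riemann_hypothesis"
  shows "\<exists>C>0. \<forall>a L \<sigma> t H. a \<ge> 0 \<and> L \<ge> 0 \<and> \<bar>\<sigma>\<bar> = 1 \<and> H \<ge> 1 \<and> t - H \<ge> 5 \<longrightarrow>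
    (\<lambda>u. log_zeta (Complex (1 / 2) (t + u)) * fejer_kernel a L \<sigma> (of_real u)) absolutely_integrable_on {-H..H} \<and>
    cmod (integral {-H..H} (\<lambda>u. log_zeta (Complex (1 / 2) (t + u)) * fejer_kernel a L \<sigma> (of_real u)) -
          integral {-H..H} (\<lambda>u. log_zeta (Complex 2 (t + u)) * fejer_kernel a L \<sigma> (Complex u (- (3 / 2)))))
      \<le> C * ln (t + H) * exp ((2 * a + L) * (3 / 2)) / H\<^sup>2"
proof -
  obtain C where C: "C > 0" "\<And>\<tau> y. \<tau> \<ge> 4 \<Longrightarrow> y \<in> {0<..3/2} \<Longrightarrow>
      cmod (log_zeta (Complex (1 / 2 + y) \<tau>)) \<le> C * ln \<tau> * (1 + 1 / (2 * sqrt y))"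
    using log_zeta_bound[OF RH] by blast
  show ?thesis
  proof (intro exI[of _ "30 * C"] conjI allI impI)
    fix a L \<sigma> t H :: real
    assume *: "a \<ge> 0 \<and> L \<ge> 0 \<and> \<bar>\<sigma>\<bar> = 1 \<and> H \<ge> 1 \<and> t - H \<ge> 5"
    define K where "K = fejer_kernel a L \<sigma>"
    define M where "M = 5 * exp ((2 * a + L) * (3 / 2)) / H\<^sup>2"
    have M: "M \<ge> 0" by (simp add: M_def)
    have Kc: "continuous_on UNIV K"
      unfolding K_def by (rule holomorphic_on_imp_continuous_on[OF holomorphic_kernel])
    have tH: "t - H \<ge> 5" using * by simp
    note lim = critical_line_limit[OF RH tH Kc]
    show "(\<lambda>u. log_zeta (Complex (1 / 2) (t + u)) * fejer_kernel a L \<sigma> (of_real u)) absolutely_integrable_on {-H..H}"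
      using lim(1) by (simp add: K_def)
    define \<Phi> where "\<Phi> = (\<lambda>w. log_zeta (1 / 2 + \<i> * (of_real t + w)) * K w)"
    have \<Phi>: "\<Phi> (Complex u (-y)) = log_zeta (Complex (1 / 2 + y) (t + u)) * K (Complex u (-y))" for u y
    proof -
      have "1 / 2 + \<i> * (of_real t + Complex u (-y)) = Complex (1 / 2 + y) (t + u)"
        by (simp add: complex_eq_iff)
      thus ?thesis by (simp add: \<Phi>_def)
    qed
    define S where "S = {w. Im w < 0} \<inter> {w. Re w > - t}"
    define J where "J = integral {-H..H} (\<lambda>u. log_zeta (Complex 2 (t + u)) * K (Complex u (- (3 / 2))))"
    have bd: "cmod (integral {-H..H} (\<lambda>u. log_zeta (Complex (1 / 2 + e) (t + u)) * K (Complex u (- e))) - J)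
        \<le> 30 * C * ln (t + H) * exp ((2 * a + L) * (3 / 2)) / H\<^sup>2" if e: "e > 0" "e \<le> 1 / 10" for e
    proof -
      have hb: "cmod (\<Phi> (Complex u (-y))) \<le> C * ln (t + H) * M * (1 + 1 / (2 * sqrt y))"
        if u: "\<bar>u\<bar> = H" and y: "y \<in> {e..3/2}" for u y
      proof -
        have y': "y \<in> {0<..3/2}" using y e by auto
        have tu: "t + u \<ge> 4" "t + u \<le> t + H" using u * by (auto simp: abs_if split: if_splits)
        have "cmod (\<Phi> (Complex u (-y))) \<le> (C * ln (t + u) * (1 + 1 / (2 * sqrt y))) * M"
          unfolding \<Phi> norm_mult K_def M_def
          by (intro mult_mono C(2) tu norm_kernel_shifted) (use * u y' C tu in \<open>auto intro!: mult_nonneg_nonneg\<close>)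
        also have "\<dots> \<le> (C * ln (t + H) * (1 + 1 / (2 * sqrt y))) * M"
          using tu C M y' by (intro mult_right_mono mult_left_mono) auto
        finally show ?thesis by (simp add: mult_ac)
      qed
      have "cmod (integral {-H..H} (\<lambda>u. \<Phi> (Complex u (-e))) - integral {-H..H} (\<lambda>u. \<Phi> (Complex u (-(3/2)))))
         \<le> 2 * (C * ln (t + H) * M * ((3 / 2 + sqrt (3 / 2)) - (e + sqrt e)))"
      proof (rule shift_contour[where S = S])
        show "open S" unfolding S_def by (intro open_Int open_halfspace_Im_lt open_halfspace_Re_gt)
        show "convex S" unfolding S_def by (intro convex_Int convex_halfspace_Im_lt convex_halfspace_Re_gt)
        have "(\<lambda>w. log_zeta (1 / 2 + \<i> * (of_real t + w))) holomorphic_on S"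
          by (rule holomorphic_on_compose_gen[OF _ log_zeta_holomorphic[OF RH], unfolded o_def])
             (auto intro!: holomorphic_intros simp: S_def log_zeta_domain_def)
        thus "\<Phi> holomorphic_on S" unfolding \<Phi>_def K_def by (intro holomorphic_intros holomorphic_kernel)
        show "((\<lambda>y. C * ln (t + H) * M * (1 + 1 / (2 * sqrt y))) has_integral
            C * ln (t + H) * M * ((3 / 2 + sqrt (3 / 2)) - (e + sqrt e))) {e..3/2}"
          by (rule inverse_sqrt_primitive) (use e in auto)
      qed (use * e hb in \<open>auto simp: S_def\<close>)
      also have "\<dots> \<le> 2 * (C * ln (t + H) * M * 3)"
      proof -
        have "sqrt (3 / 2) \<le> sqrt ((3 / 2)\<^sup>2)" by (intro real_sqrt_le_mono) (simp add: power2_eq_square)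
        hence "sqrt (3 / 2) \<le> 3 / 2" by simp
        moreover have "e + sqrt e \<ge> 0" using e by simp
        ultimately have "(3 / 2 + sqrt (3 / 2)) - (e + sqrt e) \<le> 3" by linarith
        thus ?thesis using C M * by (intro mult_left_mono mult_nonneg_nonneg) auto
      qed
      finally show ?thesis by (simp add: \<Phi> J_def M_def mult_ac)
    qed
    have "(\<lambda>k. cmod (integral {-H..H} (\<lambda>u. log_zeta (Complex (1 / 2 + 1 / (real k + 10)) (t + u)) *
           K (Complex u (- (1 / (real k + 10))))) - J)) \<longlonglongrightarrow>
       cmod (integral {-H..H} (\<lambda>u. log_zeta (Complex (1 / 2) (t + u)) * K (of_real u)) - J)"
      by (intro tendsto_intros lim(2))
    hence "cmod (integral {-H..H} (\<lambda>u. log_zeta (Complex (1 / 2) (t + u)) * K (of_real u)) - J)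
        \<le> 30 * C * ln (t + H) * exp ((2 * a + L) * (3 / 2)) / H\<^sup>2"
    proof (rule tendsto_upperbound)
      show "\<forall>\<^sub>F k in sequentially. cmod (integral {-H..H} (\<lambda>u. log_zeta (Complex (1 / 2 + 1 / (real k + 10)) (t + u)) *
           K (Complex u (- (1 / (real k + 10))))) - J)
        \<le> 30 * C * ln (t + H) * exp ((2 * a + L) * (3 / 2)) / H\<^sup>2"
        by (intro always_eventually allI bd) (auto simp: field_simps)
    qed auto
    thus "cmod (integral {-H..H} (\<lambda>u. log_zeta (Complex (1 / 2) (t + u)) * fejer_kernel a L \<sigma> (of_real u)) -
          integral {-H..H} (\<lambda>u. log_zeta (Complex 2 (t + u)) * fejer_kernel a L \<sigma> (Complex u (- (3 / 2)))))
      \<le> 30 * C * ln (t + H) * exp ((2 * a + L) * (3 / 2)) / H\<^sup>2"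
      by (simp add: K_def J_def)
  qed (use C in auto)
qed

section \<open>Integrating the Dirichlet series term by term\<close>

definition tent :: "real \<Rightarrow> real \<Rightarrow> real" where "tent a b = max 0 (2 * a - \<bar>b\<bar>)"

text \<open>
  The Fourier transform of the kernel at frequency \<open>l\<close>. The three tents come from the constant and from the two
  exponentials in \<open>-2 * sin (L * u) = \<i> * (cis (L * u) - cis (-L * u))\<close>.
\<close>

definition kernel_transform :: "real \<Rightarrow> real \<Rightarrow> real \<Rightarrow> real \<Rightarrow> complex" where
  "kernel_transform a L \<sigma> l = of_real (pi / 2) *
     (3 * of_real \<sigma> * of_real (tent a l) + \<i> * of_real (tent a (L - l)) - \<i> * of_real (tent a (L + l)))"

lemma continuous_on_kernel_line: "continuous_on A (\<lambda>u. fejer_kernel a L \<sigma> (Complex u y))"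
  by (rule continuous_on_compose2[OF holomorphic_on_imp_continuous_on[OF holomorphic_kernel[of _ _ _ UNIV]]])
     (auto intro!: continuous_intros)

lemma kernel_transform_real:
  assumes "a \<ge> 0"
  shows "((\<lambda>X. integral {-X..X} (\<lambda>u. exp (- \<i> * of_real u * of_real l) * fejer_kernel a L \<sigma> (of_real u)))
    \<longlongrightarrow> kernel_transform a L \<sigma> l) at_top"
proof -
  define f where "f = (\<lambda>b u. complex_of_real (fejer_factor a u) * cis (b * u))"
  have fc: "continuous_on A (f b)" for A b
    unfolding f_def by (intro continuous_intros continuous_on_fejer_factor)
  have fi: "f b integrable_on {-X..X}" for b X by (rule integrable_continuous_interval[OF fc])
  have f: "((\<lambda>X. integral {-X..X} (f b)) \<longlongrightarrow> of_real (pi / 2 * tent a b)) at_top" for b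
    using fejer_fourier_transform[OF assms, of b] by (simp add: f_def tent_def)
  have eq: "exp (- \<i> * of_real u * of_real l) * fejer_kernel a L \<sigma> (of_real u) =
      3 * of_real \<sigma> * f (- l) u + \<i> * f (L - l) u - \<i> * f (- L - l) u" for u
  proof -
    have c: "exp (- \<i> * of_real u * of_real l) = cis (- l * u)" by (simp add: cis_conv_exp mult_ac)
    have s: "2 * complex_of_real (sin (L * u)) = - \<i> * (cis (L * u) - cis (- L * u))"
      by (simp add: complex_eq_iff)
    have a: "cis ((L - l) * u) = cis (- l * u) * cis (L * u)" "cis ((- L - l) * u) = cis (- l * u) * cis (- L * u)"
      by (simp_all add: cis_mult algebra_simps)
    have k: "fejer_kernel a L \<sigma> (of_real u) = of_real (fejer_factor a u) * (3 * of_real \<sigma> - 2 * complex_of_real (sin (L * u)))"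
      unfolding kernel_of_real by (simp add: mult_ac)
    show ?thesis unfolding k c s f_def a by (simp add: algebra_simps)
  qed
  have "((\<lambda>X. 3 * of_real \<sigma> * integral {-X..X} (f (- l)) + \<i> * integral {-X..X} (f (L - l)) - \<i> * integral {-X..X} (f (- L - l)))
    \<longlongrightarrow> 3 * of_real \<sigma> * of_real (pi / 2 * tent a (- l)) + \<i> * of_real (pi / 2 * tent a (L - l))
        - \<i> * of_real (pi / 2 * tent a (- L - l))) at_top"
    by (intro tendsto_intros f)
  also have "3 * of_real \<sigma> * of_real (pi / 2 * tent a (- l)) + \<i> * of_real (pi / 2 * tent a (L - l))
        - \<i> * of_real (pi / 2 * tent a (- L - l)) = kernel_transform a L \<sigma> l"
  proof -
    have "\<bar>- L - l\<bar> = \<bar>L + l\<bar>" by linarith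
    hence "tent a (- l) = tent a l" "tent a (- L - l) = tent a (L + l)"
      by (simp_all only: tent_def abs_minus_cancel)
    thus ?thesis by (simp add: kernel_transform_def algebra_simps)
  qed
  also have "(\<lambda>X. 3 * of_real \<sigma> * integral {-X..X} (f (- l)) + \<i> * integral {-X..X} (f (L - l)) - \<i> * integral {-X..X} (f (- L - l)))
    = (\<lambda>X. integral {-X..X} (\<lambda>u. exp (- \<i> * of_real u * of_real l) * fejer_kernel a L \<sigma> (of_real u)))"
  proof
    fix X
    have "((\<lambda>u. 3 * of_real \<sigma> * f (- l) u + \<i> * f (L - l) u - \<i> * f (- L - l) u) has_integral
       3 * of_real \<sigma> * integral {-X..X} (f (- l)) + \<i> * integral {-X..X} (f (L - l)) - \<i> * integral {-X..X} (f (- L - l))) {-X..X}"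
      by (intro has_integral_add has_integral_diff has_integral_mult_right integrable_integral fi)
    thus "3 * of_real \<sigma> * integral {-X..X} (f (- l)) + \<i> * integral {-X..X} (f (L - l)) - \<i> * integral {-X..X} (f (- L - l))
       = integral {-X..X} (\<lambda>u. exp (- \<i> * of_real u * of_real l) * fejer_kernel a L \<sigma> (of_real u))"
      unfolding eq by (rule integral_unique[symmetric])
  qed
  finally show ?thesis .
qed

text \<open>
  The \<open>n\<close>-th term of the series is an entire function of \<open>w\<close>, and for \<open>l = ln n \<ge> 0\<close> it decays like \<open>1 / X^2\<close> on the
  vertical sides, so the improper integral over the line of height \<open>3/2\<close> below the real axis equals the one over the
  real axis.
\<close>

lemma kernel_transform_shifted:
  assumes a: "a \<ge> 0" "L \<ge> 0" "\<bar>\<sigma>\<bar> = 1" "l \<ge> 0"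
  defines "\<Phi> \<equiv> \<lambda>w. exp (- \<i> * w * of_real l) * fejer_kernel a L \<sigma> w"
  shows "((\<lambda>X. integral {-X..X} (\<lambda>u. \<Phi> (Complex u (- (3 / 2))))) \<longlongrightarrow> kernel_transform a L \<sigma> l) at_top"
proof -
  define M where "M = (\<lambda>X. 5 * exp ((2 * a + L) * (3 / 2)) / X\<^sup>2)"
  define I where "I = (\<lambda>y X. integral {-X..X} (\<lambda>u. \<Phi> (Complex u (- y))))"
  have 1: "(I 0 \<longlongrightarrow> kernel_transform a L \<sigma> l) at_top"
    using kernel_transform_real[OF a(1), of l L \<sigma>] by (simp add: I_def \<Phi>_def Complex_eq)
  have 2: "((\<lambda>X. I 0 X - I (3 / 2) X) \<longlongrightarrow> 0) at_top"
  proof (rule tendsto_norm_zero_cancel, rule tendsto_sandwich[OF _ _ tendsto_const])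
    show "((\<lambda>X. 2 * (3 / 2 * M X)) \<longlongrightarrow> 0) at_top" unfolding M_def by real_asymp
    show "\<forall>\<^sub>F X in at_top. norm (I 0 X - I (3 / 2) X) \<le> 2 * (3 / 2 * M X)"
      using eventually_gt_at_top[of 0]
    proof eventually_elim
      case (elim X)
      have b: "cmod (\<Phi> (Complex u (-y))) \<le> M X" if "\<bar>u\<bar> = X" "y \<in> {0..3/2}" for u y
      proof -
        have "cmod (exp (- \<i> * Complex u (-y) * of_real l)) \<le> 1"
          using that a by (simp add: mult_nonneg_nonneg)
        moreover have "cmod (fejer_kernel a L \<sigma> (Complex u (-y))) \<le> M X"
          unfolding M_def by (rule norm_kernel_shifted) (use a that elim in auto)
        ultimately have "cmod (\<Phi> (Complex u (-y))) \<le> 1 * M X"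
          unfolding \<Phi>_def norm_mult by (intro mult_mono) auto
        thus ?thesis by simp
      qed
      show ?case
        unfolding I_def
      proof (rule shift_contour[where S = UNIV])
        show "\<Phi> holomorphic_on UNIV" unfolding \<Phi>_def by (intro holomorphic_intros holomorphic_kernel)
        show "((\<lambda>_::real. M X) has_integral (3 / 2 * M X)) {0..3/2}"
          using has_integral_const_real[of "M X" 0 "3/2"] by simp
      qed (use elim b in auto)
    qed
  qed auto
  from tendsto_diff[OF 1 2] show ?thesis by (simp add: I_def)
qed

lemma norm_shifted_term_le:
  assumes a: "a \<ge> 0" "L \<ge> 0" "\<bar>\<sigma>\<bar> = 1" and u: "u \<noteq> 0"
  shows "cmod (exp (- \<i> * Complex u (- (3 / 2)) * of_real l) * fejer_kernel a L \<sigma> (Complex u (- (3 / 2))))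
    \<le> exp (- (3 / 2) * l) * (5 * exp ((2 * a + L) * (3 / 2)) / u\<^sup>2)"
proof -
  have "cmod (exp (- \<i> * Complex u (- (3 / 2)) * of_real l)) = exp (- (3 / 2) * l)" by simp
  moreover have "cmod (fejer_kernel a L \<sigma> (Complex u (- (3 / 2)))) \<le> 5 * exp ((2 * a + L) * (3 / 2)) / \<bar>u\<bar>\<^sup>2"
    by (rule norm_kernel_shifted) (use a u in auto)
  ultimately show ?thesis unfolding norm_mult power2_abs by (simp only:) (intro mult_left_mono, auto)
qed

lemma inverse_square_integral:
  fixes c p q :: real
  assumes "0 < p" "p \<le> q"
  shows "((\<lambda>u. c / u\<^sup>2) has_integral c / p - c / q) {p..q}"
proof -
  have "((\<lambda>u. c / u\<^sup>2) has_integral (- c / q - (- c / p))) {p..q}"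
  proof (rule fundamental_theorem_of_calculus[where f = "\<lambda>u. - c / u"])
    fix u assume "u \<in> {p..q}"
    hence "u \<noteq> 0" using assms by auto
    hence "((\<lambda>u. - c / u) has_real_derivative c / u\<^sup>2) (at u)"
      by (auto intro!: derivative_eq_intros simp: power2_eq_square)
    thus "((\<lambda>u. - c / u) has_vector_derivative c / u\<^sup>2) (at u within {p..q})"
      using has_real_derivative_iff_has_vector_derivative has_vector_derivative_at_within by blast
  qed (use assms in auto)
  thus ?thesis by simp
qed

text \<open>
  The truncation to \<open>{-H..H}\<close> has to be estimated on the lower line and not on the real axis, for the sake of the factor
  \<open>exp (- 3/2 * l) = n powr (- 3/2)\<close>: it makes the sum of these errors over \<open>n\<close> convergent.
\<close>

lemma kernel_transform_tail:
  assumes a: "a \<ge> 0" "L \<ge> 0" "\<bar>\<sigma>\<bar> = 1" "l \<ge> 0" and H: "H > 0"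
  defines "\<Phi> \<equiv> \<lambda>w. exp (- \<i> * w * of_real l) * fejer_kernel a L \<sigma> w"
  shows "cmod (integral {-H..H} (\<lambda>u. \<Phi> (Complex u (- (3 / 2)))) - kernel_transform a L \<sigma> l)
     \<le> exp (- (3 / 2) * l) * (10 * exp ((2 * a + L) * (3 / 2)) / H)"
proof -
  define E where "E = exp (- (3 / 2) * l) * (5 * exp ((2 * a + L) * (3 / 2)))"
  define f where "f = (\<lambda>u. \<Phi> (Complex u (- (3 / 2))))"
  have fc: "continuous_on A f" for A
    unfolding f_def \<Phi>_def by (intro continuous_intros continuous_on_kernel_line)
  have fi: "f integrable_on {p..q}" for p q by (rule integrable_continuous_interval[OF fc])
  have fb: "cmod (f u) \<le> E / u\<^sup>2" if "u \<noteq> 0" for u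
    using norm_shifted_term_le[OF a(1-3) that, of l] by (simp add: f_def \<Phi>_def E_def)
  have E: "E \<ge> 0" by (simp add: E_def)
  have half: "cmod (integral {H..X} g) \<le> E / H"
    if X: "X \<ge> H" and g: "continuous_on {H..X} g" "\<And>u. u \<noteq> 0 \<Longrightarrow> cmod (g u) \<le> E / u\<^sup>2" for X and g :: "real \<Rightarrow> complex"
  proof -
    note i = inverse_square_integral[OF H X, of E]
    have "cmod (integral {H..X} g) \<le> integral {H..X} (\<lambda>u. E / u\<^sup>2)"
      by (rule Henstock_Kurzweil_Integration.integral_norm_bound_integral)
         (use i H g in \<open>auto intro: integrable_continuous_interval\<close>)
    also have "\<dots> = E / H - E / X" by (rule integral_unique[OF i])
    also have "\<dots> \<le> E / H" using E H X by simp
    finally show ?thesis .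
  qed
  have bd: "cmod (integral {-H..H} f - integral {-X..X} f) \<le> 2 * E / H" if X: "X \<ge> H" for X
  proof -
    have "integral {-X..X} f = integral {-X..-H} f + integral {-H..X} f"
      by (rule Henstock_Kurzweil_Integration.integral_combine[symmetric]) (use X H fi in auto)
    also have "integral {-H..X} f = integral {-H..H} f + integral {H..X} f"
      by (rule Henstock_Kurzweil_Integration.integral_combine[symmetric]) (use X H fi in auto)
    also have "integral {-X..-H} f = integral {H..X} (\<lambda>u. f (-u))"
      using Henstock_Kurzweil_Integration.integral_reflect_real[of "-H" "-X" f] by simp
    finally have "integral {-H..H} f - integral {-X..X} f = - (integral {H..X} (\<lambda>u. f (-u)) + integral {H..X} f)"
      by simp
    also have "cmod \<dots> \<le> E / H + E / H"
      unfolding norm_minus_cancel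
    proof (intro norm_triangle_le add_mono half X fc)
      show "continuous_on {H..X} (\<lambda>u. f (- u))"
        by (rule continuous_on_compose2[OF fc[of UNIV]]) (auto intro!: continuous_intros)
      show "cmod (f (- u)) \<le> E / u\<^sup>2" if "u \<noteq> 0" for u using fb[of "-u"] that by simp
    qed (use fb in auto)
    finally show ?thesis by simp
  qed
  have "((\<lambda>X. integral {-X..X} f) \<longlongrightarrow> kernel_transform a L \<sigma> l) at_top"
    using kernel_transform_shifted[OF a] by (simp add: f_def \<Phi>_def)
  hence "((\<lambda>X. cmod (integral {-H..H} f - integral {-X..X} f)) \<longlongrightarrow>
      cmod (integral {-H..H} f - kernel_transform a L \<sigma> l)) at_top"
    by (intro tendsto_intros)
  hence "cmod (integral {-H..H} f - kernel_transform a L \<sigma> l) \<le> 2 * E / H"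
    by (rule tendsto_upperbound) (auto intro: eventually_mono[OF eventually_ge_at_top[of H]] bd)
  thus ?thesis by (simp add: E_def f_def mult_ac)
qed

lemma norm_log_coeff_term:
  assumes "n > 0"
  shows "cmod (of_real (log_coeff n) / of_nat n powr Complex (1 / 2) t) \<le> real n powr (- 1 / 2)"
proof -
  have "of_real (log_coeff n) / of_nat n powr Complex (1 / 2) t =
      of_real (log_coeff n) * (1 / of_nat n powr Complex (1 / 2) t)" by simp
  also have "cmod \<dots> = \<bar>log_coeff n\<bar> * real n powr (- (1 / 2))"
    unfolding norm_mult norm_of_real norm_dirichlet_term[OF assms] complex.sel ..
  also have "\<dots> \<le> 1 * real n powr (- (1 / 2))"
    using log_coeff_le_1[of n] log_coeff_nonneg[of n] by (intro mult_right_mono) auto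
  finally show ?thesis by simp
qed

text \<open>
  Replacing the series by its first \<open>N\<close> terms costs an error that tends to 0, because the series converges uniformly on
  the line \<open>Re s = 2\<close>. In the finite sum each integral may be completed by \<open>kernel_transform_tail\<close>, and
  the total error is bounded by \<open>\<Sum>n. n powr (-1/2) * n powr (-3/2)\<close> times the error factor. The kernel transform vanishes
  for all large \<open>n\<close>, so the completed sum does not depend on \<open>N \<ge> N0\<close>.
\<close>

lemma dirichlet_integral:
  assumes a: "a \<ge> 0" "L \<ge> 0" "\<bar>\<sigma>\<bar> = 1" and H: "H > 0"
    and N0: "\<And>n. n \<ge> N0 \<Longrightarrow> kernel_transform a L \<sigma> (ln (real n)) = 0"
  shows "cmod (integral {-H..H} (\<lambda>u. dirichlet_log (Complex 2 (t + u)) * fejer_kernel a L \<sigma> (Complex u (- (3 / 2)))) -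
     (\<Sum>n<N0. of_real (log_coeff n) / of_nat n powr Complex (1 / 2) t * kernel_transform a L \<sigma> (ln (real n))))
     \<le> (\<Sum>n. real n powr (-2)) * (10 * exp ((2 * a + L) * (3 / 2)) / H)"
proof -
  define E where "E = 10 * exp ((2 * a + L) * (3 / 2)) / H"
  have E: "E \<ge> 0" using H by (simp add: E_def)
  define K where "K = (\<lambda>u. fejer_kernel a L \<sigma> (Complex u (- (3 / 2))))"
  define c where "c = (\<lambda>n. of_real (log_coeff n) / of_nat n powr Complex (1 / 2) t :: complex)"
  define \<Phi> where "\<Phi> = (\<lambda>n u. exp (- \<i> * Complex u (- (3 / 2)) * of_real (ln (real n))) * K u)"
  define J where "J = (\<lambda>n. kernel_transform a L \<sigma> (ln (real n)))"
  define b where "b = (\<lambda>n. real n powr (-2))"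
  have sb: "summable b" unfolding b_def by (simp add: summable_real_powr_iff)
  have b0: "b n \<ge> 0" for n by (simp add: b_def)
  have Kc: "continuous_on A K" for A unfolding K_def by (rule continuous_on_kernel_line)
  have \<Phi>i: "\<Phi> n integrable_on {-H..H}" for n
    unfolding \<Phi>_def by (intro integrable_continuous_interval continuous_intros Kc)
  obtain B where B: "\<And>u. u \<in> {-H..H} \<Longrightarrow> norm (K u) \<le> B" "B \<ge> 0"
  proof -
    have "bounded (K ` {-H..H})" by (intro compact_imp_bounded compact_continuous_image Kc) auto
    thus ?thesis using that unfolding bounded_pos by (metis imageI less_imp_le)
  qed
  define g where "g = (\<lambda>n u. of_real (log_coeff n) * (1 / of_nat n powr Complex 2 (t + u)) :: complex)"
  have g\<Phi>: "g n u * K u = c n * \<Phi> n u" for n u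
  proof (cases "n = 0")
    case False
    have "of_nat n powr Complex 2 (t + u) = 
       of_nat n powr (Complex (1 / 2) t + \<i> * Complex u (- (3 / 2)))"
      by (rule arg_cong[where f = "\<lambda>x. of_nat n powr x"]) (simp add: complex_eq_iff)
    also have "\<dots> = of_nat n powr Complex (1 / 2) t * of_nat n powr (\<i> * Complex u (- (3 / 2)))"
      by (rule powr_add)
    also have "of_nat n powr (\<i> * Complex u (- (3 / 2))) = exp (\<i> * Complex u (- (3 / 2)) * of_real (ln (real n)))"
      using False by (simp add: powr_def Ln_of_nat mult_ac)
    finally have e: "of_nat n powr Complex 2 (t + u) =
        of_nat n powr Complex (1 / 2) t * exp (\<i> * Complex u (- (3 / 2)) * of_real (ln (real n)))" .
    have "\<Phi> n u = inverse (exp (\<i> * Complex u (- (3 / 2)) * of_real (ln (real n)))) * K u"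
      unfolding \<Phi>_def by (simp only: mult_minus_left exp_minus)
    thus ?thesis unfolding g_def c_def e
      by (simp only: divide_inverse inverse_mult_distrib mult_1_left mult_ac)
  qed (simp add: g_def c_def)
  have gb: "cmod (g n u) \<le> b n" for n u
  proof (cases "n = 0")
    case False
    hence "cmod (g n u) = log_coeff n * real n powr (-2)"
      unfolding g_def norm_mult by (subst norm_dirichlet_term) (auto simp: log_coeff_nonneg)
    also have "\<dots> \<le> 1 * real n powr (-2)" by (intro mult_right_mono log_coeff_le_1) auto
    finally show ?thesis by (simp add: b_def)
  qed (simp add: g_def b_def)
  define r where "r = (\<lambda>N. \<Sum>n. b (n + N))"
  have dl: "cmod (dirichlet_log (Complex 2 (t + u)) - (\<Sum>n<N. g n u)) \<le> r N" for u N
  proof -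
    have s: "(\<lambda>n. g n u) sums dirichlet_log (Complex 2 (t + u))"
      unfolding g_def by (rule dirichlet_log_sums) simp
    have "dirichlet_log (Complex 2 (t + u)) - (\<Sum>n<N. g n u) = (\<Sum>n. g (n + N) u)"
      using suminf_minus_initial_segment[of "\<lambda>n. g n u" N] s by (simp add: sums_iff)
    also have "cmod \<dots> \<le> r N" unfolding r_def
      by (rule norm_suminf_le) (use gb sb in \<open>auto intro: summable_ignore_initial_segment\<close>)
    finally show ?thesis .
  qed
  define V where "V = (\<Sum>n<N0. c n * J n)"
  define D where "D = (\<lambda>u. dirichlet_log (Complex 2 (t + u)) * K u)"
  have Di: "D integrable_on {-H..H}"
    unfolding D_def
  proof (intro integrable_continuous_interval continuous_intros Kc)
    have "continuous_on {s. Re s > 1} dirichlet_log"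
      using dirichlet_log_deriv DERIV_isCont by (intro continuous_at_imp_continuous_on) blast
    thus "continuous_on {-H..H} (\<lambda>u. dirichlet_log (Complex 2 (t + u)))"
      by (rule continuous_on_compose2) (auto intro!: continuous_intros)
  qed
  have main: "cmod (integral {-H..H} D - V) \<le> r N * B * (2 * H) + (\<Sum>n. b n) * E" if N: "N \<ge> N0" for N
  proof -
    have V: "V = (\<Sum>n<N. c n * J n)"
      unfolding V_def by (rule sum.mono_neutral_left) (use N N0 in \<open>auto simp: J_def\<close>)
    have P: "((\<lambda>u. \<Sum>n<N. c n * \<Phi> n u) has_integral (\<Sum>n<N. c n * integral {-H..H} (\<Phi> n))) {-H..H}"
      by (intro has_integral_sum has_integral_mult_right integrable_integral \<Phi>i) auto
    have "integral {-H..H} D - V = integral {-H..H} (\<lambda>u. D u - (\<Sum>n<N. c n * \<Phi> n u)) +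
        (\<Sum>n<N. c n * (integral {-H..H} (\<Phi> n) - J n))"
      using Di P unfolding V
      by (subst Henstock_Kurzweil_Integration.integral_diff) 
         (auto simp: integral_unique[OF P] sum_subtractf right_diff_distrib)
    also have "cmod \<dots> \<le> r N * B * (2 * H) + (\<Sum>n. b n) * E"
    proof (intro norm_triangle_le add_mono)
      have "cmod (integral {-H..H} (\<lambda>u. D u - (\<Sum>n<N. c n * \<Phi> n u))) \<le> integral {-H..H} (\<lambda>u. r N * B)"
      proof (rule Henstock_Kurzweil_Integration.integral_norm_bound_integral)
        show "(\<lambda>u. D u - (\<Sum>n<N. c n * \<Phi> n u)) integrable_on {-H..H}"
          using Di P by (intro integrable_diff) auto
        fix u assume u: "u \<in> {-H..H}"
        have "D u - (\<Sum>n<N. c n * \<Phi> n u) = (dirichlet_log (Complex 2 (t + u)) - (\<Sum>n<N. g n u)) * K u"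
          unfolding D_def g\<Phi>[symmetric] by (simp add: sum_distrib_right left_diff_distrib)
        also have "cmod \<dots> \<le> r N * B" unfolding norm_mult
          using dl B(1)[OF u] order_trans[OF norm_ge_zero dl] by (intro mult_mono) auto
        finally show "cmod (D u - (\<Sum>n<N. c n * \<Phi> n u)) \<le> r N * B" .
      qed auto
      also have "\<dots> = r N * B * (2 * H)" using H by simp
      finally show "cmod (integral {-H..H} (\<lambda>u. D u - (\<Sum>n<N. c n * \<Phi> n u))) \<le> r N * B * (2 * H)" .
      have "cmod (\<Sum>n<N. c n * (integral {-H..H} (\<Phi> n) - J n)) \<le> (\<Sum>n<N. b n * E)"
      proof (rule sum_norm_le)
        fix n
        show "cmod (c n * (integral {-H..H} (\<Phi> n) - J n)) \<le> b n * E"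
        proof (cases "n = 0")
          case False
          hence n: "real n > 0" by simp
          have 1: "cmod (c n) \<le> real n powr (- 1 / 2)"
            unfolding c_def by (rule norm_log_coeff_term) (use False in simp)
          have 2: "cmod (integral {-H..H} (\<Phi> n) - J n) \<le> exp (- (3 / 2) * ln (real n)) * E"
            unfolding \<Phi>_def K_def J_def E_def
            by (rule kernel_transform_tail[OF a _ H]) (use False in auto)
          have "cmod (c n * (integral {-H..H} (\<Phi> n) - J n)) \<le> real n powr (- 1 / 2) * (exp (- (3 / 2) * ln (real n)) * E)"
            unfolding norm_mult by (intro mult_mono 1 2) auto
          also have "exp (- (3 / 2) * ln (real n)) = real n powr (- 3 / 2)" using n by (simp add: powr_def)
          also have "real n powr (- 1 / 2) * (real n powr (- 3 / 2) * E) = b n * E"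
            by (simp add: b_def mult.assoc[symmetric] powr_add[symmetric])
          finally show ?thesis .
        qed (simp add: c_def b_def)
      qed
      also have "\<dots> = (\<Sum>n<N. b n) * E" by (simp add: sum_distrib_right)
      also have "\<dots> \<le> (\<Sum>n. b n) * E"
        using sb b0 E by (intro mult_right_mono sum_le_suminf) auto
      finally show "cmod (\<Sum>n<N. c n * (integral {-H..H} (\<Phi> n) - J n)) \<le> (\<Sum>n. b n) * E" .
    qed
    finally show ?thesis .
  qed
  have "(\<lambda>N. r N * B * (2 * H) + (\<Sum>n. b n) * E) \<longlonglongrightarrow> 0 * B * (2 * H) + (\<Sum>n. b n) * E"
    unfolding r_def by (intro tendsto_intros suminf_exist_split2 sb)
  hence "cmod (integral {-H..H} D - V) \<le> 0 * B * (2 * H) + (\<Sum>n. b n) * E"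
    by (rule tendsto_lowerbound) (auto intro!: eventually_mono[OF eventually_ge_at_top[of N0]] main)
  thus ?thesis by (simp add: D_def K_def V_def c_def J_def b_def E_def)
qed

section \<open>Evaluation of the sum and conclusion\<close>

text \<open>
  With \<open>x = exp (2 * a)\<close> this says \<open>\<Sum>n\<le>x. n powr (-1/2) * ln (x / n) \<le> 16 * sqrt x\<close>. Since
  \<open>ln (x / n) \<le> 4 * (x / n) powr (1/4)\<close>, each term is at most \<open>4 * x powr (1/4) * n powr (-3/4)\<close>, and
  \<open>n powr (-3/4)\<close> is at most four times the increment of \<open>n powr (1/4)\<close>, so the sum telescopes. The minimum on the right
  carries the induction over the terms with \<open>n > x\<close>, which vanish.
\<close>

lemma sum_tent_le:
  assumes "a \<ge> 0"
  shows "(\<Sum>n\<in>{1..N}. real n powr (- 1 / 2) * max 0 (2 * a - ln (real n))) \<le> 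
    16 * exp (a / 2) * min (real N powr (1 / 4)) (exp (a / 2))"
proof (induction N)
  case (Suc N)
  let ?n = "real (Suc N)"
  show ?case
  proof (cases "ln ?n < 2 * a")
    case False
    hence "max 0 (2 * a - ln ?n) = 0" by simp
    hence "(\<Sum>n\<in>{1..Suc N}. real n powr (- 1 / 2) * max 0 (2 * a - ln (real n))) \<le>
        16 * exp (a / 2) * min (real N powr (1 / 4)) (exp (a / 2))" using Suc by simp
    also have "\<dots> \<le> 16 * exp (a / 2) * min (?n powr (1 / 4)) (exp (a / 2))"
      by (intro mult_left_mono min.mono powr_mono2) auto
    finally show ?thesis .
  next
    case True
    define p q where "p = ?n powr (1 / 4)" and "q = real N powr (1 / 4)"
    have p: "p > 0" "p = exp (ln ?n / 4)" by (auto simp: p_def powr_def)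
    have q: "q \<ge> 0" "q \<le> p" by (auto simp: p_def q_def intro!: powr_mono2)
    have p2: "?n powr (- 1 / 2) = 1 / p ^ 2"
    proof -
      have "p ^ 2 = ?n powr (1 / 2)" by (simp add: p_def powr_power)
      thus ?thesis by (simp add: powr_minus field_simps)
    qed
    have pe: "p \<le> exp (a / 2)" using True p by simp
    have p4: "p ^ 4 = ?n" by (simp add: p_def powr_power)
    have q4: "q ^ 4 = real N" by (cases "N = 0") (simp_all add: q_def powr_power)
    have "1 = p ^ 4 - q ^ 4" unfolding p4 q4 by simp
    also have "\<dots> = (p - q) * (p ^ 3 + p ^ 2 * q + p * q ^ 2 + q ^ 3)"
      by (simp add: eval_nat_numeral algebra_simps)
    also have "\<dots> \<le> (p - q) * (p ^ 3 + p ^ 2 * p + p * p ^ 2 + p ^ 3)"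
      using p q by (intro mult_left_mono add_mono power_mono) auto
    also have "\<dots> = 4 * (p - q) * p ^ 3" by (simp add: eval_nat_numeral algebra_simps)
    finally have d: "1 / p ^ 3 \<le> 4 * (p - q)" using p by (simp add: field_simps)
    have "2 * a - ln ?n = 4 * (a / 2 - ln ?n / 4)" by simp
    also have "\<dots> \<le> 4 * exp (a / 2 - ln ?n / 4)"
    proof -
      have "y \<le> exp y" for y :: real using exp_ge_add_one_self[of y] by linarith
      thus ?thesis by (intro mult_left_mono) auto
    qed
    also have "exp (a / 2 - ln ?n / 4) = exp (a / 2) / p" by (simp add: p exp_diff)
    finally have "max 0 (2 * a - ln ?n) \<le> 4 * (exp (a / 2) / p)" using p by simp
    hence "?n powr (- 1 / 2) * max 0 (2 * a - ln ?n) \<le> ?n powr (- 1 / 2) * (4 * (exp (a / 2) / p))"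
      by (intro mult_left_mono) auto
    also have "?n powr (- 1 / 2) * (4 * (exp (a / 2) / p)) = 1 / p ^ 2 * (4 * (exp (a / 2) / p))"
      unfolding p2 ..
    also have "1 / p ^ 2 * (4 * (exp (a / 2) / p)) = 4 * exp (a / 2) * (1 / p ^ 3)"
      by (simp add: eval_nat_numeral)
    also have "\<dots> \<le> 4 * exp (a / 2) * (4 * (p - q))" by (intro mult_left_mono d) auto
    also have "\<dots> = 16 * exp (a / 2) * (p - q)" by (simp add: algebra_simps)
    finally have t: "?n powr (- 1 / 2) * max 0 (2 * a - ln ?n) \<le> 16 * exp (a / 2) * (p - q)"
      unfolding p2 .
    have "(\<Sum>n\<in>{1..N}. real n powr (- 1 / 2) * max 0 (2 * a - ln (real n))) \<le> 16 * exp (a / 2) * q"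
      using Suc q pe by (simp add: q_def min_def split: if_splits)
    hence "(\<Sum>n\<in>{1..Suc N}. real n powr (- 1 / 2) * max 0 (2 * a - ln (real n))) \<le>
       16 * exp (a / 2) * q + 16 * exp (a / 2) * (p - q)" using t by simp
    also have "\<dots> = 16 * exp (a / 2) * p" by (simp add: algebra_simps)
    finally show ?thesis using pe by (simp add: p_def min_def)
  qed
qed auto

text \<open>
  The tent centred at \<open>ln n = L\<close> produces the main term exactly, the one centred at \<open>ln n = -L\<close> vanishes because of
  \<open>2 * a \<le> L\<close>, and the one centred at 0 is estimated by \<open>sum_tent_le\<close> with \<open>log_coeff n \<le> 1\<close>.
\<close>

lemma transform_sum_estimate:
  assumes a: "a \<ge> 0" "2 * a \<le> L" "\<bar>\<sigma>\<bar> = 1"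
  defines "N0 \<equiv> nat \<lceil>exp (L + 2 * a)\<rceil>"
  shows "\<And>n. n \<ge> N0 \<Longrightarrow> kernel_transform a L \<sigma> (ln (real n)) = 0"
    and "cmod ((\<Sum>n<N0. of_real (log_coeff n) / of_nat n powr Complex (1 / 2) t * kernel_transform a L \<sigma> (ln (real n)))
      - \<i> * pi / 2 * (\<Sum>\<^sub>\<infinity>n\<in>{2..}. mangoldt n * of_real (tent a (L - ln (real n))) /
          (of_real (ln (real n)) * of_nat n powr Complex (1 / 2) t))) \<le> 24 * pi * exp a"
proof -
  have ln_ge: "ln (real n) \<ge> L + 2 * a" "n > 0" if n: "n \<ge> N0" for n
  proof -
    have e: "exp (L + 2 * a) \<le> real n" using n unfolding N0_def by linarith
    hence n0: "real n > 0" using exp_gt_zero[of "L + 2 * a"] by linarith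
    thus "n > 0" by simp
    show "ln (real n) \<ge> L + 2 * a" using e n0 by (simp add: ln_ge_iff)
  qed
  have t0: "tent a b = 0" if "\<bar>b\<bar> \<ge> 2 * a" for b using that by (simp add: tent_def)
  show kt0: "kernel_transform a L \<sigma> (ln (real n)) = 0" if n: "n \<ge> N0" for n
    using ln_ge[OF n] a by (simp add: kernel_transform_def t0)
  (* Only finitely many tents around L are nonzero, so the infinite sum is S below. *)
  define c where "c = (\<lambda>n. of_real (log_coeff n) / of_nat n powr Complex (1 / 2) t :: complex)"
  define S where "S = (\<Sum>n<N0. c n * of_real (tent a (L - ln (real n))))"
  have "(\<Sum>\<^sub>\<infinity>n\<in>{2..}. mangoldt n * of_real (tent a (L - ln (real n))) /
          (of_real (ln (real n)) * of_nat n powr Complex (1 / 2) t)) =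
        (\<Sum>\<^sub>\<infinity>n\<in>{..<N0}. c n * of_real (tent a (L - ln (real n))))"
  proof (rule infsum_cong_neutral)
    fix n assume "n \<in> {2..} - {..<N0}"
    hence "n \<ge> N0" by simp
    hence "tent a (L - ln (real n)) = 0" using ln_ge[of n] a by (intro t0) auto
    thus "mangoldt n * of_real (tent a (L - ln (real n))) /
          (of_real (ln (real n)) * of_nat n powr Complex (1 / 2) t) = 0" by simp
  next
    fix n :: nat assume "n \<in> {..<N0} - {2..}"
    hence "n = 0 \<or> n = Suc 0" by auto
    thus "c n * of_real (tent a (L - ln (real n))) = 0" by (auto simp: c_def)
  next
    fix n :: nat
    have "complex_of_real (log_coeff n) = mangoldt n / of_real (ln (real n))"
      by (simp add: log_coeff_def)
    thus "mangoldt n * of_real (tent a (L - ln (real n))) /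
          (of_real (ln (real n)) * of_nat n powr Complex (1 / 2) t) = c n * of_real (tent a (L - ln (real n)))"
      by (simp add: c_def)
  qed
  hence S: "(\<Sum>\<^sub>\<infinity>n\<in>{2..}. mangoldt n * of_real (tent a (L - ln (real n))) /
          (of_real (ln (real n)) * of_nat n powr Complex (1 / 2) t)) = S" by (simp add: S_def)
  have diff: "c n * kernel_transform a L \<sigma> (ln (real n)) - \<i> * pi / 2 * (c n * of_real (tent a (L - ln (real n))))
     = c n * (of_real (3 * pi / 2 * \<sigma>) * of_real (tent a (ln (real n))))" for n
  proof (cases "n = 0")
    case False
    hence "ln (real n) \<ge> 0" by simp
    hence "tent a (L + ln (real n)) = 0" using a by (intro t0) auto
    thus ?thesis by (simp add: kernel_transform_def algebra_simps)
  qed (simp add: c_def)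
  have "(\<Sum>n<N0. c n * kernel_transform a L \<sigma> (ln (real n))) - \<i> * pi / 2 * S =
      (\<Sum>n<N0. c n * (of_real (3 * pi / 2 * \<sigma>) * of_real (tent a (ln (real n)))))"
    unfolding S_def sum_distrib_left sum_subtractf[symmetric] diff ..
  also have "cmod \<dots> \<le> (\<Sum>n<N0. 3 * pi / 2 * (real n powr (- 1 / 2) * tent a (ln (real n))))"
  proof (rule sum_norm_le)
    fix n
    show "cmod (c n * (of_real (3 * pi / 2 * \<sigma>) * of_real (tent a (ln (real n)))))
       \<le> 3 * pi / 2 * (real n powr (- 1 / 2) * tent a (ln (real n)))"
    proof (cases "n = 0")
      case False
      have c: "cmod (c n) \<le> real n powr (- 1 / 2)"
        unfolding c_def by (rule norm_log_coeff_term) (use False in simp)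
      have tn: "tent a (ln (real n)) \<ge> 0" by (simp add: tent_def)
      have "cmod (c n * (of_real (3 * pi / 2 * \<sigma>) * of_real (tent a (ln (real n))))) =
         cmod (c n) * (3 * pi / 2 * tent a (ln (real n)))"
        unfolding norm_mult norm_of_real using a(3) tn by (simp add: abs_mult)
      also have "\<dots> \<le> real n powr (- 1 / 2) * (3 * pi / 2 * tent a (ln (real n)))"
        using tn by (intro mult_right_mono c mult_nonneg_nonneg) auto
      finally show ?thesis by (simp add: mult_ac)
    qed (simp add: c_def)
  qed
  also have "\<dots> = 3 * pi / 2 * (\<Sum>n<N0. real n powr (- 1 / 2) * tent a (ln (real n)))"
    by (simp only: sum_distrib_left)
  also have "(\<Sum>n<N0. real n powr (- 1 / 2) * tent a (ln (real n))) \<le>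
      (\<Sum>n\<in>{1..N0}. real n powr (- 1 / 2) * max 0 (2 * a - ln (real n)))"
  proof -
    have "(\<Sum>n<N0. real n powr (- 1 / 2) * tent a (ln (real n))) =
       (\<Sum>n\<in>{1..<N0}. real n powr (- 1 / 2) * tent a (ln (real n)))"
      by (rule sum.mono_neutral_right) auto
    also have "\<dots> = (\<Sum>n\<in>{1..<N0}. real n powr (- 1 / 2) * max 0 (2 * a - ln (real n)))"
      by (intro sum.cong) (auto simp: tent_def)
    also have "\<dots> \<le> (\<Sum>n\<in>{1..N0}. real n powr (- 1 / 2) * max 0 (2 * a - ln (real n)))"
      by (intro sum_mono2) auto
    finally show ?thesis .
  qed
  also have "\<dots> \<le> 16 * exp (a / 2) * min (real N0 powr (1 / 4)) (exp (a / 2))"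
    by (rule sum_tent_le[OF a(1)])
  also have "\<dots> \<le> 16 * exp (a / 2) * exp (a / 2)" by (intro mult_left_mono) auto
  also have "\<dots> = 16 * exp a" by (simp flip: exp_add)
  finally have "cmod ((\<Sum>n<N0. c n * kernel_transform a L \<sigma> (ln (real n))) - \<i> * pi / 2 * S)
      \<le> 3 * pi / 2 * (16 * exp a)" by simp
  thus "cmod ((\<Sum>n<N0. of_real (log_coeff n) / of_nat n powr Complex (1 / 2) t * kernel_transform a L \<sigma> (ln (real n)))
      - \<i> * pi / 2 * (\<Sum>\<^sub>\<infinity>n\<in>{2..}. mangoldt n * of_real (tent a (L - ln (real n))) /
          (of_real (ln (real n)) * of_nat n powr Complex (1 / 2) t))) \<le> 24 * pi * exp a"
    unfolding S by (simp add: c_def)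
qed

text \<open>
  These inequalities keep the segment \<open>t - H..t + H\<close> away from the real axis and make \<open>ln (t + H) \<le> 2 * ln T\<close>.
\<close>

lemma parameter_range:
  assumes "0 < (\<beta> :: real)"
  shows "\<forall>\<^sub>F T in at_top. ln T \<ge> 1 \<and> T \<ge> 1 \<and> T powr \<beta> - ln T ^ 3 \<ge> 5 \<and> T * ln T + ln T ^ 3 \<le> T\<^sup>2"
proof -
  have "\<forall>\<^sub>F T::real in at_top. ln T \<ge> 1" by real_asymp
  moreover have "\<forall>\<^sub>F T::real in at_top. T powr \<beta> - ln T ^ 3 \<ge> 5" using assms by real_asymp
  moreover have "\<forall>\<^sub>F T::real in at_top. T * ln T + ln T ^ 3 \<le> T\<^sup>2" by real_asymp
  ultimately show ?thesis using eventually_ge_at_top[of 1] by eventually_elim auto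
qed

theorem proposition3:
  fixes \<beta> lam :: real
  assumes "riemann_hypothesis"
    and "0 < \<beta>" "\<beta> < 1"
    and "0 < lam" "lam < 1 / 2"
  shows "\<exists>C T0 :: real. \<forall>T\<ge>T0. \<forall>t. T powr \<beta> \<le> t \<and> t \<le> T * ln T \<longrightarrow>
    (\<forall>\<sigma>\<in>{1, -1 :: real}.
      let L = ln (ln T);
          w = (\<lambda>n :: nat. max 0 (2 * lam * L - \<bar>L - ln (real n)\<bar>));
          F = (\<lambda>u. log_zeta (Complex (1 / 2) (t + u)) *
                complex_of_real (fejer_factor (lam * L) u * (\<sigma> * 3 - 2 * sin (u * L))));
          S = (\<Sum>\<^sub>\<infinity>n\<in>{2..}. mangoldt n * complex_of_real (w n) /
                (complex_of_real (ln (real n)) * of_nat n powr Complex (1 / 2) t))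
      in F absolutely_integrable_on {- (ln T ^ 3) .. ln T ^ 3} \<and>
         cmod (integral {- (ln T ^ 3) .. ln T ^ 3} F - \<i> * pi / 2 * S) \<le> C * ln T powr lam)"
proof -
  obtain C where C: "C > 0" and shift: "\<And>a L \<sigma> t H. a \<ge> 0 \<Longrightarrow> L \<ge> 0 \<Longrightarrow> \<bar>\<sigma>\<bar> = 1 \<Longrightarrow> H \<ge> 1 \<Longrightarrow> t - H \<ge> 5 \<Longrightarrow>
    (\<lambda>u. log_zeta (Complex (1 / 2) (t + u)) * fejer_kernel a L \<sigma> (of_real u)) absolutely_integrable_on {-H..H} \<and>
    cmod (integral {-H..H} (\<lambda>u. log_zeta (Complex (1 / 2) (t + u)) * fejer_kernel a L \<sigma> (of_real u)) -
          integral {-H..H} (\<lambda>u. log_zeta (Complex 2 (t + u)) * fejer_kernel a L \<sigma> (Complex u (- (3 / 2)))))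
      \<le> C * ln (t + H) * exp ((2 * a + L) * (3 / 2)) / H\<^sup>2"
    using shift_log_zeta_integral[OF assms(1)] by blast
  define B where "B = (\<Sum>n. real n powr (-2))"
  have B: "B \<ge> 0" unfolding B_def by (intro suminf_nonneg) (auto simp: summable_real_powr_iff)
  obtain T0 where T0: "\<And>T. T \<ge> T0 \<Longrightarrow> ln T \<ge> 1 \<and> T \<ge> 1 \<and> T powr \<beta> - ln T ^ 3 \<ge> 5 \<and> T * ln T + ln T ^ 3 \<le> T\<^sup>2"
    using parameter_range[OF assms(2)] by (auto simp: eventually_at_top_linorder)
  have main: "(\<lambda>u. log_zeta (Complex (1 / 2) (t + u)) *
              complex_of_real (fejer_factor (lam * ln (ln T)) u * (\<sigma> * 3 - 2 * sin (u * ln (ln T)))))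
              absolutely_integrable_on {- (ln T ^ 3) .. ln T ^ 3} \<and>
       cmod (integral {- (ln T ^ 3) .. ln T ^ 3} (\<lambda>u. log_zeta (Complex (1 / 2) (t + u)) *
              complex_of_real (fejer_factor (lam * ln (ln T)) u * (\<sigma> * 3 - 2 * sin (u * ln (ln T))))) - 
           \<i> * pi / 2 * (\<Sum>\<^sub>\<infinity>n\<in>{2..}. mangoldt n * complex_of_real (max 0 (2 * lam * ln (ln T) - \<bar>ln (ln T) - ln (real n)\<bar>)) /
                (complex_of_real (ln (real n)) * of_nat n powr Complex (1 / 2) t)))
         \<le> (2 * C + 10 * B + 24 * pi) * ln T powr lam"
    if T: "T \<ge> T0" and t: "T powr \<beta> \<le> t" "t \<le> T * ln T" and \<sigma>: "\<bar>\<sigma>\<bar> = 1" for T t \<sigma>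
  proof -
    define L where "L = ln (ln T)"
    define a where "a = lam * L"
    define H where "H = ln T ^ 3"
    define E where "E = exp ((2 * a + L) * (3 / 2))"
    have lnT: "ln T \<ge> 1" "T \<ge> 1" and rng: "T powr \<beta> - H \<ge> 5" "T * ln T + H \<le> T\<^sup>2"
      using T0[OF T] by (auto simp: H_def)
    have L: "L \<ge> 0" using lnT by (simp add: L_def)
    have a: "a \<ge> 0" "2 * a \<le> L"
      using L assms(4,5) mult_right_mono[of "2 * lam" 1 L] by (auto simp: a_def)
    have H: "H \<ge> 1" using lnT by (simp add: H_def)
    (* This is where 2 * lam \<le> 1 enters: the growth of the kernel is at most H. *)
    have EH: "E \<le> H"
    proof -
      have "E \<le> exp (3 * L)" unfolding E_def using a by simp
      also have "exp (3 * L) = exp L ^ 3" using exp_of_nat_mult[of 3 L] by simp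
      also have "exp L = ln T" unfolding L_def by (rule exp_ln) (use lnT in linarith)
      finally show ?thesis by (simp only: H_def)
    qed
    have tH: "t - H \<ge> 5" using t rng by linarith
    have ln_tH: "ln (t + H) \<le> 2 * ln T"
    proof -
      have "ln (t + H) \<le> ln (T\<^sup>2)" using t rng tH H by (intro ln_mono) linarith+
      also have "\<dots> = 2 * ln T" using lnT by (simp add: ln_realpow)
      finally show ?thesis .
    qed
    have "ln T \<noteq> 0" using lnT by linarith
    hence ea: "exp a = ln T powr lam" by (simp add: a_def L_def powr_def mult.commute)
    have ea1: "exp a \<ge> 1" using a by simp
    define F where "F = (\<lambda>u. log_zeta (Complex (1 / 2) (t + u)) * fejer_kernel a L \<sigma> (of_real u))"
    define I2 where "I2 = integral {-H..H} (\<lambda>u. log_zeta (Complex 2 (t + u)) * fejer_kernel a L \<sigma> (Complex u (- (3 / 2))))"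
    define V where "V = (\<Sum>n<nat \<lceil>exp (L + 2 * a)\<rceil>. of_real (log_coeff n) / of_nat n powr Complex (1 / 2) t *
        kernel_transform a L \<sigma> (ln (real n)))"
    define S where "S = (\<Sum>\<^sub>\<infinity>n\<in>{2..}. mangoldt n * complex_of_real (tent a (L - ln (real n))) /
                (complex_of_real (ln (real n)) * of_nat n powr Complex (1 / 2) t))"
    have F: "F absolutely_integrable_on {-H..H}" and 1: "cmod (integral {-H..H} F - I2) \<le> 2 * C"
    proof -
      from shift[OF a(1) L \<sigma> H tH] show "F absolutely_integrable_on {-H..H}" by (simp add: F_def)
      from shift[OF a(1) L \<sigma> H tH] have "cmod (integral {-H..H} F - I2) \<le> C * ln (t + H) * E / H\<^sup>2"
        by (simp add: F_def I2_def E_def)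
      also have "\<dots> \<le> C * (2 * ln T) * H / H\<^sup>2"
        using C ln_tH EH H lnT tH by (intro divide_right_mono mult_mono mult_nonneg_nonneg) (auto simp: E_def)
      also have "\<dots> = 2 * C * (ln T / H)" using H by (simp add: power2_eq_square)
      also have "\<dots> \<le> 2 * C * 1"
      proof -
        have "ln T ^ 1 \<le> ln T ^ 3" using lnT by (intro power_increasing) auto
        hence "ln T \<le> H" by (simp add: H_def)
        hence "ln T / H \<le> 1" using H by (subst divide_le_eq_1_pos) auto
        thus ?thesis using C by (intro mult_left_mono) auto
      qed
      finally show "cmod (integral {-H..H} F - I2) \<le> 2 * C" by simp
    qed
    have 2: "cmod (I2 - V) \<le> 10 * B"
    proof -
      have I2: "I2 = integral {-H..H} (\<lambda>u. dirichlet_log (Complex 2 (t + u)) * fejer_kernel a L \<sigma> (Complex u (- (3 / 2))))"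
        by (simp add: I2_def log_zeta_eq_dirichlet[OF assms(1)])
      have "H > 0" using H by simp
      have "cmod (I2 - V) \<le> B * (10 * E / H)"
        unfolding I2 V_def B_def E_def
        by (rule dirichlet_integral[OF a(1) L \<sigma> \<open>H > 0\<close>]) (rule transform_sum_estimate(1)[OF a \<sigma>])
      also have "\<dots> \<le> B * 10" using EH H B by (intro mult_left_mono) (auto simp: divide_le_eq)
      finally show ?thesis by simp
    qed
    have 3: "cmod (V - \<i> * pi / 2 * S) \<le> 24 * pi * exp a"
      unfolding V_def S_def by (rule transform_sum_estimate(2)[OF a \<sigma>])
    have "integral {-H..H} F - \<i> * pi / 2 * S = (integral {-H..H} F - I2) + ((I2 - V) + (V - \<i> * pi / 2 * S))" by simp
    also have "cmod \<dots> \<le> 2 * C + (10 * B + 24 * pi * exp a)"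
      by (intro norm_triangle_le add_mono 1 2 3)
    also have "\<dots> \<le> 2 * C * exp a + (10 * B * exp a + 24 * pi * exp a)"
    proof -
      have "2 * C * 1 \<le> 2 * C * exp a" "10 * B * 1 \<le> 10 * B * exp a"
        using C B by (intro mult_left_mono[OF ea1]; simp)+
      thus ?thesis by linarith
    qed
    also have "\<dots> = (2 * C + 10 * B + 24 * pi) * ln T powr lam" by (simp add: ea algebra_simps)
    finally have "cmod (integral {-H..H} F - \<i> * pi / 2 * S) \<le> (2 * C + 10 * B + 24 * pi) * ln T powr lam" .
    with F show ?thesis
      by (simp only: F_def S_def H_def kernel_of_real tent_def a_def L_def mult.assoc)
  qed
  show ?thesis
  proof (rule exI[of _ "2 * C + 10 * B + 24 * pi"], rule exI[of _ T0], intro allI impI ballI)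
    fix T t \<sigma> :: real
    assume "T0 \<le> T" "T powr \<beta> \<le> t \<and> t \<le> T * ln T" "\<sigma> \<in> {1, -1}"
    thus "let L = ln (ln T);
          w = (\<lambda>n :: nat. max 0 (2 * lam * L - \<bar>L - ln (real n)\<bar>));
          F = (\<lambda>u. log_zeta (Complex (1 / 2) (t + u)) *
                complex_of_real (fejer_factor (lam * L) u * (\<sigma> * 3 - 2 * sin (u * L))));
          S = (\<Sum>\<^sub>\<infinity>n\<in>{2..}. mangoldt n * complex_of_real (w n) /
                (complex_of_real (ln (real n)) * of_nat n powr Complex (1 / 2) t))
      in F absolutely_integrable_on {- (ln T ^ 3) .. ln T ^ 3} \<and>
         cmod (integral {- (ln T ^ 3) .. ln T ^ 3} F - \<i> * pi / 2 * S) \<le> (2 * C + 10 * B + 24 * pi) * ln T powr lam"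
      unfolding Let_def by (intro main) auto
  qed
qed

end
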